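(* Let $(N,\gamma)$ be a (pseudo-)Riemannian manifold of dimension $n-1$, and let $(M,g)$ be its metric cone, that is, $M=N\times\mathbb{R}^+$ with the metric $$g=dr^2+r^2\gamma ,$$ where $r$ is the coordinate on $\mathbb{R}^+=(0,\infty)$. Then $(M,g)$ (i.e. the Levi--Civita connection of $g$) admits a metric projective compactification of order $1$.
   Context: Let $\overline{M}=M\cup\partial M$ be a manifold with non-empty boundary $\partial M$ and interior $M$. An affine connection $\nabla$ on $M$ admits a projective compactification of order $\alpha$ to $\overline{M}$ if there exists a (smooth) function $T:\overline{M}\to\mathbb{R}$ such that $\{T=0\}=\partial M$, $dT$ does not vanish on $\partial M$, and the connection $\overline{\nabla}$ on $M$ defined by $$\overline{\nabla}_XY=\nabla_XY+\Upsilon(X)Y+\Upsilon(Y)X,\qquad \Upsilon=\frac{dT}{\alpha T},$$ extends smoothly to $\partial M$. The projective compactification is called metric if $\overline{\nabla}$ is the Levi--Civita connection of some (pseudo-)Riemannian metric $\overline{g}$ on $\overline{M}$. *)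

theory Defs
  imports "HOL-Analysis.Analysis"
begin

section \<open>Smooth maps between subsets of Euclidean spaces\<close>

text \<open>Only meaningful for open \<^term>\<open>S\<close>: all iterated directional derivatives up to order
  \<^term>\<open>k\<close> exist as Frechet derivatives and are continuous.\<close>

primrec Ck_on :: "nat \<Rightarrow> ('e::euclidean_space \<Rightarrow> 'f::real_normed_vector) \<Rightarrow> 'e set \<Rightarrow> bool" where
  "Ck_on 0 f S \<longleftrightarrow> continuous_on S f"
| "Ck_on (Suc k) f S \<longleftrightarrow>
     (\<forall>x\<in>S. f differentiable at x) \<and> (\<forall>v. Ck_on k (\<lambda>x. frechet_derivative f (at x) v) S)"

text \<open>The usual convention for subsets that need not be open (here: relatively open subsets of
  a half-space): a map is smooth if it extends smoothly to a neighbourhood of each point.\<close>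

definition smooth_on :: "('e::euclidean_space \<Rightarrow> 'f::real_normed_vector) \<Rightarrow> 'e set \<Rightarrow> bool" where
  "smooth_on f S \<longleftrightarrow>
     (\<forall>x\<in>S. \<exists>U h. open U \<and> x \<in> U \<and> (\<forall>k. Ck_on k h U) \<and> (\<forall>y\<in>U \<inter> S. h y = f y))"


section \<open>Manifolds with or without boundary\<close>

text \<open>A chart is a pair of its domain and its coordinate map.\<close>

type_synonym ('a, 'e) chart = "'a set \<times> ('a \<Rightarrow> 'e)"

record ('a, 'e) mfd =
  mtop :: "'a topology"
  charts :: "('a, 'e) chart set"

abbreviation points :: "('a, 'e) mfd \<Rightarrow> 'a set" where
  "points M \<equiv> topspace (mtop M)"

definition charts_at :: "('a, 'e) mfd \<Rightarrow> 'a \<Rightarrow> ('a, 'e) chart set" where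
  "charts_at M p = {c \<in> charts M. p \<in> fst c}"

text \<open>The local representative of \<^term>\<open>F\<close> in the charts \<^term>\<open>c\<close>, \<^term>\<open>d\<close>, and the set of
  coordinate values on which it is defined.\<close>

definition local_rep :: "('a \<Rightarrow> 'b) \<Rightarrow> ('a, 'e) chart \<Rightarrow> ('b, 'f) chart \<Rightarrow> 'e \<Rightarrow> 'f" where
  "local_rep F c d = snd d \<circ> F \<circ> inv_into (fst c) (snd c)"

definition local_dom :: "('a \<Rightarrow> 'b) \<Rightarrow> ('a, 'e) chart \<Rightarrow> ('b, 'f) chart \<Rightarrow> 'e set" where
  "local_dom F c d = snd c ` (fst c \<inter> F -` fst d)"

text \<open>Charts take values in relatively open subsets of the model \<^term>\<open>H\<close>, which is the whole
  space for manifolds without boundary and a closed half-space for manifolds with boundary.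
  The dimension is that of the type \<^typ>\<open>'e\<close>. Manifolds are nonempty by convention; the atlas need
  not be maximal.\<close>

definition smooth_manifold_on :: "'e::euclidean_space set \<Rightarrow> ('a, 'e) mfd \<Rightarrow> bool" where
  "smooth_manifold_on H M \<longleftrightarrow>
     Hausdorff_space (mtop M) \<and> second_countable (mtop M) \<and> points M \<noteq> {} \<and>
     (\<Union>c\<in>charts M. fst c) = points M \<and>
     (\<forall>c\<in>charts M. openin (mtop M) (fst c) \<and>
        openin (top_of_set H) (snd c ` fst c) \<and>
        homeomorphic_map (subtopology (mtop M) (fst c)) (top_of_set (snd c ` fst c)) (snd c)) \<and>
     (\<forall>c\<in>charts M. \<forall>d\<in>charts M. smooth_on (local_rep id c d) (local_dom id c d))"

definition smooth_manifold :: "('a, 'e::euclidean_space) mfd \<Rightarrow> bool" where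
  "smooth_manifold M \<longleftrightarrow> smooth_manifold_on UNIV M"

definition smooth_manifold_with_boundary ::
  "('a, 'e::euclidean_space \<times> real) mfd \<Rightarrow> bool" where
  "smooth_manifold_with_boundary M \<longleftrightarrow> smooth_manifold_on {x. 0 \<le> snd x} M"

definition boundary_points :: "('a, 'e \<times> real) mfd \<Rightarrow> 'a set" where
  "boundary_points M = {p \<in> points M. \<exists>c\<in>charts_at M p. snd (snd c p) = 0}"

definition interior_points :: "('a, 'e \<times> real) mfd \<Rightarrow> 'a set" where
  "interior_points M = {p \<in> points M. \<exists>c\<in>charts_at M p. 0 < snd (snd c p)}"

definition open_submanifold :: "('a, 'e) mfd \<Rightarrow> 'a set \<Rightarrow> ('a, 'e) mfd" where
  "open_submanifold M W =
     \<lparr>mtop = subtopology (mtop M) W, charts = (\<lambda>c. (fst c \<inter> W, snd c)) ` charts M\<rparr>"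

definition prod_manifold :: "('a, 'e) mfd \<Rightarrow> ('b, 'f) mfd \<Rightarrow> ('a \<times> 'b, 'e \<times> 'f) mfd" where
  "prod_manifold M N =
     \<lparr>mtop = prod_topology (mtop M) (mtop N),
      charts = (\<lambda>(c, d). (fst c \<times> fst d, map_prod (snd c) (snd d))) ` (charts M \<times> charts N)\<rparr>"

definition smooth_function :: "('a, 'e::euclidean_space) mfd \<Rightarrow> ('a \<Rightarrow> real) \<Rightarrow> bool" where
  "smooth_function M f \<longleftrightarrow>
     (\<forall>c\<in>charts M. smooth_on (f \<circ> inv_into (fst c) (snd c)) (snd c ` fst c))"

definition smooth_map ::
  "('a, 'e::euclidean_space) mfd \<Rightarrow> ('b, 'f::euclidean_space) mfd \<Rightarrow> ('a \<Rightarrow> 'b) \<Rightarrow> bool" where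
  "smooth_map M N F \<longleftrightarrow> continuous_map (mtop M) (mtop N) F \<and>
     (\<forall>c\<in>charts M. \<forall>d\<in>charts N. smooth_on (local_rep F c d) (local_dom F c d))"

definition diffeomorphism ::
  "('a, 'e::euclidean_space) mfd \<Rightarrow> ('b, 'f::euclidean_space) mfd \<Rightarrow> ('a \<Rightarrow> 'b) \<Rightarrow> bool" where
  "diffeomorphism M N F \<longleftrightarrow> bij_betw F (points M) (points N) \<and>
     smooth_map M N F \<and> smooth_map N M (inv_into (points M) F)"


section \<open>Tangent vectors and vector fields\<close>

text \<open>The derivative is taken within the domain of the local representative, so that it also makes
  sense at boundary points, where the domain is relatively open in a half-space.\<close>

definition local_deriv ::
  "('a \<Rightarrow> 'b) \<Rightarrow> ('a, 'e::euclidean_space) chart \<Rightarrow> ('b, 'f::euclidean_space) chart \<Rightarrow> 'a \<Rightarrow> 'e \<Rightarrow> 'f" where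
  "local_deriv F c d p = frechet_derivative (local_rep F c d) (at (snd c p) within local_dom F c d)"

text \<open>A tangent vector at \<^term>\<open>p\<close> assigns to each chart around \<^term>\<open>p\<close> a coordinate vector, and
  these are related by the derivatives of the transition maps. For definiteness it is zero on
  everything that is not a chart around \<^term>\<open>p\<close>, so that equality of tangent vectors is equality of
  functions.\<close>

type_synonym ('a, 'e) tangent = "('a, 'e) chart \<Rightarrow> 'e"

definition tangent_space :: "('a, 'e::euclidean_space) mfd \<Rightarrow> 'a \<Rightarrow> ('a, 'e) tangent set" where
  "tangent_space M p =
     {v. (\<forall>c. c \<notin> charts_at M p \<longrightarrow> v c = 0) \<and>
         (\<forall>c\<in>charts_at M p. \<forall>d\<in>charts_at M p. v d = local_deriv id c d p (v c))}"

text \<open>The tangent vector at \<^term>\<open>p\<close> whose coordinate vector in the chart \<^term>\<open>c\<close> is \<^term>\<open>u\<close>.\<close>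

definition coord_vector ::
  "('a, 'e::euclidean_space) mfd \<Rightarrow> ('a, 'e) chart \<Rightarrow> 'a \<Rightarrow> 'e \<Rightarrow> ('a, 'e) tangent" where
  "coord_vector M c p u = (\<lambda>d. if d \<in> charts_at M p then local_deriv id c d p u else 0)"

definition some_chart :: "('a, 'e) mfd \<Rightarrow> 'a \<Rightarrow> ('a, 'e) chart" where
  "some_chart M p = (SOME c. c \<in> charts_at M p)"

definition differential ::
  "('a, 'e::euclidean_space) mfd \<Rightarrow> ('b, 'f::euclidean_space) mfd \<Rightarrow> ('a \<Rightarrow> 'b) \<Rightarrow> 'a \<Rightarrow>
    ('a, 'e) tangent \<Rightarrow> ('b, 'f) tangent" where
  "differential M N F p v =
     (\<lambda>d. if d \<in> charts_at N (F p)
          then local_deriv F (some_chart M p) d p (v (some_chart M p)) else 0)"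

text \<open>The value \<open>df\<^sub>p(v)\<close> for a real function \<^term>\<open>f\<close>.\<close>

definition dfun ::
  "('a, 'e::euclidean_space) mfd \<Rightarrow> ('a \<Rightarrow> real) \<Rightarrow> 'a \<Rightarrow> ('a, 'e) tangent \<Rightarrow> real" where
  "dfun M f p v =
     (let c = some_chart M p in
      frechet_derivative (f \<circ> inv_into (fst c) (snd c)) (at (snd c p) within snd c ` fst c) (v c))"

text \<open>Vector fields vanish off the manifold, again to make equality extensional.\<close>

type_synonym ('a, 'e) vfield = "'a \<Rightarrow> ('a, 'e) tangent"

definition vector_fields :: "('a, 'e::euclidean_space) mfd \<Rightarrow> ('a, 'e) vfield set" where
  "vector_fields M =
     {X. (\<forall>p\<in>points M. X p \<in> tangent_space M p) \<and>
         (\<forall>p. p \<notin> points M \<longrightarrow> X p = (\<lambda>c. 0)) \<and>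
         (\<forall>c\<in>charts M. smooth_on (\<lambda>x. X (inv_into (fst c) (snd c) x) c) (snd c ` fst c))}"

definition vf_add ::
  "('a, 'e::real_vector) vfield \<Rightarrow> ('a, 'e) vfield \<Rightarrow> ('a, 'e) vfield" where
  "vf_add X Y = (\<lambda>p c. X p c + Y p c)"

definition vf_scale :: "('a \<Rightarrow> real) \<Rightarrow> ('a, 'e::real_vector) vfield \<Rightarrow> ('a, 'e) vfield" where
  "vf_scale f X = (\<lambda>p c. f p *\<^sub>R X p c)"

definition vf_apply ::
  "('a, 'e::euclidean_space) mfd \<Rightarrow> ('a, 'e) vfield \<Rightarrow> ('a \<Rightarrow> real) \<Rightarrow> 'a \<Rightarrow> real" where
  "vf_apply M X f = (\<lambda>p. dfun M f p (X p))"


section \<open>Metrics and connections\<close>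

text \<open>Nondegeneracy is imposed pointwise and no condition is put on the signature, which is
  therefore constant on connected components. Riemannian metrics are the positive definite case.\<close>

type_synonym ('a, 'e) metric = "'a \<Rightarrow> ('a, 'e) tangent \<Rightarrow> ('a, 'e) tangent \<Rightarrow> real"

definition pseudo_riemannian_metric ::
  "('a, 'e::euclidean_space) mfd \<Rightarrow> ('a, 'e) metric \<Rightarrow> bool" where
  "pseudo_riemannian_metric M g \<longleftrightarrow>
     (\<forall>p\<in>points M.
        (\<forall>u\<in>tangent_space M p. \<forall>v\<in>tangent_space M p. g p u v = g p v u) \<and>
        (\<forall>u\<in>tangent_space M p. \<forall>v\<in>tangent_space M p. \<forall>w\<in>tangent_space M p. \<forall>a b.
           g p (\<lambda>c. a *\<^sub>R u c + b *\<^sub>R v c) w = a * g p u w + b * g p v w) \<and>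
        (\<forall>u\<in>tangent_space M p. (\<forall>v\<in>tangent_space M p. g p u v = 0) \<longrightarrow> u = (\<lambda>c. 0))) \<and>
     (\<forall>c\<in>charts M. \<forall>u v.
        smooth_on (\<lambda>x. let p = inv_into (fst c) (snd c) x
                       in g p (coord_vector M c p u) (coord_vector M c p v)) (snd c ` fst c))"

type_synonym ('a, 'e) connection = "('a, 'e) vfield \<Rightarrow> ('a, 'e) vfield \<Rightarrow> ('a, 'e) vfield"

definition affine_connection ::
  "('a, 'e::euclidean_space) mfd \<Rightarrow> ('a, 'e) connection \<Rightarrow> bool" where
  "affine_connection M nabla \<longleftrightarrow>
     (\<forall>X\<in>vector_fields M. \<forall>Y\<in>vector_fields M. nabla X Y \<in> vector_fields M) \<and>
     (\<forall>X\<in>vector_fields M. \<forall>X'\<in>vector_fields M. \<forall>Y\<in>vector_fields M.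
        nabla (vf_add X X') Y = vf_add (nabla X Y) (nabla X' Y)) \<and>
     (\<forall>X\<in>vector_fields M. \<forall>Y\<in>vector_fields M. \<forall>Y'\<in>vector_fields M.
        nabla X (vf_add Y Y') = vf_add (nabla X Y) (nabla X Y')) \<and>
     (\<forall>X\<in>vector_fields M. \<forall>Y\<in>vector_fields M. \<forall>f. smooth_function M f \<longrightarrow>
        nabla (vf_scale f X) Y = vf_scale f (nabla X Y) \<and>
        nabla X (vf_scale f Y) = vf_add (vf_scale f (nabla X Y)) (vf_scale (vf_apply M X f) Y))"

text \<open>The Lie bracket in the torsion condition enters through its action
  \<open>[X, Y] f = X (Y f) - Y (X f)\<close> on smooth functions.\<close>

definition torsion_free ::
  "('a, 'e::euclidean_space) mfd \<Rightarrow> ('a, 'e) connection \<Rightarrow> bool" where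
  "torsion_free M nabla \<longleftrightarrow>
     (\<forall>X\<in>vector_fields M. \<forall>Y\<in>vector_fields M. \<forall>f. smooth_function M f \<longrightarrow>
        (\<forall>p\<in>points M.
           vf_apply M (nabla X Y) f p - vf_apply M (nabla Y X) f p =
           vf_apply M X (vf_apply M Y f) p - vf_apply M Y (vf_apply M X f) p))"

definition metric_compatible ::
  "('a, 'e::euclidean_space) mfd \<Rightarrow> ('a, 'e) metric \<Rightarrow> ('a, 'e) connection \<Rightarrow> bool" where
  "metric_compatible M g nabla \<longleftrightarrow>
     (\<forall>X\<in>vector_fields M. \<forall>Y\<in>vector_fields M. \<forall>Z\<in>vector_fields M. \<forall>p\<in>points M.
        vf_apply M X (\<lambda>q. g q (Y q) (Z q)) p =
        g p (nabla X Y p) (Z p) + g p (Y p) (nabla X Z p))"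

definition levi_civita ::
  "('a, 'e::euclidean_space) mfd \<Rightarrow> ('a, 'e) metric \<Rightarrow> ('a, 'e) connection \<Rightarrow> bool" where
  "levi_civita M g nabla \<longleftrightarrow>
     affine_connection M nabla \<and> torsion_free M nabla \<and> metric_compatible M g nabla"


section \<open>Projective compactification\<close>

definition projective_change ::
  "('a \<Rightarrow> ('a, 'e) tangent \<Rightarrow> real) \<Rightarrow> ('a, 'e::real_vector) connection \<Rightarrow> ('a, 'e) connection" where
  "projective_change \<Upsilon> nabla X Y =
     (\<lambda>p c. nabla X Y p c + \<Upsilon> p (X p) *\<^sub>R Y p c + \<Upsilon> p (Y p) *\<^sub>R X p c)"

definition related_vf ::
  "('a, 'e::euclidean_space) mfd \<Rightarrow> ('b, 'f::euclidean_space) mfd \<Rightarrow> ('a \<Rightarrow> 'b) \<Rightarrow>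
    ('a, 'e) vfield \<Rightarrow> ('b, 'f) vfield \<Rightarrow> bool" where
  "related_vf M N F X Y \<longleftrightarrow> (\<forall>p\<in>points M. Y (F p) = differential M N F p (X p))"

text \<open>\<^term>\<open>nabla'\<close> is a connection on \<^term>\<open>N\<close> extending the operator \<^term>\<open>nabla\<close> on
  \<^term>\<open>M\<close>, where \<^term>\<open>M\<close> is identified with an open subset of \<^term>\<open>N\<close> by \<^term>\<open>F\<close>; a vector
  field on \<^term>\<open>M\<close> that is \<^term>\<open>F\<close>-related to one on \<^term>\<open>N\<close> is the restriction of the latter.\<close>

definition connection_extends ::
  "('a, 'e::euclidean_space) mfd \<Rightarrow> ('b, 'f::euclidean_space) mfd \<Rightarrow> ('a \<Rightarrow> 'b) \<Rightarrow>
    ('a, 'e) connection \<Rightarrow> ('b, 'f) connection \<Rightarrow> bool" where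
  "connection_extends M N F nabla nabla' \<longleftrightarrow> affine_connection N nabla' \<and>
     (\<forall>X\<in>vector_fields M. \<forall>Y\<in>vector_fields M. \<forall>X'\<in>vector_fields N. \<forall>Y'\<in>vector_fields N.
        related_vf M N F X X' \<longrightarrow> related_vf M N F Y Y' \<longrightarrow>
        related_vf M N F (nabla X Y) (nabla' X' Y'))"

text \<open>The manifold \<^term>\<open>M\<close> is identified with the interior of \<^term>\<open>Mb\<close> by the diffeomorphism
  \<^term>\<open>\<iota>\<close>, and \<^term>\<open>nablab\<close> is the smooth extension to \<^term>\<open>Mb\<close> of the projectively changed
  connection with \<open>\<Upsilon> = dT / (\<alpha> T)\<close>.\<close>

definition projective_compactification ::
  "real \<Rightarrow> ('a, 'e::euclidean_space \<times> real) mfd \<Rightarrow> ('a, 'e \<times> real) connection \<Rightarrow>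
    ('b, 'e \<times> real) mfd \<Rightarrow> ('a \<Rightarrow> 'b) \<Rightarrow> ('b \<Rightarrow> real) \<Rightarrow> ('b, 'e \<times> real) connection \<Rightarrow> bool" where
  "projective_compactification \<alpha> M nabla Mb \<iota> T nablab \<longleftrightarrow>
     smooth_manifold_with_boundary Mb \<and> boundary_points Mb \<noteq> {} \<and>
     diffeomorphism M (open_submanifold Mb (interior_points Mb)) \<iota> \<and>
     smooth_function Mb T \<and> {p \<in> points Mb. T p = 0} = boundary_points Mb \<and>
     (\<forall>p\<in>boundary_points Mb. \<exists>v\<in>tangent_space Mb p. dfun Mb T p v \<noteq> 0) \<and>
     connection_extends M Mb \<iota>
       (projective_change (\<lambda>p v. dfun M (T \<circ> \<iota>) p v / (\<alpha> * T (\<iota> p))) nabla) nablab"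

text \<open>HOL has no quantification over types, so the points of the compactification are taken from
  the point type of \<^term>\<open>M\<close>. Since \<^term>\<open>M\<close> has positive dimension, it has the same cardinality
  as any manifold with boundary whose interior it is, and this is no restriction.\<close>

definition admits_metric_projective_compactification ::
  "real \<Rightarrow> ('a, 'e::euclidean_space \<times> real) mfd \<Rightarrow> ('a, 'e \<times> real) connection \<Rightarrow> bool" where
  "admits_metric_projective_compactification \<alpha> M nabla \<longleftrightarrow>
     (\<exists>(Mb :: ('a, 'e \<times> real) mfd) \<iota> T nablab gb.
        projective_compactification \<alpha> M nabla Mb \<iota> T nablab \<and>
        pseudo_riemannian_metric Mb gb \<and> levi_civita Mb gb nablab)"


section \<open>The metric cone\<close>

definition positive_reals :: "(real, real) mfd" where
  "positive_reals = \<lparr>mtop = top_of_set {0<..}, charts = {({0<..}, id)}\<rparr>"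

definition cone_manifold :: "('a, 'e) mfd \<Rightarrow> ('a \<times> real, 'e \<times> real) mfd" where
  "cone_manifold N = prod_manifold N positive_reals"

text \<open>\<open>g = dr\<^sup>2 + r\<^sup>2 \<gamma>\<close>, where \<open>r\<close> is the second projection and \<open>\<gamma>\<close> is pulled back by the first.\<close>

definition cone_metric ::
  "('a, 'e::euclidean_space) mfd \<Rightarrow> ('a, 'e) metric \<Rightarrow> ('a \<times> real, 'e \<times> real) metric" where
  "cone_metric N \<gamma> q v w =
     (let M = cone_manifold N in
      dfun M snd q v * dfun M snd q w +
      (snd q)\<^sup>2 * \<gamma> (fst q) (differential M N fst q v) (differential M N fst q w))"

end

theory Submission
  imports Defs
begin

text \<open>Write \<open>s = 1/r\<close> and compactify the cone to \<open>N \<times> [0, \<infinity>)\<close> with the defining function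
  \<open>T = s / sqrt (1 + s\<^sup>2) = 1 / sqrt (1 + r\<^sup>2)\<close>, so that \<open>\<Upsilon> = - r dr / (1 + r\<^sup>2)\<close>. The projectively
  changed connection is then the Levi-Civita connection of \<open>ds\<^sup>2 / (1 + s\<^sup>2)\<^sup>2 + \<gamma> / (1 + s\<^sup>2)\<close>, which
  is smooth up to \<open>s = 0\<close>. For the cone over the round sphere this is the central projection of
  flat space to a hemisphere.

  Both metrics are of the form \<open>a(t) dt\<^sup>2 + b(t) \<gamma>\<close>, so their Christoffel symbols are explicit in
  terms of those of \<open>\<gamma>\<close>, and the comparison of the connections becomes an algebraic identity between
  Christoffel symbols. That symbols in charts define a connection at all is the classical
  transformation law under coordinate changes, which for \<open>\<gamma>\<close> follows from the Koszul formula.\<close>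

section \<open>Calculus of smooth functions\<close>

text \<open>With \<open>T = s\<close> alone the changed connection is also smooth up to
  \<open>s = 0\<close>: besides the symbols of \<open>\<gamma>\<close> it only has the
  \<open>s\<close>-component \<open>s \<gamma>(u, v)\<close> on vectors \<open>u\<close>,
  \<open>v\<close> tangent to \<open>N\<close>. No metric \<open>a ds^2 + b \<gamma>\<close> with
  \<open>a\<close>, \<open>b\<close> functions of \<open>s\<close> has these symbols: vanishing
  mixed symbols \<open>b' / (2 b)\<close> make \<open>b\<close> constant, and then
  \<open>- b' / (2 a)\<close> is 0 instead of \<open>s\<close>. The factor
  \<open>1 / sqrt (1 + s^2)\<close> corrects this. It gives
  \<open>\<Upsilon> = ds / (s (1 + s^2))\<close>, so the mixed symbols become
  \<open>- 1 / s + 1 / (s (1 + s^2)) = - s / (1 + s^2)\<close> and force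
  \<open>b = 1 / (1 + s^2)\<close> up to a constant factor. The component on vectors tangent to
  \<open>N\<close> does not see \<open>\<Upsilon>\<close>, so \<open>- b' / (2 a) = s\<close> forces
  \<open>a = 1 / (1 + s^2)^2\<close> with the same factor. The remaining symbol
  \<open>a' / (2 a) = - 2 s / (1 + s^2)\<close> then agrees. At the boundary, smoothness means local
  extendability while derivatives are taken within a half-space; relating the two needs a calculus
  of its own.\<close>

lemma Ck_on_subset: "Ck_on k f S \<Longrightarrow> T \<subseteq> S \<Longrightarrow> Ck_on k f T"
  by (induction k arbitrary: f) (auto intro: continuous_on_subset)

lemma frechet_derivative_within_eq:
  assumes "at x within S = at x within T" "x \<in> S" "\<And>y. y \<in> S \<Longrightarrow> f y = g y"
  shows "frechet_derivative f (at x within S) = frechet_derivative g (at x within T)"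
proof -
  have *: "(f has_derivative f') (at x within S) \<longleftrightarrow> (g has_derivative f') (at x within S)" for f'
    using has_derivative_transform[OF assms(2), of f g f'] has_derivative_transform[OF assms(2), of g f f']
      assms(3) by metis
  show ?thesis
    unfolding assms(1)[symmetric] frechet_derivative_def * ..
qed

lemma frechet_derivative_cong_open:
  assumes "open S" "x \<in> S" "\<And>y. y \<in> S \<Longrightarrow> f y = g y"
  shows "frechet_derivative f (at x) = frechet_derivative g (at x)"
  using frechet_derivative_within_eq[OF refl assms(2), of f g] assms(3)
  unfolding at_within_open[OF assms(2,1)] by blast

lemma Ck_on_cong:
  assumes "open S" "\<And>x. x \<in> S \<Longrightarrow> f x = g x" "Ck_on k f S"
  shows "Ck_on k g S"
  using assms(2,3)
proof (induction k arbitrary: f g)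
  case 0
  then show ?case
    using continuous_on_eq[of S f g] by simp
next
  case (Suc k)
  have "g differentiable at x" if "x \<in> S" for x
  proof -
    have "(f has_derivative frechet_derivative f (at x)) (at x)"
      using Suc.prems(2) that frechet_derivative_works by auto
    then show ?thesis
      using has_derivative_transform_within_open[of f _ x UNIV S g] Suc.prems(1) that assms(1)
      unfolding differentiable_def by blast
  qed
  moreover have "Ck_on k (\<lambda>x. frechet_derivative g (at x) v) S" for v
    using Suc.IH[of "\<lambda>x. frechet_derivative f (at x) v" "\<lambda>x. frechet_derivative g (at x) v"]
      Suc.prems frechet_derivative_cong_open[OF assms(1)] by (metis Ck_on.simps(2))
  ultimately show ?case
    by simp
qed

lemma Ck_on_Suc_imp: "Ck_on (Suc k) f S \<Longrightarrow> Ck_on k f S"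
proof (induction k arbitrary: f)
  case 0
  then show ?case
    by (auto intro: continuous_at_imp_continuous_on differentiable_imp_continuous_within)
next
  case (Suc k)
  then show ?case
    by (metis Ck_on.simps(2))
qed

lemma Ck_on_imp_continuous_on: "Ck_on k f S \<Longrightarrow> continuous_on S f"
proof (induction k)
  case 0
  then show ?case by simp
next
  case (Suc k)
  then show ?case
    using Ck_on_Suc_imp by blast
qed

lemma Ck_on_SucI:
  assumes "open S" "\<And>x. x \<in> S \<Longrightarrow> (f has_derivative f' x) (at x)"
    and "\<And>v. Ck_on k (\<lambda>x. f' x v) S"
  shows "Ck_on (Suc k) f S"
proof -
  have "Ck_on k (\<lambda>x. frechet_derivative f (at x) v) S" for v
    by (rule Ck_on_cong[OF assms(1) _ assms(3)[of v]]) (metis assms(2) frechet_derivative_at)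
  then show ?thesis
    using assms(2) by (auto simp: differentiable_def)
qed

lemma Ck_on_SucD:
  assumes "Ck_on (Suc k) f S" "x \<in> S"
  shows "(f has_derivative frechet_derivative f (at x)) (at x)"
  using assms frechet_derivative_works by auto

lemma Ck_on_frechet_derivative:
  "Ck_on (Suc k) f S \<Longrightarrow> Ck_on k (\<lambda>x. frechet_derivative f (at x) v) S"
  by simp

lemma Ck_on_const: "Ck_on k (\<lambda>x. c) S"
  by (induction k arbitrary: c) simp_all

lemma Ck_on_add:
  assumes "open S" "Ck_on k f S" "Ck_on k g S"
  shows "Ck_on k (\<lambda>x. f x + g x) S"
  using assms(2,3)
proof (induction k arbitrary: f g)
  case 0
  then show ?case
    by (simp add: continuous_on_add)
next
  case (Suc k)
  show ?case
  proof (rule Ck_on_SucI[OF assms(1)])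
    show "((\<lambda>x. f x + g x) has_derivative (\<lambda>v. frechet_derivative f (at x) v +
        frechet_derivative g (at x) v)) (at x)" if "x \<in> S" for x
      using that by (intro has_derivative_add Suc.prems[THEN Ck_on_SucD])
    show "Ck_on k (\<lambda>x. frechet_derivative f (at x) v + frechet_derivative g (at x) v) S" for v
      by (intro Suc.IH Suc.prems[THEN Ck_on_frechet_derivative])
  qed
qed

lemma Ck_on_sum:
  assumes "open S" "\<And>i. i \<in> I \<Longrightarrow> Ck_on k (f i) S"
  shows "Ck_on k (\<lambda>x. \<Sum>i\<in>I. f i x) S"
  using assms(2)
  by (induction I rule: infinite_finite_induct) (simp_all add: Ck_on_const Ck_on_add assms(1))

lemma (in bounded_bilinear) Ck_on:
  fixes f :: "'e::euclidean_space \<Rightarrow> 'a" and g :: "'e \<Rightarrow> 'b"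
  assumes "open S" "Ck_on k f S" "Ck_on k g S"
  shows "Ck_on k (\<lambda>x. prod (f x) (g x)) S"
  using assms(2,3)
proof (induction k arbitrary: f g)
  case 0
  then show ?case
    by (simp add: continuous_on)
next
  case (Suc k)
  show ?case
  proof (rule Ck_on_SucI[OF assms(1)])
    show "((\<lambda>x. prod (f x) (g x)) has_derivative (\<lambda>v. prod (f x) (frechet_derivative g (at x) v) +
        prod (frechet_derivative f (at x) v) (g x))) (at x)" if "x \<in> S" for x
      by (rule FDERIV Ck_on_SucD Suc.prems that)+
    show "Ck_on k (\<lambda>x. prod (f x) (frechet_derivative g (at x) v) +
        prod (frechet_derivative f (at x) v) (g x)) S" for v
      by (intro Ck_on_add assms Suc.IH Suc.prems[THEN Ck_on_Suc_imp]
          Suc.prems[THEN Ck_on_frechet_derivative])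
  qed
qed

lemma Ck_on_bounded_linear:
  assumes "open S" "bounded_linear h"
  shows "Ck_on k h S"
proof (cases k)
  case 0
  then show ?thesis
    using linear_continuous_on[OF assms(2)] by simp
next
  case (Suc m)
  have "Ck_on (Suc m) h S"
    by (rule Ck_on_SucI[OF assms(1), where f'="\<lambda>x. h"])
      (rule bounded_linear_imp_has_derivative[OF assms(2)] Ck_on_const)+
  then show ?thesis
    using Suc by simp
qed

lemma linear_expand_basis:
  fixes L :: "'e::euclidean_space \<Rightarrow> 'f::real_vector"
  assumes "linear L"
  shows "L x = (\<Sum>i\<in>Basis. (x \<bullet> i) *\<^sub>R L i)"
proof -
  have "L x = L (\<Sum>i\<in>Basis. (x \<bullet> i) *\<^sub>R i)"
    by (simp add: euclidean_representation)
  also have "\<dots> = (\<Sum>i\<in>Basis. (x \<bullet> i) *\<^sub>R L i)"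
    using assms by (simp add: linear_sum linear_scale)
  finally show ?thesis .
qed

text \<open>Regularity of a family of linear maps is only ever known for each fixed argument.
  Expanding \<open>Y x\<close> in the finite basis turns the value into a sum of products, so no
  norm on a space of operators enters.\<close>

lemma Ck_on_linear_apply:
  fixes L :: "'e::euclidean_space \<Rightarrow> 'f::euclidean_space \<Rightarrow> 'g::real_normed_vector"
  assumes "open S" "\<And>x. x \<in> S \<Longrightarrow> linear (L x)" "\<And>u. Ck_on k (\<lambda>x. L x u) S" "Ck_on k Y S"
  shows "Ck_on k (\<lambda>x. L x (Y x)) S"
proof (rule Ck_on_cong[OF assms(1)])
  show "(\<Sum>i\<in>Basis. (Y x \<bullet> i) *\<^sub>R L x i) = L x (Y x)" if "x \<in> S" for x
    by (rule linear_expand_basis[OF assms(2)[OF that], symmetric])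
  show "Ck_on k (\<lambda>x. \<Sum>i\<in>Basis. (Y x \<bullet> i) *\<^sub>R L x i) S"
    by (rule Ck_on_sum[OF assms(1)], rule bounded_bilinear.Ck_on[OF bounded_bilinear_scaleR assms(1)
        bounded_bilinear.Ck_on[OF bounded_bilinear_inner assms(1,4) Ck_on_const] assms(3)])
qed

text \<open>The chain rule gives \<open>Dg(f x)(Df x v)\<close>, and for a fixed vector
  \<open>u\<close> the map \<open>x\<close> to \<open>Dg(f x) u\<close> is again a composite with
  the same \<open>f\<close>. Hence the induction generalizes over \<open>g\<close> only, and
  \<open>Ck_on_linear_apply\<close> puts the moving argument back.\<close>

lemma Ck_on_compose:
  fixes f :: "'e::euclidean_space \<Rightarrow> 'f::euclidean_space" and g :: "'f \<Rightarrow> 'g::real_normed_vector"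
  assumes "open S" "open T" "f ` S \<subseteq> T" "Ck_on k f S" "Ck_on k g T"
  shows "Ck_on k (\<lambda>x. g (f x)) S"
  using assms(3-5)
proof (induction k arbitrary: g)
  case 0
  then show ?case
    using continuous_on_compose2[of T g S f] by simp
next
  case (Suc k)
  show ?case
  proof (rule Ck_on_SucI[OF assms(1)])
    show "((\<lambda>x. g (f x)) has_derivative
        (\<lambda>v. frechet_derivative g (at (f x)) (frechet_derivative f (at x) v))) (at x)"
      if "x \<in> S" for x
      using Suc.prems(1) that
      by (intro has_derivative_compose[OF Ck_on_SucD[OF Suc.prems(2)] Ck_on_SucD[OF Suc.prems(3)]]) auto
    have g: "Ck_on k (\<lambda>x. frechet_derivative g (at (f x)) u) S" for u
      by (rule Suc.IH[OF Suc.prems(1) Ck_on_Suc_imp[OF Suc.prems(2)]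
            Ck_on_frechet_derivative[OF Suc.prems(3)]])
    show "Ck_on k (\<lambda>x. frechet_derivative g (at (f x)) (frechet_derivative f (at x) v)) S" for v
    proof (rule Ck_on_linear_apply[OF assms(1) _ g])
      show "linear (frechet_derivative g (at (f x)))" if "x \<in> S" for x
        using that Suc.prems(1) by (intro has_derivative_linear[OF Ck_on_SucD[OF Suc.prems(3)]]) auto
      show "Ck_on k (\<lambda>x. frechet_derivative f (at x) v) S"
        using Suc.prems by simp
    qed
  qed
qed

text \<open>The derivative is a product of constants and two copies of the function itself, so the
  induction over the order closes.\<close>

lemma Ck_on_inverse: "Ck_on k (inverse :: real \<Rightarrow> real) (- {0})"
proof (induction k)
  case 0
  then show ?case
    by (auto intro!: continuous_intros)
next
  case (Suc k)
  have op: "open (- {0::real})"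
    by auto
  show ?case
  proof (rule Ck_on_SucI[OF op])
    show "(inverse has_derivative (\<lambda>h. - 1 * (inverse x * h * inverse x))) (at x)"
      if "x \<in> - {0}" for x :: real
      using has_derivative_inverse'[of x] that by simp
    show "Ck_on k (\<lambda>x. - 1 * (inverse x * h * inverse x)) (- {0})" for h :: real
      by (intro bounded_bilinear.Ck_on[OF bounded_bilinear_mult] op Ck_on_const Suc)
  qed
qed

lemma Ck_on_sqrt: "Ck_on k sqrt {0<..}"
proof (induction k)
  case 0
  then show ?case
    by (auto intro!: continuous_intros)
next
  case (Suc k)
  have op: "open {0::real<..}" "open (- {0::real})"
    by auto
  have "sqrt ` {0<..} \<subseteq> - {0}"
    by auto
  then have inv: "Ck_on k (\<lambda>x. inverse (sqrt x)) {0<..}"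
    by (rule Ck_on_compose[OF op _ Suc Ck_on_inverse])
  show ?case
  proof (rule Ck_on_SucI[OF op(1)])
    show "(sqrt has_derivative (\<lambda>v. v * (1 / 2) * inverse (sqrt x))) (at x)" if "x \<in> {0<..}" for x
      using DERIV_real_sqrt[of x] that
      by (auto simp: has_field_derivative_def field_simps elim!: has_derivative_eq_rhs)
    show "Ck_on k (\<lambda>x. v * (1 / 2) * inverse (sqrt x)) {0<..}" for v
      by (intro bounded_bilinear.Ck_on[OF bounded_bilinear_mult] op Ck_on_const inv)
  qed
qed

subsection \<open>Symmetry of second derivatives\<close>

text \<open>Two applications of the mean value theorem, along \<open>u\<close> and then along
  \<open>v\<close>, express the second difference over a small parallelogram by a second derivative
  at a nearby point. The left-hand side is symmetric in \<open>u\<close> and \<open>v\<close>, which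
  is what forces the mixed derivatives to agree.\<close>

lemma second_difference_mvt:
  fixes f :: "'e::euclidean_space \<Rightarrow> real"
  assumes "Ck_on (Suc (Suc 0)) f U" "ball z \<delta> \<subseteq> U" "s > 0" "s * (norm u + norm v) < \<delta>"
  shows "\<exists>p\<in>ball z \<delta>. f (z + s *\<^sub>R u + s *\<^sub>R v) - f (z + s *\<^sub>R u) - f (z + s *\<^sub>R v) + f z =
    s\<^sup>2 * frechet_derivative (\<lambda>y. frechet_derivative f (at y) u) (at p) v"
proof -
  let ?D = "\<lambda>y. frechet_derivative f (at y)"
  have dist_add_self: "dist z (z + w) = norm w" for w
    by (simp add: dist_norm)
  have in_ball: "z + a *\<^sub>R u + b *\<^sub>R v \<in> ball z \<delta>" if "0 \<le> a" "a \<le> s" "0 \<le> b" "b \<le> s" for a b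
  proof -
    have "norm (a *\<^sub>R u + b *\<^sub>R v) \<le> a * norm u + b * norm v"
      using norm_triangle_ineq[of "a *\<^sub>R u" "b *\<^sub>R v"] that by simp
    also have "\<dots> \<le> s * (norm u + norm v)"
      using that by (auto simp: distrib_left intro!: add_mono mult_right_mono)
    finally have "dist z (z + (a *\<^sub>R u + b *\<^sub>R v)) < \<delta>"
      using assms(4) unfolding dist_add_self by linarith
    then show ?thesis
      by (simp add: add.assoc)
  qed
  have D1: "(f has_derivative ?D y) (at y)" if "y \<in> ball z \<delta>" for y
    using assms that Ck_on_SucD by blast
  have D2: "((\<lambda>y. ?D y u) has_derivative frechet_derivative (\<lambda>y. ?D y u) (at y)) (at y)"
    if "y \<in> ball z \<delta>" for y
    using assms(2) that by (intro Ck_on_SucD[OF Ck_on_frechet_derivative[OF assms(1)]]) auto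
  have D1': "((\<lambda>t. f (z + t *\<^sub>R u + b *\<^sub>R v)) has_derivative (\<lambda>h. ?D (z + a *\<^sub>R u + b *\<^sub>R v) (h *\<^sub>R u))) (at a)"
    if "0 \<le> a" "a \<le> s" "0 \<le> b" "b \<le> s" for a b
    by (rule has_derivative_compose[of "\<lambda>t. z + t *\<^sub>R u + b *\<^sub>R v" _ _ _ f, OF _ D1])
      (auto intro!: derivative_eq_intros in_ball[OF that, simplified])
  have G1: "((\<lambda>t. f (z + t *\<^sub>R u + s *\<^sub>R v) - f (z + t *\<^sub>R u)) has_derivative
      (\<lambda>h. ?D (z + a *\<^sub>R u + s *\<^sub>R v) (h *\<^sub>R u) - ?D (z + a *\<^sub>R u) (h *\<^sub>R u))) (at a)"
    if "0 \<le> a" "a \<le> s" for a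
    using that assms(3) D1'[of a s] D1'[of a 0] by (auto intro: has_derivative_diff)
  obtain a where a: "a \<in> {0<..<s}" and
    *: "f (z + s *\<^sub>R u + s *\<^sub>R v) - f (z + s *\<^sub>R u) - (f (z + 0 *\<^sub>R u + s *\<^sub>R v) - f (z + 0 *\<^sub>R u)) =
      ?D (z + a *\<^sub>R u + s *\<^sub>R v) ((s - 0) *\<^sub>R u) - ?D (z + a *\<^sub>R u) ((s - 0) *\<^sub>R u)"
    using mvt_simple[OF assms(3) has_derivative_at_withinI[OF G1]] by blast
  have lin: "linear (?D (z + a *\<^sub>R u + b *\<^sub>R v))" if "0 \<le> b" "b \<le> s" for b
    using D1 in_ball that a has_derivative_linear by (metis greaterThanLessThan_iff less_eq_real_def)
  have G2: "((\<lambda>t. ?D (z + a *\<^sub>R u + t *\<^sub>R v) u) has_derivative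
      (\<lambda>h. frechet_derivative (\<lambda>y. ?D y u) (at (z + a *\<^sub>R u + b *\<^sub>R v)) (h *\<^sub>R v))) (at b)"
    if "0 \<le> b" "b \<le> s" for b
    using that a assms(3)
    by (intro has_derivative_compose[of "\<lambda>t. z + a *\<^sub>R u + t *\<^sub>R v" _ _ _ "\<lambda>y. ?D y u", OF _ D2])
      (auto intro!: derivative_eq_intros in_ball[simplified])
  obtain b where b: "b \<in> {0<..<s}" and
    **: "?D (z + a *\<^sub>R u + s *\<^sub>R v) u - ?D (z + a *\<^sub>R u + 0 *\<^sub>R v) u =
      frechet_derivative (\<lambda>y. ?D y u) (at (z + a *\<^sub>R u + b *\<^sub>R v)) ((s - 0) *\<^sub>R v)"
    using mvt_simple[OF assms(3) has_derivative_at_withinI[OF G2]] by blast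
  have inb: "z + a *\<^sub>R u + b *\<^sub>R v \<in> ball z \<delta>"
    using a b in_ball by auto
  have "linear (frechet_derivative (\<lambda>y. ?D y u) (at (z + a *\<^sub>R u + b *\<^sub>R v)))"
    using D2[OF inb] has_derivative_linear by blast
  then have "f (z + s *\<^sub>R u + s *\<^sub>R v) - f (z + s *\<^sub>R u) - f (z + s *\<^sub>R v) + f z =
      s\<^sup>2 * frechet_derivative (\<lambda>y. ?D y u) (at (z + a *\<^sub>R u + b *\<^sub>R v)) v"
    using * ** lin[of s] lin[of 0] assms(3)
    by (simp add: linear_scale power2_eq_square flip: right_diff_distrib)
  then show ?thesis
    using inb by blast
qed

text \<open>Schwarz's theorem: the second difference is the same in both orders and equals
  \<open>s^2\<close> times either mixed derivative at points near \<open>z\<close>. If the two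
  derivatives differed at \<open>z\<close>, continuity would keep each nearby value within half of
  the gap, a contradiction.\<close>

lemma second_derivative_symmetric_real:
  fixes f :: "'e::euclidean_space \<Rightarrow> real"
  assumes "open U" "z \<in> U" "Ck_on (Suc (Suc 0)) f U"
  shows "frechet_derivative (\<lambda>y. frechet_derivative f (at y) u) (at z) v =
    frechet_derivative (\<lambda>y. frechet_derivative f (at y) v) (at z) u"
proof (rule ccontr)
  define D2 where "D2 = (\<lambda>u v y. frechet_derivative (\<lambda>y. frechet_derivative f (at y) u) (at y) v)"
  assume "\<not> ?thesis"
  then have e: "dist (D2 u v z) (D2 v u z) / 2 > 0" (is "?e > 0")
    by (simp add: D2_def)
  have cont: "continuous_on U (D2 a b)" for a b
    using assms(3) by (simp add: D2_def)
  obtain d0 where d0: "d0 > 0" "ball z d0 \<subseteq> U"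
    using assms openE by blast
  have "isCont (D2 a b) z" for a b
    using cont assms continuous_on_eq_continuous_at by blast
  then obtain d1 d2 where d: "d1 > 0" "\<And>y. dist y z < d1 \<Longrightarrow> dist (D2 u v y) (D2 u v z) < ?e"
      "d2 > 0" "\<And>y. dist y z < d2 \<Longrightarrow> dist (D2 v u y) (D2 v u z) < ?e"
    using e unfolding continuous_at_eps_delta by metis
  define \<delta> where "\<delta> = min d0 (min d1 d2)"
  \<comment> \<open>The summand 1 keeps the denominator positive when \<open>u\<close> and
    \<open>v\<close> vanish and makes \<open>s * (norm u + norm v)\<close> strictly smaller than
    \<open>\<delta>\<close>.\<close>
  define s where "s = \<delta> / (norm u + norm v + 1)"
  have \<delta>: "\<delta> > 0" "ball z \<delta> \<subseteq> U"
    using d d0 by (auto simp: \<delta>_def)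
  have np: "norm u + norm v + 1 > 0"
    by (simp add: add_nonneg_pos)
  then have s: "s > 0" "s * (norm u + norm v) < \<delta>"
    using \<delta> by (auto simp: s_def field_simps)
  obtain p where p: "p \<in> ball z \<delta>"
    "f (z + s *\<^sub>R u + s *\<^sub>R v) - f (z + s *\<^sub>R u) - f (z + s *\<^sub>R v) + f z = s\<^sup>2 * D2 u v p"
    using second_difference_mvt[OF assms(3) \<delta>(2) s] by (auto simp: D2_def)
  obtain q where q: "q \<in> ball z \<delta>"
    "f (z + s *\<^sub>R v + s *\<^sub>R u) - f (z + s *\<^sub>R v) - f (z + s *\<^sub>R u) + f z = s\<^sup>2 * D2 v u q"
    using second_difference_mvt[OF assms(3) \<delta>(2) s(1), of v u] s(2) by (auto simp: D2_def add.commute)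
  have eq: "z + s *\<^sub>R v + s *\<^sub>R u = z + s *\<^sub>R u + s *\<^sub>R v"
    by simp
  have "s\<^sup>2 * D2 u v p = s\<^sup>2 * D2 v u q"
    using p(2) q(2)[unfolded eq] by linarith
  then have "D2 u v p = D2 v u q"
    using s(1) by simp
  moreover have "dist (D2 u v p) (D2 u v z) < ?e" "dist (D2 v u q) (D2 v u z) < ?e"
    using d p(1) q(1) by (auto simp: \<delta>_def dist_commute)
  ultimately show False
    using dist_triangle[of "D2 u v z" "D2 v u z" "D2 u v p"] by (simp add: dist_commute)
qed

lemma second_derivative_symmetric:
  fixes f :: "'e::euclidean_space \<Rightarrow> 'f::euclidean_space"
  assumes "open U" "z \<in> U" "Ck_on (Suc (Suc 0)) f U"
  shows "frechet_derivative (\<lambda>y. frechet_derivative f (at y) u) (at z) v =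
    frechet_derivative (\<lambda>y. frechet_derivative f (at y) v) (at z) u"
proof (rule euclidean_eqI)
  fix i :: 'f
  assume "i \<in> Basis"
  have inner: "frechet_derivative (\<lambda>y. g y \<bullet> i) (at y) w = frechet_derivative g (at y) w \<bullet> i"
    if "Ck_on (Suc k) g U" "y \<in> U" for g k y w
    by (rule fun_cong[OF frechet_derivative_at[OF has_derivative_inner_left[OF Ck_on_SucD[OF that]]],
          symmetric])
  have "frechet_derivative (\<lambda>y. frechet_derivative (\<lambda>y. f y \<bullet> i) (at y) a) (at z) b =
      frechet_derivative (\<lambda>y. frechet_derivative f (at y) a) (at z) b \<bullet> i" for a b
  proof -
    have "frechet_derivative (\<lambda>y. frechet_derivative (\<lambda>y. f y \<bullet> i) (at y) a) (at z) b =
        frechet_derivative (\<lambda>y. frechet_derivative f (at y) a \<bullet> i) (at z) b"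
      by (rule fun_cong[OF frechet_derivative_cong_open[OF assms(1,2) inner[OF assms(3)]]])
    also have "\<dots> = frechet_derivative (\<lambda>y. frechet_derivative f (at y) a) (at z) b \<bullet> i"
      by (rule inner[OF Ck_on_frechet_derivative[OF assms(3)] assms(2)])
    finally show ?thesis .
  qed
  moreover have C: "Ck_on (Suc (Suc 0)) (\<lambda>y. f y \<bullet> i) U"
    by (rule bounded_bilinear.Ck_on[OF bounded_bilinear_inner assms(1,3) Ck_on_const])
  ultimately show "frechet_derivative (\<lambda>y. frechet_derivative f (at y) u) (at z) v \<bullet> i =
      frechet_derivative (\<lambda>y. frechet_derivative f (at y) v) (at z) u \<bullet> i"
    using second_derivative_symmetric_real[OF assms(1,2) C, of u v] by simp
qed

subsection \<open>Smooth functions on relatively open subsets of a model\<close>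

text \<open>Both models, the whole space and the half-space, are stable under positive shifts along the
  basis vectors. This is what makes derivatives within the model unique, also at boundary points.\<close>

definition upward :: "'e::euclidean_space set \<Rightarrow> bool" where
  "upward H \<longleftrightarrow> (\<forall>z\<in>H. \<forall>i\<in>Basis. \<forall>d>0. z + d *\<^sub>R i \<in> H)"

lemma upward_UNIV: "upward UNIV"
  by (simp add: upward_def)

lemma upward_Times:
  assumes "upward A" "upward B"
  shows "upward (A \<times> B)"
  using assms unfolding upward_def by (fastforce simp: Basis_prod_def)

text \<open>Derivatives are taken within the fixed model \<open>H\<close> and not within a chart
  image. Chart images are relatively open in \<open>H\<close>, so both filters agree at their
  points, and derivatives over different charts and overlaps become directly comparable.\<close>

definition dwithin :: "'e::euclidean_space set \<Rightarrow> ('e \<Rightarrow> 'f::real_normed_vector) \<Rightarrow> 'e \<Rightarrow> 'e \<Rightarrow> 'f" where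
  "dwithin H f z = frechet_derivative f (at z within H)"

lemma at_within_openin:
  assumes "openin (top_of_set H) S" "z \<in> S"
  shows "at z within S = at z within H"
proof -
  obtain T where T: "open T" "S = H \<inter> T"
    using assms(1) openin_open by metis
  show ?thesis
    by (rule at_within_nhd[of z T]) (use T assms(2) in auto)
qed

lemma frechet_derivative_openin:
  "openin (top_of_set H) S \<Longrightarrow> z \<in> S \<Longrightarrow> frechet_derivative f (at z within S) = dwithin H f z"
  unfolding dwithin_def by (simp only: at_within_openin)

lemma dwithin_cong:
  assumes "openin (top_of_set H) S" "z \<in> S" "\<And>y. y \<in> S \<Longrightarrow> f y = g y"
  shows "dwithin H f z = dwithin H g z"
proof -
  have "frechet_derivative f (at z within S) = frechet_derivative g (at z within S)"
    by (rule frechet_derivative_within_eq[OF refl assms(2,3)])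
  then show ?thesis
    unfolding frechet_derivative_openin[OF assms(1,2)] .
qed

lemma has_derivative_cong_openin:
  assumes "openin (top_of_set H) S" "z \<in> S" "\<And>y. y \<in> S \<Longrightarrow> f y = g y"
    and "(f has_derivative f') (at z within H)"
  shows "(g has_derivative f') (at z within H)"
  using has_derivative_transform[OF assms(2), of g f f'] assms(3,4) at_within_openin[OF assms(1,2)]
  by simp

text \<open>\<open>frechet_derivative\<close> is a choice among possible derivatives, so every
  evaluation of \<open>dwithin\<close> rests on uniqueness. At a boundary point of \<open>H\<close>
  uniqueness persists because each basis direction is approached from its positive side.\<close>

lemma dwithin_eq:
  assumes "upward H" "z \<in> H" "(f has_derivative f') (at z within H)"
  shows "dwithin H f z = f'"
proof -
  have "(f has_derivative dwithin H f z) (at z within H)"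
    unfolding dwithin_def using assms(3) frechet_derivative_works differentiableI by blast
  then show ?thesis
  proof (rule frechet_derivative_unique_within[OF _ assms(3)])
    fix i :: 'a and e :: real
    assume "i \<in> Basis" "e > 0"
    then have "z + (e / 2) *\<^sub>R i \<in> H"
      using assms(1,2) by (simp add: upward_def)
    then show "\<exists>d. 0 < \<bar>d\<bar> \<and> \<bar>d\<bar> < e \<and> z + d *\<^sub>R i \<in> H"
      using \<open>e > 0\<close> by (intro exI[of _ "e / 2"]) auto
  qed
qed

section \<open>Closure properties of smoothness on sets that need not be open\<close>

lemma smooth_onE:
  assumes "smooth_on f S" "x \<in> S"
  obtains U h where "open U" "x \<in> U" "\<forall>k. Ck_on k h U" "\<forall>y\<in>U \<inter> S. h y = f y"
proof -
  obtain U h where "open U \<and> x \<in> U \<and> (\<forall>k. Ck_on k h U) \<and> (\<forall>y\<in>U \<inter> S. h y = f y)"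
    using assms(1)[unfolded smooth_on_def, THEN bspec, OF assms(2)] by (elim exE)
  then show ?thesis
    by (intro that[of U h]) simp_all
qed

lemma smooth_on_cong:
  assumes "smooth_on f S" "\<And>x. x \<in> S \<Longrightarrow> f x = g x"
  shows "smooth_on g S"
  unfolding smooth_on_def
proof
  fix x assume "x \<in> S"
  from smooth_onE[OF assms(1) this] obtain U h where
    U': "open U" "x \<in> U" "\<forall>k. Ck_on k h U" "\<forall>y\<in>U \<inter> S. h y = f y" .
  show "\<exists>U h. open U \<and> x \<in> U \<and> (\<forall>k. Ck_on k h U) \<and> (\<forall>y\<in>U \<inter> S. h y = g y)"
    using U' assms(2) by (intro exI[of _ U] exI[of _ h] conjI allI ballI) simp_all
qed

lemma Ck_on_imp_smooth_on:
  assumes "open U" "\<And>k. Ck_on k f U" "S \<subseteq> U"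
  shows "smooth_on f S"
  unfolding smooth_on_def
proof
  fix x assume "x \<in> S"
  then show "\<exists>U h. open U \<and> x \<in> U \<and> (\<forall>k. Ck_on k h U) \<and> (\<forall>y\<in>U \<inter> S. h y = f y)"
    using assms by (intro exI[of _ U] exI[of _ f]) auto
qed

lemma Ck_on_local:
  assumes "\<And>x. x \<in> S \<Longrightarrow> \<exists>U. open U \<and> x \<in> U \<and> Ck_on k f U"
  shows "Ck_on k f S"
  using assms
proof (induction k arbitrary: f)
  case 0
  have "isCont f x" if x: "x \<in> S" for x
  proof -
    obtain U where "open U" "x \<in> U" "continuous_on U f"
      using 0[OF x] by auto
    then show ?thesis
      using continuous_on_eq_continuous_at by blast
  qed
  then show ?case
    by (simp add: continuous_at_imp_continuous_on)
next
  case (Suc k)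
  have "Ck_on k (\<lambda>x. frechet_derivative f (at x) v) S" for v
  proof (rule Suc.IH)
    fix x assume "x \<in> S"
    then obtain U where "open U" "x \<in> U" "Ck_on (Suc k) f U"
      using Suc.prems by meson
    then show "\<exists>U. open U \<and> x \<in> U \<and> Ck_on k (\<lambda>x. frechet_derivative f (at x) v) U"
      using Ck_on_frechet_derivative[of k f U v] by meson
  qed
  moreover have "f differentiable at x" if x: "x \<in> S" for x
  proof -
    obtain U where "x \<in> U" "Ck_on (Suc k) f U"
      using Suc.prems[OF x] by meson
    then show ?thesis
      by simp
  qed
  ultimately show ?case
    by simp
qed

lemma open_smooth_on_imp_Ck_on:
  assumes "open S" "smooth_on f S"
  shows "Ck_on k f S"
proof (rule Ck_on_local)
  fix x assume "x \<in> S"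
  from smooth_onE[OF assms(2) this] obtain U h where
    U': "open U" "x \<in> U" "\<forall>k. Ck_on k h U" "\<forall>y\<in>U \<inter> S. h y = f y" .
  note U = U'(1,2) U'(3)[rule_format] U'(4)[rule_format, OF IntI]
  have "Ck_on k f (U \<inter> S)"
    by (rule Ck_on_cong[of _ h]) (use U(1,4) assms(1) Ck_on_subset[OF U(3)] in auto)
  then show "\<exists>U. open U \<and> x \<in> U \<and> Ck_on k f U"
    using U(1,2) assms(1) \<open>x \<in> S\<close> by (intro exI[of _ "U \<inter> S"]) auto
qed

lemma smooth_on_const: "smooth_on (\<lambda>x. c) S"
  by (rule Ck_on_imp_smooth_on[of UNIV]) (auto simp: Ck_on_const)

lemma smooth_on_bounded_linear: "bounded_linear h \<Longrightarrow> smooth_on h S"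
  by (rule Ck_on_imp_smooth_on[of UNIV]) (auto simp: Ck_on_bounded_linear)

text \<open>The local extensions of \<open>f\<close> and \<open>g\<close> live on different
  neighbourhoods; their combination is an extension on the intersection. The premise
  \<open>comb\<close> speaks of all open sets and all functions because it is applied to the
  extensions.\<close>

lemma smooth_on_combine:
  fixes f :: "'e::euclidean_space \<Rightarrow> 'f::real_normed_vector" and g :: "'e \<Rightarrow> 'g::real_normed_vector"
    and F :: "'f \<Rightarrow> 'g \<Rightarrow> 'h::real_normed_vector"
  assumes "smooth_on f S" "smooth_on g S"
    and comb: "\<And>k U (f :: 'e \<Rightarrow> 'f) (g :: 'e \<Rightarrow> 'g). open U \<Longrightarrow> Ck_on k f U \<Longrightarrow> Ck_on k g U \<Longrightarrow> Ck_on k (\<lambda>x. F (f x) (g x)) U"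
  shows "smooth_on (\<lambda>x. F (f x) (g x)) S"
  unfolding smooth_on_def
proof
  fix x assume "x \<in> S"
  from smooth_onE[OF assms(1) this] obtain U h where
    U': "open U" "x \<in> U" "\<forall>k. Ck_on k h U" "\<forall>y\<in>U \<inter> S. h y = f y" .
  note U = U'(1,2) U'(3)[rule_format] U'(4)[rule_format, OF IntI]
  from smooth_onE[OF assms(2) \<open>x \<in> S\<close>] obtain V l where
    V': "open V" "x \<in> V" "\<forall>k. Ck_on k l V" "\<forall>y\<in>V \<inter> S. l y = g y" .
  note V = V'(1,2) V'(3)[rule_format] V'(4)[rule_format, OF IntI]
  have "Ck_on k (\<lambda>x. F (h x) (l x)) (U \<inter> V)" for k
    using U(1) V(1) by (intro comb Ck_on_subset[OF U(3)] Ck_on_subset[OF V(3)]) auto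
  then show "\<exists>U h. open U \<and> x \<in> U \<and> (\<forall>k. Ck_on k h U) \<and> (\<forall>y\<in>U \<inter> S. h y = F (f y) (g y))"
    using U(1,2,4) V(1,2,4)
    by (intro exI[of _ "U \<inter> V"] exI[of _ "\<lambda>x. F (h x) (l x)"] conjI allI ballI) (simp_all add: open_Int)
qed

lemma smooth_on_add: "smooth_on f S \<Longrightarrow> smooth_on g S \<Longrightarrow> smooth_on (\<lambda>x. f x + g x) S"
  by (rule smooth_on_combine[of f S g "(+)"]) (auto intro: Ck_on_add)

lemma (in bounded_bilinear) smooth_on:
  fixes f :: "'e::euclidean_space \<Rightarrow> 'a" and g :: "'e \<Rightarrow> 'b"
  shows "smooth_on f S \<Longrightarrow> smooth_on g S \<Longrightarrow> smooth_on (\<lambda>x. prod (f x) (g x)) S"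
  by (rule smooth_on_combine[of f S g prod]) (auto intro: Ck_on)

lemmas smooth_on_mult = bounded_bilinear.smooth_on[OF bounded_bilinear_mult]
  and smooth_on_scaleR = bounded_bilinear.smooth_on[OF bounded_bilinear_scaleR]
  and smooth_on_inner = bounded_bilinear.smooth_on[OF bounded_bilinear_inner]

lemma smooth_on_minus: "smooth_on f S \<Longrightarrow> smooth_on (\<lambda>x. - f x) S"
  using smooth_on_scaleR[OF smooth_on_const[of "-1"], of f S] by simp

lemma smooth_on_diff: "smooth_on f S \<Longrightarrow> smooth_on g S \<Longrightarrow> smooth_on (\<lambda>x. f x - g x) S"
  using smooth_on_add[OF _ smooth_on_minus, of f S g] by simp

lemma smooth_on_power: "smooth_on f S \<Longrightarrow> smooth_on (\<lambda>x. (f x :: real) ^ n) S"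
  by (induction n) (auto intro: smooth_on_const smooth_on_mult)

lemma smooth_on_sum:
  assumes "\<And>i. i \<in> I \<Longrightarrow> smooth_on (f i) S"
  shows "smooth_on (\<lambda>x. \<Sum>i\<in>I. f i x) S"
  using assms
  by (induction I rule: infinite_finite_induct) (simp_all add: smooth_on_const smooth_on_add)

lemma smooth_on_compose:
  fixes f :: "'e::euclidean_space \<Rightarrow> 'f::euclidean_space" and g :: "'f \<Rightarrow> 'g::real_normed_vector"
  assumes "smooth_on f S" "smooth_on g T" "f ` S \<subseteq> T"
  shows "smooth_on (\<lambda>x. g (f x)) S"
  unfolding smooth_on_def
proof
  fix x assume "x \<in> S"
  from smooth_onE[OF assms(1) this] obtain U h where
    U': "open U" "x \<in> U" "\<forall>k. Ck_on k h U" "\<forall>y\<in>U \<inter> S. h y = f y" .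
  note U = U'(1,2) U'(3)[rule_format] U'(4)[rule_format, OF IntI]
  have "f x \<in> T"
    using assms(3) \<open>x \<in> S\<close> by blast
  from smooth_onE[OF assms(2) this] obtain V l where
    V': "open V" "f x \<in> V" "\<forall>k. Ck_on k l V" "\<forall>y\<in>V \<inter> T. l y = g y" .
  note V = V'(1,2) V'(3)[rule_format] V'(4)[rule_format, OF IntI]
  \<comment> \<open>The extension \<open>h\<close> may take values outside \<open>V\<close>, so the
    neighbourhood is shrunk until the outer extension \<open>l\<close> can be composed with
    it.\<close>
  define W where "W = U \<inter> h -` V"
  have W: "open W"
    unfolding W_def
    by (rule continuous_open_preimage[OF Ck_on_imp_continuous_on[OF U(3)] U(1) V(1)])
  have "Ck_on k (\<lambda>x. l (h x)) W" for k
    by (rule Ck_on_compose[OF W V(1) _ Ck_on_subset[OF U(3)] V(3)]) (auto simp: W_def)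
  moreover have "x \<in> W"
    using U V \<open>x \<in> S\<close> by (simp add: W_def)
  moreover have "l (h y) = g (f y)" if "y \<in> W \<inter> S" for y
  proof -
    have "h y = f y" "h y \<in> V" "f y \<in> T"
      using that U(4) assms(3) by (auto simp: W_def)
    then show ?thesis
      using V(4) by simp
  qed
  ultimately show "\<exists>U h. open U \<and> x \<in> U \<and> (\<forall>k. Ck_on k h U) \<and> (\<forall>y\<in>U \<inter> S. h y = g (f y))"
    using W by (intro exI[of _ W] exI[of _ "\<lambda>x. l (h x)"] conjI allI ballI) simp_all
qed

lemma smooth_on_inverse:
  fixes f :: "'e::euclidean_space \<Rightarrow> real"
  assumes "smooth_on f S" "\<And>x. x \<in> S \<Longrightarrow> f x \<noteq> 0"
  shows "smooth_on (\<lambda>x. inverse (f x)) S"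
  by (rule smooth_on_compose[OF assms(1) Ck_on_imp_smooth_on[of "- {0}", OF _ Ck_on_inverse order_refl]])
    (use assms(2) in auto)

lemma smooth_on_divide:
  fixes f :: "'e::euclidean_space \<Rightarrow> real"
  assumes "smooth_on f S" "smooth_on g S" "\<And>x. x \<in> S \<Longrightarrow> g x \<noteq> 0"
  shows "smooth_on (\<lambda>x. f x / g x) S"
  unfolding divide_inverse by (intro smooth_on_mult smooth_on_inverse assms)

lemma smooth_on_sqrt:
  fixes f :: "'e::euclidean_space \<Rightarrow> real"
  assumes "smooth_on f S" "\<And>x. x \<in> S \<Longrightarrow> f x > 0"
  shows "smooth_on (\<lambda>x. sqrt (f x)) S"
  by (rule smooth_on_compose[OF assms(1) Ck_on_imp_smooth_on[of "{0<..}", OF _ Ck_on_sqrt order_refl]])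
    (use assms(2) in auto)

lemma smooth_on_linear_apply:
  fixes L :: "'e::euclidean_space \<Rightarrow> 'f::euclidean_space \<Rightarrow> 'g::real_normed_vector"
  assumes "\<And>x. x \<in> S \<Longrightarrow> linear (L x)" "\<And>u. smooth_on (\<lambda>x. L x u) S" "smooth_on Y S"
  shows "smooth_on (\<lambda>x. L x (Y x)) S"
proof (rule smooth_on_cong)
  show "(\<Sum>i\<in>Basis. (Y x \<bullet> i) *\<^sub>R L x i) = L x (Y x)" if "x \<in> S" for x
    by (rule linear_expand_basis[OF assms(1)[OF that], symmetric])
  show "smooth_on (\<lambda>x. \<Sum>i\<in>Basis. (Y x \<bullet> i) *\<^sub>R L x i) S"
    by (intro smooth_on_sum smooth_on_scaleR smooth_on_inner smooth_on_const assms(2,3))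
qed

lemma smooth_on_Pair:
  fixes f :: "'e::euclidean_space \<Rightarrow> 'f::euclidean_space" and g :: "'e \<Rightarrow> 'g::euclidean_space"
  assumes "smooth_on f S" "smooth_on g S"
  shows "smooth_on (\<lambda>x. (f x, g x)) S"
proof -
  have "smooth_on (\<lambda>x. (f x, 0::'g)) S" "smooth_on (\<lambda>x. (0::'f, g x)) S"
    by (rule smooth_on_compose[OF assms(1) smooth_on_bounded_linear[OF bounded_linear_Pair[OF
          bounded_linear_ident bounded_linear_zero], of UNIV] subset_UNIV])
      (rule smooth_on_compose[OF assms(2) smooth_on_bounded_linear[OF bounded_linear_Pair[OF
          bounded_linear_zero bounded_linear_ident], of UNIV] subset_UNIV])
  from smooth_on_add[OF this] show ?thesis
    by simp
qed

lemma smooth_on_fst: "smooth_on f S \<Longrightarrow> smooth_on (\<lambda>x. fst (f x :: 'f::euclidean_space \<times> 'g::euclidean_space)) S"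
  by (rule smooth_on_compose[OF _ smooth_on_bounded_linear[OF bounded_linear_fst, of UNIV]]) auto

lemma smooth_on_snd: "smooth_on f S \<Longrightarrow> smooth_on (\<lambda>x. snd (f x :: 'f::euclidean_space \<times> 'g::euclidean_space)) S"
  by (rule smooth_on_compose[OF _ smooth_on_bounded_linear[OF bounded_linear_snd, of UNIV]]) auto

lemma smooth_on_id: "smooth_on (\<lambda>x. x) S"
  by (rule smooth_on_bounded_linear[OF bounded_linear_ident])

subsection \<open>Derivatives within the model\<close>

text \<open>Any local extension computes the derivative within \<open>H\<close>: on the relatively
  open set \<open>S \<inter> U\<close> the function agrees with \<open>h\<close>, the full
  derivative of \<open>h\<close> is also one within \<open>H\<close>, and uniqueness does the rest.
  In particular the value is independent of the extension.\<close>

lemma dwithin_extension: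
  assumes "upward H" "openin (top_of_set H) S" "z \<in> S" "open U" "z \<in> U" "Ck_on (Suc k) h U"
    and "\<And>y. y \<in> U \<Longrightarrow> y \<in> S \<Longrightarrow> h y = f y"
  shows "(f has_derivative frechet_derivative h (at z)) (at z within H)"
    and "dwithin H f z = frechet_derivative h (at z)"
proof -
  have op: "openin (top_of_set H) (S \<inter> U)"
    using assms(2,4) by (simp add: openin_Int_open)
  have "(h has_derivative frechet_derivative h (at z)) (at z within H)"
    using Ck_on_SucD[OF assms(6,5)] has_derivative_at_withinI by blast
  then show D: "(f has_derivative frechet_derivative h (at z)) (at z within H)"
    by (rule has_derivative_cong_openin[OF op, rotated 2]) (use assms in auto)
  have "z \<in> H"
    using assms(2,3) openin_imp_subset by blast
  then show "dwithin H f z = frechet_derivative h (at z)"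
    by (rule dwithin_eq[OF assms(1) _ D])
qed

lemma smooth_on_has_derivative:
  assumes "upward H" "openin (top_of_set H) S" "smooth_on f S" "z \<in> S"
  shows "(f has_derivative dwithin H f z) (at z within H)"
proof -
  from smooth_onE[OF assms(3,4)] obtain U h where
    U': "open U" "z \<in> U" "\<forall>k. Ck_on k h U" "\<forall>y\<in>U \<inter> S. h y = f y" .
  note U = U'(1,2) U'(3)[rule_format] U'(4)[rule_format, OF IntI]
  show ?thesis
    using dwithin_extension[where k=0 and f=f, OF assms(1,2,4) U(1,2) U(3) U(4)] by simp
qed

lemma linear_dwithin:
  assumes "upward H" "openin (top_of_set H) S" "smooth_on f S" "z \<in> S"
  shows "linear (dwithin H f z)"
  using smooth_on_has_derivative[OF assms] has_derivative_linear by blast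

text \<open>The derivative of an extension extends the derivative, because the two agree at every
  point of \<open>U \<inter> S\<close> and not only at \<open>x\<close>.\<close>

lemma smooth_on_dwithin:
  assumes "upward H" "openin (top_of_set H) S" "smooth_on f S"
  shows "smooth_on (\<lambda>z. dwithin H f z v) S"
  unfolding smooth_on_def
proof
  fix x assume "x \<in> S"
  from smooth_onE[OF assms(3) this] obtain U h where
    U': "open U" "x \<in> U" "\<forall>k. Ck_on k h U" "\<forall>y\<in>U \<inter> S. h y = f y" .
  note U = U'(1,2) U'(3)[rule_format] U'(4)[rule_format, OF IntI]
  have "Ck_on k (\<lambda>x. frechet_derivative h (at x) v) U" for k
    using Ck_on_frechet_derivative U(3) by blast
  moreover have "frechet_derivative h (at y) v = dwithin H f y v" if "y \<in> U \<inter> S" for y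
    using dwithin_extension(2)[where k=0 and f=f and z=y, OF assms(1,2) _ U(1) _ U(3) U(4)] that
    by simp
  ultimately show "\<exists>U h. open U \<and> x \<in> U \<and> (\<forall>k. Ck_on k h U) \<and> (\<forall>y\<in>U \<inter> S. h y = dwithin H f y v)"
    using U(1,2) by (intro exI[of _ U] exI[of _ "\<lambda>x. frechet_derivative h (at x) v"] conjI allI ballI) simp_all
qed

text \<open>Second derivatives within \<open>H\<close> are those of a local extension, to which
  Schwarz's theorem applies. The symmetry is used for the vanishing of torsion and for the
  transformation law of the symbols.\<close>

lemma dwithin_symmetric:
  fixes f :: "'e::euclidean_space \<Rightarrow> 'f::euclidean_space"
  assumes "upward H" "openin (top_of_set H) S" "smooth_on f S" "z \<in> S"
  shows "dwithin H (\<lambda>y. dwithin H f y u) z v = dwithin H (\<lambda>y. dwithin H f y v) z u"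
proof -
  from smooth_onE[OF assms(3,4)] obtain U h where
    U': "open U" "z \<in> U" "\<forall>k. Ck_on k h U" "\<forall>y\<in>U \<inter> S. h y = f y" .
  note U = U'(1,2) U'(3)[rule_format] U'(4)[rule_format, OF IntI]
  have 1: "frechet_derivative h (at y) w = dwithin H f y w" if "y \<in> U" "y \<in> S" for y w
    using dwithin_extension(2)[where k=0 and f=f and z=y, OF assms(1,2) _ U(1) _ U(3) U(4)] that
    by simp
  have "dwithin H (\<lambda>y. dwithin H f y a) z b =
      frechet_derivative (\<lambda>y. frechet_derivative h (at y) a) (at z) b" for a b
    by (simp only: dwithin_extension(2)[where k=0 and f="\<lambda>y. dwithin H f y a",
          OF assms(1,2,4) U(1,2) Ck_on_frechet_derivative[OF U(3)] 1])
  then show ?thesis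
    using second_derivative_symmetric[OF U(1,2,3)] by simp
qed

lemma has_derivative_chain_openin:
  assumes "upward H'" "openin (top_of_set H) S" "openin (top_of_set H') S'" "z \<in> S" "f ` S \<subseteq> S'"
    and "(f has_derivative f') (at z within H)" "smooth_on g S'"
  shows "((\<lambda>y. g (f y)) has_derivative (\<lambda>v. dwithin H' g (f z) (f' v))) (at z within H)"
proof -
  have fz: "f z \<in> S'"
    using assms by blast
  have f: "(f has_derivative f') (at z within S)"
    using assms(6) at_within_openin[OF assms(2,4)] by simp
  have "(g has_derivative dwithin H' g (f z)) (at (f z) within S')"
    using smooth_on_has_derivative[OF assms(1,3,7) fz] at_within_openin[OF assms(3) fz] by simp
  then have "(g has_derivative dwithin H' g (f z)) (at (f z) within f ` S)"
    using assms(5) has_derivative_subset by blast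
  from has_derivative_in_compose[OF f this] show ?thesis
    unfolding at_within_openin[OF assms(2,4)] .
qed

text \<open>The product rule for a family of linear maps applied to a moving vector;
  \<open>L\<close> is differentiated with its argument frozen at \<open>Y z\<close>. By expansion in
  the basis, differentiability for each fixed argument is enough. Bilinear forms are treated by one
  use in each slot.\<close>

lemma has_derivative_linear_apply:
  fixes L :: "'e::euclidean_space \<Rightarrow> 'f::euclidean_space \<Rightarrow> 'g::real_normed_vector"
  assumes "upward H" "openin (top_of_set H) S" "z \<in> S" "\<And>x. x \<in> S \<Longrightarrow> linear (L x)"
    and L: "\<And>u. \<exists>l. ((\<lambda>x. L x u) has_derivative l) (at z within H)"
    and Y: "(Y has_derivative Y') (at z within H)"
  shows "((\<lambda>x. L x (Y x)) has_derivative (\<lambda>v. dwithin H (\<lambda>x. L x (Y z)) z v + L z (Y' v)))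
    (at z within H)"
proof -
  have zH: "z \<in> H"
    using assms(2,3) openin_imp_subset by blast
  have D: "((\<lambda>x. L x u) has_derivative dwithin H (\<lambda>x. L x u) z) (at z within H)" for u
    using L[of u] dwithin_eq[OF assms(1) zH] by metis
  have expand: "((\<lambda>x. L x (W x)) has_derivative
      (\<lambda>v. \<Sum>i\<in>Basis. (W z \<bullet> i) *\<^sub>R dwithin H (\<lambda>x. L x i) z v + (W' v \<bullet> i) *\<^sub>R L z i)) (at z within H)"
    if W: "(W has_derivative W') (at z within H)" for W W'
  proof (rule has_derivative_cong_openin[OF assms(2,3)])
    show "(\<Sum>i\<in>Basis. (W x \<bullet> i) *\<^sub>R L x i) = L x (W x)" if "x \<in> S" for x
      by (rule linear_expand_basis[OF assms(4)[OF that], symmetric])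
    show "((\<lambda>x. \<Sum>i\<in>Basis. (W x \<bullet> i) *\<^sub>R L x i) has_derivative
        (\<lambda>v. \<Sum>i\<in>Basis. (W z \<bullet> i) *\<^sub>R dwithin H (\<lambda>x. L x i) z v + (W' v \<bullet> i) *\<^sub>R L z i)) (at z within H)"
      by (intro has_derivative_sum has_derivative_scaleR has_derivative_inner_left W D)
  qed
  have const: "dwithin H (\<lambda>x. L x c) z = (\<lambda>v. \<Sum>i\<in>Basis. (c \<bullet> i) *\<^sub>R dwithin H (\<lambda>x. L x i) z v)" for c
    using dwithin_eq[OF assms(1) zH expand[OF has_derivative_const[of c]]]
    by (simp only: inner_zero_left scaleR_zero_left add_0_right)
  have LY: "L z (Y' v) = (\<Sum>i\<in>Basis. (Y' v \<bullet> i) *\<^sub>R L z i)" for v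
    by (rule linear_expand_basis[OF assms(4)[OF assms(3)]])
  show ?thesis
    unfolding const[of "Y z"] LY sum.distrib[symmetric] by (rule expand[OF Y])
qed

section \<open>Manifolds over a model\<close>

abbreviation inv_chart :: "('a, 'e) chart \<Rightarrow> 'e \<Rightarrow> 'a" where
  "inv_chart c \<equiv> inv_into (fst c) (snd c)"

abbreviation chart_image :: "('a, 'e) chart \<Rightarrow> 'e set" where
  "chart_image c \<equiv> snd c ` fst c"

definition metric_rep ::
  "('a, 'e::euclidean_space) mfd \<Rightarrow> ('a, 'e) metric \<Rightarrow> ('a, 'e) chart \<Rightarrow> 'e \<Rightarrow> 'e \<Rightarrow> 'e \<Rightarrow> real" where
  "metric_rep M g c z u v =
     g (inv_chart c z) (coord_vector M c (inv_chart c z) u) (coord_vector M c (inv_chart c z) v)"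

definition vf_rep :: "('a, 'e) vfield \<Rightarrow> ('a, 'e) chart \<Rightarrow> 'e \<Rightarrow> 'e" where
  "vf_rep X c z = X (inv_chart c z) c"

lemma charts_at_iff: "c \<in> charts_at M p \<longleftrightarrow> c \<in> charts M \<and> p \<in> fst c"
  by (auto simp: charts_at_def)

lemma tangent_space_change:
  "v \<in> tangent_space M p \<Longrightarrow> c \<in> charts_at M p \<Longrightarrow> d \<in> charts_at M p \<Longrightarrow>
    v d = local_deriv id c d p (v c)"
  unfolding tangent_space_def by blast

lemma tangent_space_zero: "v \<in> tangent_space M p \<Longrightarrow> c \<notin> charts_at M p \<Longrightarrow> v c = 0"
  unfolding tangent_space_def by blast

lemma tangent_spaceI:
  assumes "\<And>c. c \<notin> charts_at M p \<Longrightarrow> v c = 0"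
    and "\<And>c d. c \<in> charts_at M p \<Longrightarrow> d \<in> charts_at M p \<Longrightarrow> v d = local_deriv id c d p (v c)"
  shows "v \<in> tangent_space M p"
  using assms unfolding tangent_space_def by blast

lemma tangent_space_eqI:
  assumes "v \<in> tangent_space M p" "w \<in> tangent_space M p"
    and "\<And>c. c \<in> charts_at M p \<Longrightarrow> v c = w c"
  shows "v = w"
proof
  fix c
  show "v c = w c"
  proof (cases "c \<in> charts_at M p")
    case False
    then show ?thesis
      using tangent_space_zero[OF assms(1)] tangent_space_zero[OF assms(2)] by simp
  qed (rule assms(3))
qed

lemma vector_fields_tangent: "X \<in> vector_fields M \<Longrightarrow> p \<in> points M \<Longrightarrow> X p \<in> tangent_space M p"
  by (simp add: vector_fields_def)

lemma vector_fields_smooth: "X \<in> vector_fields M \<Longrightarrow> c \<in> charts M \<Longrightarrow> smooth_on (vf_rep X c) (chart_image c)"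
  by (simp add: vector_fields_def vf_rep_def[abs_def])

lemma vector_fields_zero:
  assumes "X \<in> vector_fields M" "c \<notin> charts_at M p"
  shows "X p c = 0"
proof (cases "p \<in> points M")
  case True
  then show ?thesis
    using tangent_space_zero[OF vector_fields_tangent[OF assms(1)] assms(2)] by simp
next
  case False
  then show ?thesis
    using assms(1) by (simp add: vector_fields_def)
qed

lemma local_dom_id: "local_dom id c d = snd c ` (fst c \<inter> fst d)"
  by (simp add: local_dom_def)

text \<open>The model \<open>H\<close> stays a parameter so that one theory covers the base and the
  cone, modelled on a whole space, and the compactification, modelled on a half-space.\<close>

locale model_manifold =
  fixes H :: "'e::euclidean_space set" and M :: "('a, 'e) mfd"
  assumes upward: "upward H" and manifold: "smooth_manifold_on H M"
begin

lemma chart_openin: "c \<in> charts M \<Longrightarrow> openin (mtop M) (fst c)"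
  using manifold by (simp add: smooth_manifold_on_def)

lemma chart_image_openin: "c \<in> charts M \<Longrightarrow> openin (top_of_set H) (chart_image c)"
  using manifold by (simp add: smooth_manifold_on_def)

lemma chart_homeomorphic:
  "c \<in> charts M \<Longrightarrow>
    homeomorphic_map (subtopology (mtop M) (fst c)) (top_of_set (chart_image c)) (snd c)"
  using manifold by (simp add: smooth_manifold_on_def)

lemma transition_smooth:
  "c \<in> charts M \<Longrightarrow> d \<in> charts M \<Longrightarrow> smooth_on (local_rep id c d) (snd c ` (fst c \<inter> fst d))"
  using manifold unfolding smooth_manifold_on_def local_dom_id by blast

lemma chart_subset: "c \<in> charts M \<Longrightarrow> fst c \<subseteq> points M"
  using chart_openin openin_subset by blast

lemma chart_point: "c \<in> charts M \<Longrightarrow> p \<in> fst c \<Longrightarrow> p \<in> points M"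
  by (rule subsetD[OF chart_subset])

lemma chart_inj:
  assumes "c \<in> charts M"
  shows "inj_on (snd c) (fst c)"
  using homeomorphic_imp_injective_map[OF chart_homeomorphic[OF assms]] chart_subset[OF assms]
  by (simp add: Int_absorb1)

lemma inv_chart: "c \<in> charts M \<Longrightarrow> p \<in> fst c \<Longrightarrow> inv_chart c (snd c p) = p"
  using chart_inj inv_into_f_f by metis

lemma some_chart_at:
  assumes "p \<in> points M"
  shows "some_chart M p \<in> charts_at M p"
proof -
  have "p \<in> (\<Union>c\<in>charts M. fst c)"
    using manifold assms by (simp add: smooth_manifold_on_def)
  then have "\<exists>c. c \<in> charts_at M p"
    by (auto simp: charts_at_def)
  then show ?thesis
    unfolding some_chart_def by (rule someI_ex)
qed

lemma image_Int_openin: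
  assumes "c \<in> charts M" "openin (mtop M) V"
  shows "openin (top_of_set H) (snd c ` (fst c \<inter> V))"
proof -
  have "openin (subtopology (mtop M) (fst c)) (fst c \<inter> V)"
    using assms(2) by (metis inf_commute openin_subtopology_Int)
  then have "openin (top_of_set (chart_image c)) (snd c ` (fst c \<inter> V))"
    using homeomorphic_imp_open_map[OF chart_homeomorphic[OF assms(1)]] by (simp add: open_map_def)
  then show ?thesis
    using chart_image_openin[OF assms(1)] openin_trans by blast
qed

lemma local_dom_openin:
  "c \<in> charts M \<Longrightarrow> d \<in> charts M \<Longrightarrow> openin (top_of_set H) (snd c ` (fst c \<inter> fst d))"
  by (rule image_Int_openin) (auto intro: chart_openin)

lemma local_rep_eq: "c \<in> charts M \<Longrightarrow> p \<in> fst c \<Longrightarrow> local_rep F c d (snd c p) = snd d (F p)"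
  by (simp add: local_rep_def inv_chart)

lemma local_deriv_id:
  assumes "c \<in> charts_at M p" "d \<in> charts_at M p"
  shows "local_deriv id c d p = dwithin H (local_rep id c d) (snd c p)"
  using assms unfolding local_deriv_def local_dom_id charts_at_iff
  by (intro frechet_derivative_openin local_dom_openin) auto

lemma model_point: "c \<in> charts M \<Longrightarrow> p \<in> fst c \<Longrightarrow> snd c p \<in> H"
  using openin_imp_subset[OF chart_image_openin] by blast

lemma transition_has_derivative:
  assumes "c \<in> charts_at M p" "d \<in> charts_at M p"
  shows "(local_rep id c d has_derivative local_deriv id c d p) (at (snd c p) within H)"
  unfolding local_deriv_id[OF assms] using assms unfolding charts_at_iff
  by (intro smooth_on_has_derivative[OF upward local_dom_openin transition_smooth]) auto

lemma local_deriv_linear: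
  "c \<in> charts_at M p \<Longrightarrow> d \<in> charts_at M p \<Longrightarrow> linear (local_deriv id c d p)"
  using transition_has_derivative has_derivative_linear by blast

text \<open>The chain rule for a change of chart, in one form for functions, transition maps and
  vector fields: \<open>f'\<close> and \<open>f\<close> represent the same object in
  \<open>c\<close> and in \<open>d\<close>. The open set \<open>W\<close> restricts the comparison,
  for instance to the domain of a third chart.\<close>

lemma dwithin_transition:
  assumes c: "c \<in> charts_at M p" and d: "d \<in> charts_at M p" and "openin (mtop M) W" "p \<in> W"
    and "openin (top_of_set H) S'" "smooth_on f S'" "snd d ` (fst d \<inter> W) \<subseteq> S'"
    and f': "\<And>q. q \<in> fst c \<Longrightarrow> q \<in> fst d \<Longrightarrow> q \<in> W \<Longrightarrow> f' (snd c q) = f (snd d q)"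
  shows "dwithin H f' (snd c p) u = dwithin H f (snd d p) (local_deriv id c d p u)"
proof -
  have cc: "c \<in> charts M" "p \<in> fst c" "d \<in> charts M" "p \<in> fst d"
    using c d by (auto simp: charts_at_iff)
  define S where "S = snd c ` (fst c \<inter> (fst d \<inter> W))"
  have S: "openin (top_of_set H) S" "snd c p \<in> S"
    unfolding S_def using cc assms(3,4) by (auto intro!: image_Int_openin openin_Int chart_openin)
  have img: "local_rep id c d ` S \<subseteq> S'"
    using assms(7) cc by (auto simp: S_def local_rep_eq)
  have "((\<lambda>y. f (local_rep id c d y)) has_derivative
      (\<lambda>v. dwithin H f (local_rep id c d (snd c p)) (local_deriv id c d p v))) (at (snd c p) within H)"
    by (rule has_derivative_chain_openin[OF upward S(1) assms(5) S(2) img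
          transition_has_derivative[OF c d] assms(6)])
  then have "(f' has_derivative
      (\<lambda>v. dwithin H f (local_rep id c d (snd c p)) (local_deriv id c d p v))) (at (snd c p) within H)"
    by (rule has_derivative_cong_openin[OF S, rotated]) (use cc f' in \<open>auto simp: S_def local_rep_eq\<close>)
  from dwithin_eq[OF upward model_point[OF cc(1,2)] this] show ?thesis
    using cc by (simp add: local_rep_eq)
qed

lemma local_deriv_same: "c \<in> charts_at M p \<Longrightarrow> local_deriv id c c p u = u"
proof -
  assume c: "c \<in> charts_at M p"
  then have cc: "c \<in> charts M" "p \<in> fst c"
    by (auto simp: charts_at_iff)
  have "(local_rep id c c has_derivative (\<lambda>v. v)) (at (snd c p) within H)"
    by (rule has_derivative_cong_openin[OF chart_image_openin[OF cc(1)] _ _ has_derivative_ident])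
      (use cc in \<open>auto simp: local_rep_eq\<close>)
  from dwithin_eq[OF upward model_point[OF cc] this] show ?thesis
    by (simp add: local_deriv_id[OF c c])
qed

text \<open>The chain rule on a triple overlap. It makes \<open>coord_vector\<close> a tangent
  vector in every chart and makes the Jacobians of opposite transitions inverse to each
  other.\<close>

lemma local_deriv_cocycle:
  assumes "c \<in> charts_at M p" "d \<in> charts_at M p" "e \<in> charts_at M p"
  shows "local_deriv id d e p (local_deriv id c d p u) = local_deriv id c e p u"
proof -
  have cc: "c \<in> charts M" "p \<in> fst c" "d \<in> charts M" "p \<in> fst d" "e \<in> charts M" "p \<in> fst e"
    using assms by (auto simp: charts_at_iff)
  have "dwithin H (local_rep id c e) (snd c p) u =
      dwithin H (local_rep id d e) (snd d p) (local_deriv id c d p u)"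
    by (rule dwithin_transition[OF assms(1,2) chart_openin[OF cc(5)] cc(6)
          local_dom_openin[OF cc(3,5)] transition_smooth[OF cc(3,5)]])
      (use cc in \<open>auto simp: local_rep_eq\<close>)
  then show ?thesis
    by (simp add: local_deriv_id[OF assms(2,3)] local_deriv_id[OF assms(1,3)])
qed

lemma coord_vector_tangent:
  assumes "c \<in> charts_at M p"
  shows "coord_vector M c p u \<in> tangent_space M p"
  by (rule tangent_spaceI) (simp_all add: coord_vector_def local_deriv_cocycle[OF assms])

lemma coord_vector_chart: "c \<in> charts_at M p \<Longrightarrow> d \<in> charts_at M p \<Longrightarrow>
    coord_vector M c p u d = local_deriv id c d p u"
  by (simp add: coord_vector_def)

lemma coord_vector_same: "c \<in> charts_at M p \<Longrightarrow> coord_vector M c p u c = u"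
  by (simp add: coord_vector_chart local_deriv_same)

lemma tangent_space_eqI':
  assumes "v \<in> tangent_space M p" "w \<in> tangent_space M p" "c \<in> charts_at M p" "v c = w c"
  shows "v = w"
proof (rule tangent_space_eqI[OF assms(1,2)])
  fix d assume d: "d \<in> charts_at M p"
  show "v d = w d"
    by (simp only: tangent_space_change[OF assms(1,3) d] tangent_space_change[OF assms(2,3) d] assms(4))
qed

lemma coord_vector_of_tangent:
  assumes "c \<in> charts_at M p" "v \<in> tangent_space M p"
  shows "coord_vector M c p (v c) = v"
  by (rule tangent_space_eqI'[OF coord_vector_tangent[OF assms(1)] assms(2,1) coord_vector_same[OF assms(1)]])

lemma coord_vector_change:
  assumes "c \<in> charts_at M p" "d \<in> charts_at M p"
  shows "coord_vector M d p (local_deriv id c d p u) = coord_vector M c p u"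
  using coord_vector_of_tangent[OF assms(2) coord_vector_tangent[OF assms(1), of u]]
  by (simp add: coord_vector_chart[OF assms])

lemma coord_vector_linear:
  assumes "c \<in> charts_at M p"
  shows "coord_vector M c p (a *\<^sub>R u + b *\<^sub>R v) =
    (\<lambda>d. a *\<^sub>R coord_vector M c p u d + b *\<^sub>R coord_vector M c p v d)"
  by (rule ext) (simp add: coord_vector_def linear_add[OF local_deriv_linear[OF assms]]
      linear_scale[OF local_deriv_linear[OF assms]])

lemma tangent_space_lincomb:
  assumes "u \<in> tangent_space M p" "v \<in> tangent_space M p"
  shows "(\<lambda>d. a *\<^sub>R u d + b *\<^sub>R v d) \<in> tangent_space M p"
proof (rule tangent_spaceI)
  fix c d assume c: "c \<in> charts_at M p" and d: "d \<in> charts_at M p"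
  show "a *\<^sub>R u d + b *\<^sub>R v d = local_deriv id c d p (a *\<^sub>R u c + b *\<^sub>R v c)"
    by (simp only: linear_add[OF local_deriv_linear[OF c d]] linear_scale[OF local_deriv_linear[OF c d]]
        tangent_space_change[OF assms(1) c d] tangent_space_change[OF assms(2) c d])
qed (simp add: tangent_space_zero[OF assms(1)] tangent_space_zero[OF assms(2)])

text \<open>\<open>dfun\<close> evaluates in a chart selected by choice. For smooth \<open>f\<close>
  the Jacobian from the chain rule is absorbed by the transformation of the tangent vector, so every
  chart computes the same value.\<close>

lemma dfun_eq:
  assumes "smooth_function M f" "c \<in> charts_at M p" "v \<in> tangent_space M p"
  shows "dfun M f p v = dwithin H (f \<circ> inv_chart c) (snd c p) (v c)"
proof -
  have p: "p \<in> points M" and cc: "c \<in> charts M" "p \<in> fst c"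
    using assms(2) chart_point unfolding charts_at_iff by blast+
  define d where "d = some_chart M p"
  have d: "d \<in> charts_at M p"
    unfolding d_def by (rule some_chart_at[OF p])
  then have dd: "d \<in> charts M" "p \<in> fst d"
    by (auto simp: charts_at_iff)
  have "dfun M f p v = dwithin H (f \<circ> inv_chart d) (snd d p) (v d)"
    unfolding dfun_def Let_def d_def[symmetric]
    by (subst frechet_derivative_openin[OF chart_image_openin[OF dd(1)]]) (use dd in auto)
  also have "\<dots> = dwithin H (f \<circ> inv_chart c) (snd c p) (local_deriv id d c p (v d))"
    by (rule dwithin_transition[OF d assms(2) chart_openin[OF cc(1)] cc(2) chart_image_openin[OF cc(1)]])
      (use cc dd assms(1) in \<open>auto simp: smooth_function_def inv_chart\<close>)
  finally show ?thesis
    using tangent_space_change[OF assms(3) d assms(2)] by simp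
qed

lemma vf_rep_chart: "c \<in> charts M \<Longrightarrow> p \<in> fst c \<Longrightarrow> vf_rep X c (snd c p) = X p c"
  by (simp add: vf_rep_def inv_chart)

lemma vf_apply_rep:
  assumes "smooth_function M f" "X \<in> vector_fields M" "c \<in> charts M" "z \<in> chart_image c"
  shows "(vf_apply M X f \<circ> inv_chart c) z = dwithin H (f \<circ> inv_chart c) z (vf_rep X c z)"
proof -
  obtain p where p: "p \<in> fst c" "z = snd c p"
    using assms(4) by blast
  then have "c \<in> charts_at M p" "p \<in> points M"
    using assms(3) chart_point unfolding charts_at_iff by blast+
  then show ?thesis
    using dfun_eq[OF assms(1) _ vector_fields_tangent[OF assms(2)]] p assms(3)
    by (simp add: vf_apply_def inv_chart vf_rep_chart)
qed

lemma metric_rep_eq: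
  assumes "c \<in> charts_at M p" "v \<in> tangent_space M p" "w \<in> tangent_space M p"
  shows "metric_rep M g c (snd c p) (v c) (w c) = g p v w"
  using assms coord_vector_of_tangent by (simp add: metric_rep_def charts_at_iff inv_chart)

lemma metric_rep_change:
  assumes "c \<in> charts_at M p" "d \<in> charts_at M p"
  shows "metric_rep M g d (snd d p) (local_deriv id c d p u) (local_deriv id c d p v) =
    metric_rep M g c (snd c p) u v"
  using assms by (simp add: metric_rep_def charts_at_iff inv_chart coord_vector_change)

section \<open>Coordinate representatives of a metric\<close>

context
  fixes g
  assumes metric: "pseudo_riemannian_metric M g"
begin

lemma metric_sym:
  "p \<in> points M \<Longrightarrow> u \<in> tangent_space M p \<Longrightarrow> v \<in> tangent_space M p \<Longrightarrow> g p u v = g p v u"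
  using metric by (simp add: pseudo_riemannian_metric_def)

lemma metric_lin:
  "p \<in> points M \<Longrightarrow> u \<in> tangent_space M p \<Longrightarrow> v \<in> tangent_space M p \<Longrightarrow> w \<in> tangent_space M p \<Longrightarrow>
    g p (\<lambda>c. a *\<^sub>R u c + b *\<^sub>R v c) w = a * g p u w + b * g p v w"
  using metric by (simp add: pseudo_riemannian_metric_def)

lemma metric_nondeg:
  "p \<in> points M \<Longrightarrow> u \<in> tangent_space M p \<Longrightarrow> (\<And>v. v \<in> tangent_space M p \<Longrightarrow> g p u v = 0) \<Longrightarrow>
    u = (\<lambda>c. 0)"
  using metric by (simp add: pseudo_riemannian_metric_def)

lemma metric_rep_smooth:
  "c \<in> charts M \<Longrightarrow> smooth_on (\<lambda>z. metric_rep M g c z u v) (chart_image c)"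
  using metric by (simp add: pseudo_riemannian_metric_def metric_rep_def Let_def)

lemma metric_rep_sym:
  assumes "c \<in> charts M" "z \<in> chart_image c"
  shows "metric_rep M g c z u v = metric_rep M g c z v u"
proof -
  obtain p where p: "p \<in> fst c" "z = snd c p"
    using assms(2) by blast
  then have "c \<in> charts_at M p" "p \<in> points M"
    using assms(1) chart_point unfolding charts_at_iff by blast+
  then show ?thesis
    using metric_sym[of p] coord_vector_tangent[of c p] p assms(1)
    by (simp add: metric_rep_def inv_chart)
qed

lemma metric_rep_linear_left:
  assumes "c \<in> charts M" "z \<in> chart_image c"
  shows "linear (\<lambda>u. metric_rep M g c z u v)"
proof -
  obtain p where p: "p \<in> fst c" "z = snd c p"
    using assms(2) by blast
  then have c: "c \<in> charts_at M p" "p \<in> points M"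
    using assms(1) chart_point unfolding charts_at_iff by blast+
  have L: "metric_rep M g c z (a *\<^sub>R u + b *\<^sub>R w) v = a * metric_rep M g c z u v + b * metric_rep M g c z w v"
    for a b u w
    using metric_lin[OF c(2)] coord_vector_tangent[OF c(1)] p assms(1)
    by (simp add: metric_rep_def inv_chart coord_vector_linear[OF c(1)])
  show ?thesis
    by (rule linearI) (use L[of 1 _ 1] L[of _ _ 0] in simp_all)
qed

lemma metric_rep_linear_right:
  assumes "c \<in> charts M" "z \<in> chart_image c"
  shows "linear (\<lambda>v. metric_rep M g c z u v)"
  using metric_rep_linear_left[OF assms, of u] metric_rep_sym[OF assms, of u] by simp

lemma metric_rep_nondeg:
  assumes "c \<in> charts M" "z \<in> chart_image c" "\<And>v. metric_rep M g c z u v = 0"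
  shows "u = 0"
proof -
  obtain p where p: "p \<in> fst c" "z = snd c p"
    using assms(2) by blast
  then have c: "c \<in> charts_at M p" "p \<in> points M"
    using assms(1) chart_point unfolding charts_at_iff by blast+
  have "coord_vector M c p u = (\<lambda>c. 0)"
  proof (rule metric_nondeg[OF c(2) coord_vector_tangent[OF c(1)]])
    fix v assume "v \<in> tangent_space M p"
    then show "g p (coord_vector M c p u) v = 0"
      using assms(3)[of "v c"] p assms(1)
      by (simp add: metric_rep_def inv_chart coord_vector_of_tangent[OF c(1)])
  qed
  then show ?thesis
    using coord_vector_same[OF c(1), of u] by simp
qed

end

end

section \<open>The connection of a family of Christoffel symbols\<close>

text \<open>Symbols are characterized by what is used of them and not by a formula: symmetry,
  compatibility with the metric, smoothness and the inhomogeneous law under changes of chart.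
  Explicit symbols of a warped product can thus be verified without inverting its metric. Linearity
  is asked in the last argument; symmetry carries it to the other.\<close>

definition christoffel_symbols ::
  "'e::euclidean_space set \<Rightarrow> ('a, 'e) mfd \<Rightarrow> ('a, 'e) metric \<Rightarrow>
    (('a, 'e) chart \<Rightarrow> 'e \<Rightarrow> 'e \<Rightarrow> 'e \<Rightarrow> 'e) \<Rightarrow> bool" where
  "christoffel_symbols H M g \<Gamma> \<longleftrightarrow>
     (\<forall>c\<in>charts M. \<forall>z\<in>chart_image c. \<forall>u.
        linear (\<Gamma> c z u) \<and> (\<forall>v. \<Gamma> c z u v = \<Gamma> c z v u) \<and>
        (\<forall>v w. dwithin H (\<lambda>y. metric_rep M g c y u v) z w =
           metric_rep M g c z (\<Gamma> c z w u) v + metric_rep M g c z u (\<Gamma> c z w v))) \<and>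
     (\<forall>c\<in>charts M. \<forall>u v. smooth_on (\<lambda>z. \<Gamma> c z u v) (chart_image c)) \<and>
     (\<forall>p. \<forall>c\<in>charts_at M p. \<forall>d\<in>charts_at M p. \<forall>u v.
        local_deriv id c d p (\<Gamma> c (snd c p) u v) =
        dwithin H (\<lambda>z. dwithin H (local_rep id c d) z v) (snd c p) u +
        \<Gamma> d (snd d p) (local_deriv id c d p u) (local_deriv id c d p v))"

text \<open>The value 0 away from the charts around the point follows the convention for tangent
  vectors, so that equations between vector fields are equations of functions.\<close>

definition christoffel_connection ::
  "'e::euclidean_space set \<Rightarrow> ('a, 'e) mfd \<Rightarrow> (('a, 'e) chart \<Rightarrow> 'e \<Rightarrow> 'e \<Rightarrow> 'e \<Rightarrow> 'e) \<Rightarrow>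
    ('a, 'e) connection" where
  "christoffel_connection H M \<Gamma> X Y = (\<lambda>p c.
     if c \<in> charts_at M p
     then dwithin H (vf_rep Y c) (snd c p) (X p c) + \<Gamma> c (snd c p) (X p c) (Y p c) else 0)"

context model_manifold
begin

text \<open>Holds for arbitrary \<open>f\<close>, at the price of the chosen chart. It serves for
  functions such as \<open>vf_apply M Y f\<close> and the product of two fields, whose smoothness is
  not established separately.\<close>

lemma dfun_some_chart:
  assumes "p \<in> points M"
  shows "dfun M f p v =
    dwithin H (f \<circ> inv_chart (some_chart M p)) (snd (some_chart M p) p) (v (some_chart M p))"
proof -
  have c: "some_chart M p \<in> charts M" "p \<in> fst (some_chart M p)"
    using some_chart_at[OF assms] by (simp_all add: charts_at_iff)
  show ?thesis
    unfolding dfun_def Let_def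
    by (subst frechet_derivative_openin[OF chart_image_openin[OF c(1)]]) (use c in auto)
qed

lemma vf_rep_has_derivative:
  assumes "Y \<in> vector_fields M" "c \<in> charts_at M p"
  shows "(vf_rep Y c has_derivative dwithin H (vf_rep Y c) (snd c p)) (at (snd c p) within H)"
  using assms unfolding charts_at_iff
  by (intro smooth_on_has_derivative[OF upward chart_image_openin vector_fields_smooth]) auto

text \<open>The representative of \<open>Y\<close> in \<open>d\<close> is the Jacobian of the
  transition applied to the representative in \<open>c\<close>. The product rule adds the second
  derivative of the transition, the term that keeps coordinate derivatives of fields from being
  tangent vectors.\<close>

lemma vf_rep_transition_derivative:
  assumes Y: "Y \<in> vector_fields M" and c: "c \<in> charts_at M p" and d: "d \<in> charts_at M p"
  shows "dwithin H (vf_rep Y d) (snd d p) (local_deriv id c d p u) =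
    dwithin H (\<lambda>z. dwithin H (local_rep id c d) z (Y p c)) (snd c p) u +
    local_deriv id c d p (dwithin H (vf_rep Y c) (snd c p) u)"
proof -
  have cc: "c \<in> charts M" "p \<in> fst c" "d \<in> charts M" "p \<in> fst d"
    using c d by (auto simp: charts_at_iff)
  define S where "S = snd c ` (fst c \<inter> fst d)"
  have S: "openin (top_of_set H) S" "snd c p \<in> S" "smooth_on (local_rep id c d) S"
    using cc by (auto simp: S_def intro: local_dom_openin transition_smooth)
  have D: "((\<lambda>z. dwithin H (local_rep id c d) z (vf_rep Y c z)) has_derivative
      (\<lambda>v. dwithin H (\<lambda>z. dwithin H (local_rep id c d) z (vf_rep Y c (snd c p))) (snd c p) v +
        dwithin H (local_rep id c d) (snd c p) (dwithin H (vf_rep Y c) (snd c p) v)))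
      (at (snd c p) within H)"
  proof (rule has_derivative_linear_apply[OF upward S(1,2) _ _ vf_rep_has_derivative[OF Y c]])
    show "linear (dwithin H (local_rep id c d) z)" if "z \<in> S" for z
      by (rule linear_dwithin[OF upward S(1,3) that])
    show "\<exists>l. ((\<lambda>z. dwithin H (local_rep id c d) z u) has_derivative l) (at (snd c p) within H)" for u
      using smooth_on_has_derivative[OF upward S(1) smooth_on_dwithin[OF upward S(1,3)] S(2)] by blast
  qed
  have "dwithin H (\<lambda>z. dwithin H (local_rep id c d) z (vf_rep Y c z)) (snd c p) u =
      dwithin H (vf_rep Y d) (snd d p) (local_deriv id c d p u)"
  proof (rule dwithin_transition[OF c d chart_openin[OF cc(1)] cc(2) chart_image_openin[OF cc(3)]
        vector_fields_smooth[OF Y cc(3)]])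
    fix q assume "q \<in> fst c" "q \<in> fst d"
    then have q: "c \<in> charts_at M q" "d \<in> charts_at M q" "q \<in> points M"
      using cc chart_point by (auto simp: charts_at_iff)
    have "Y q d = local_deriv id c d q (Y q c)"
      by (rule tangent_space_change[OF vector_fields_tangent[OF Y q(3)] q(1,2)])
    then show "dwithin H (local_rep id c d) (snd c q) (vf_rep Y c (snd c q)) = vf_rep Y d (snd d q)"
      using \<open>q \<in> fst c\<close> \<open>q \<in> fst d\<close> cc by (simp add: vf_rep_chart local_deriv_id[OF q(1,2)])
  qed auto
  then show ?thesis
    using dwithin_eq[OF upward model_point[OF cc(1,2)] D] cc
    by (simp add: vf_rep_chart local_deriv_id[OF c d])
qed

context
  fixes g \<Gamma>
  assumes metric: "pseudo_riemannian_metric M g" and \<Gamma>: "christoffel_symbols H M g \<Gamma>"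
begin

lemma christoffel_sym: "c \<in> charts M \<Longrightarrow> z \<in> chart_image c \<Longrightarrow> \<Gamma> c z u v = \<Gamma> c z v u"
  using \<Gamma> unfolding christoffel_symbols_def by blast

lemma christoffel_linear: "c \<in> charts M \<Longrightarrow> z \<in> chart_image c \<Longrightarrow> linear (\<Gamma> c z u)"
  using \<Gamma> unfolding christoffel_symbols_def by blast

lemma christoffel_linear_left:
  assumes "c \<in> charts M" "z \<in> chart_image c"
  shows "linear (\<lambda>u. \<Gamma> c z u v)"
  using christoffel_linear[OF assms, of v] unfolding christoffel_sym[OF assms, of v] .

lemma christoffel_metric:
  "c \<in> charts M \<Longrightarrow> z \<in> chart_image c \<Longrightarrow> dwithin H (\<lambda>y. metric_rep M g c y u v) z w =
     metric_rep M g c z (\<Gamma> c z w u) v + metric_rep M g c z u (\<Gamma> c z w v)"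
  using \<Gamma> unfolding christoffel_symbols_def by blast

lemma christoffel_smooth: "c \<in> charts M \<Longrightarrow> smooth_on (\<lambda>z. \<Gamma> c z u v) (chart_image c)"
  using \<Gamma> unfolding christoffel_symbols_def by blast

lemma christoffel_change:
  "c \<in> charts_at M p \<Longrightarrow> d \<in> charts_at M p \<Longrightarrow>
    local_deriv id c d p (\<Gamma> c (snd c p) u v) =
    dwithin H (\<lambda>z. dwithin H (local_rep id c d) z v) (snd c p) u +
    \<Gamma> d (snd d p) (local_deriv id c d p u) (local_deriv id c d p v)"
  using \<Gamma> unfolding christoffel_symbols_def by blast

abbreviation "nabla \<equiv> christoffel_connection H M \<Gamma>"

lemma connection_chart:
  "c \<in> charts_at M p \<Longrightarrow>
    nabla X Y p c = dwithin H (vf_rep Y c) (snd c p) (X p c) + \<Gamma> c (snd c p) (X p c) (Y p c)"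
  by (simp add: christoffel_connection_def)

text \<open>The second derivative of the transition enters one side through the derivative of
  \<open>Y\<close> in the chart \<open>d\<close> and the other side through the law for
  \<open>\<Gamma> c\<close>; the two occurrences are equal.\<close>

lemma connection_tangent:
  assumes "X \<in> vector_fields M" "Y \<in> vector_fields M" "p \<in> points M"
  shows "nabla X Y p \<in> tangent_space M p"
proof (rule tangent_spaceI)
  fix c d assume c: "c \<in> charts_at M p" and d: "d \<in> charts_at M p"
  note change = tangent_space_change[OF vector_fields_tangent[OF _ assms(3)] c d]
  show "nabla X Y p d = local_deriv id c d p (nabla X Y p c)"
    unfolding connection_chart[OF c] connection_chart[OF d] linear_add[OF local_deriv_linear[OF c d]]
      christoffel_change[OF c d] change[OF assms(1)] change[OF assms(2)]
      vf_rep_transition_derivative[OF assms(2) c d]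
    by (simp only: ac_simps)
qed (simp add: christoffel_connection_def)

lemma connection_vector_field:
  assumes X: "X \<in> vector_fields M" and Y: "Y \<in> vector_fields M"
  shows "nabla X Y \<in> vector_fields M"
proof -
  have "smooth_on (vf_rep (nabla X Y) c) (chart_image c)" if c: "c \<in> charts M" for c
  proof (rule smooth_on_cong)
    show "smooth_on (\<lambda>z. dwithin H (vf_rep Y c) z (vf_rep X c z) + \<Gamma> c z (vf_rep X c z) (vf_rep Y c z))
        (chart_image c)"
    proof (rule smooth_on_add)
      show "smooth_on (\<lambda>z. dwithin H (vf_rep Y c) z (vf_rep X c z)) (chart_image c)"
        by (rule smooth_on_linear_apply[OF linear_dwithin[OF upward chart_image_openin[OF c]
                vector_fields_smooth[OF Y c]] smooth_on_dwithin[OF upward chart_image_openin[OF c]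
                vector_fields_smooth[OF Y c]] vector_fields_smooth[OF X c]])
      show "smooth_on (\<lambda>z. \<Gamma> c z (vf_rep X c z) (vf_rep Y c z)) (chart_image c)"
      proof (rule smooth_on_linear_apply[where L="\<lambda>z u. \<Gamma> c z u (vf_rep Y c z)"])
        show "linear (\<lambda>u. \<Gamma> c z u (vf_rep Y c z))" if "z \<in> chart_image c" for z
          by (rule christoffel_linear_left[OF c that])
        show "smooth_on (\<lambda>z. \<Gamma> c z u (vf_rep Y c z)) (chart_image c)" for u
          by (rule smooth_on_linear_apply[where L="\<lambda>z v. \<Gamma> c z u v", OF christoffel_linear[OF c]
                christoffel_smooth[OF c] vector_fields_smooth[OF Y c]])
        show "smooth_on (vf_rep X c) (chart_image c)"
          by (rule vector_fields_smooth[OF X c])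
      qed
    qed
    fix z assume "z \<in> chart_image c"
    then obtain p where p: "p \<in> fst c" "z = snd c p"
      by blast
    then have "c \<in> charts_at M p"
      using c by (simp add: charts_at_iff)
    then show "dwithin H (vf_rep Y c) z (vf_rep X c z) + \<Gamma> c z (vf_rep X c z) (vf_rep Y c z) =
        vf_rep (nabla X Y) c z"
      using p c by (simp add: vf_rep_chart connection_chart)
  qed
  moreover have "nabla X Y p = (\<lambda>c. 0)" if "p \<notin> points M" for p
  proof
    fix c
    have "c \<notin> charts_at M p"
      using that chart_point unfolding charts_at_iff by blast
    then show "nabla X Y p c = 0"
      by (simp add: christoffel_connection_def)
  qed
  ultimately show ?thesis
    using connection_tangent[OF X Y] by (simp add: vector_fields_def vf_rep_def[abs_def])
qed

lemma connection_add_left: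
  assumes "X \<in> vector_fields M" "X' \<in> vector_fields M" "Y \<in> vector_fields M"
  shows "nabla (vf_add X X') Y = vf_add (nabla X Y) (nabla X' Y)"
proof (intro ext)
  fix p c
  show "nabla (vf_add X X') Y p c = vf_add (nabla X Y) (nabla X' Y) p c"
  proof (cases "c \<in> charts_at M p")
    case True
    then have c: "c \<in> charts M" "snd c p \<in> chart_image c"
      by (auto simp: charts_at_iff)
    show ?thesis
      by (simp add: vf_add_def connection_chart[OF True]
          linear_add[OF has_derivative_linear[OF vf_rep_has_derivative[OF assms(3) True]]]
          linear_add[OF christoffel_linear_left[OF c]])
  qed (simp add: christoffel_connection_def vf_add_def)
qed

lemma connection_add_right:
  assumes "X \<in> vector_fields M" "Y \<in> vector_fields M" "Y' \<in> vector_fields M"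
  shows "nabla X (vf_add Y Y') = vf_add (nabla X Y) (nabla X Y')"
proof (intro ext)
  fix p c
  show "nabla X (vf_add Y Y') p c = vf_add (nabla X Y) (nabla X Y') p c"
  proof (cases "c \<in> charts_at M p")
    case True
    then have c: "c \<in> charts M" "snd c p \<in> chart_image c" "p \<in> fst c"
      by (auto simp: charts_at_iff)
    have "vf_rep (vf_add Y Y') c = (\<lambda>z. vf_rep Y c z + vf_rep Y' c z)"
      by (simp add: vf_rep_def vf_add_def fun_eq_iff)
    then have D: "dwithin H (vf_rep (vf_add Y Y') c) (snd c p) =
        (\<lambda>v. dwithin H (vf_rep Y c) (snd c p) v + dwithin H (vf_rep Y' c) (snd c p) v)"
      using dwithin_eq[OF upward model_point[OF c(1,3)] has_derivative_add[OF
            vf_rep_has_derivative[OF assms(2) True] vf_rep_has_derivative[OF assms(3) True]]] by simp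
    show ?thesis
      by (simp add: connection_chart[OF True] D)
        (simp add: vf_add_def connection_chart[OF True] linear_add[OF christoffel_linear[OF c(1,2)]])
  qed (simp add: christoffel_connection_def vf_add_def)
qed

lemma connection_scale_left:
  assumes "X \<in> vector_fields M" "Y \<in> vector_fields M"
  shows "nabla (vf_scale f X) Y = vf_scale f (nabla X Y)"
proof (intro ext)
  fix p c
  show "nabla (vf_scale f X) Y p c = vf_scale f (nabla X Y) p c"
  proof (cases "c \<in> charts_at M p")
    case True
    then have c: "c \<in> charts M" "snd c p \<in> chart_image c"
      by (auto simp: charts_at_iff)
    show ?thesis
      by (simp add: vf_scale_def connection_chart[OF True] scaleR_add_right
          linear_scale[OF has_derivative_linear[OF vf_rep_has_derivative[OF assms(2) True]]]
          linear_scale[OF christoffel_linear_left[OF c]])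
  qed (simp add: christoffel_connection_def vf_scale_def)
qed

lemma connection_scale_right:
  assumes X: "X \<in> vector_fields M" and Y: "Y \<in> vector_fields M" and f: "smooth_function M f"
  shows "nabla X (vf_scale f Y) = vf_add (vf_scale f (nabla X Y)) (vf_scale (vf_apply M X f) Y)"
proof (intro ext)
  fix p c
  show "nabla X (vf_scale f Y) p c =
      vf_add (vf_scale f (nabla X Y)) (vf_scale (vf_apply M X f) Y) p c"
  proof (cases "c \<in> charts_at M p")
    case True
    then have c: "c \<in> charts M" "snd c p \<in> chart_image c" "p \<in> fst c"
      by (auto simp: charts_at_iff)
    have f': "(f \<circ> inv_chart c has_derivative dwithin H (f \<circ> inv_chart c) (snd c p)) (at (snd c p) within H)"
      using f c by (intro smooth_on_has_derivative[OF upward chart_image_openin]) (auto simp: smooth_function_def)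
    have "vf_rep (vf_scale f Y) c = (\<lambda>z. (f \<circ> inv_chart c) z *\<^sub>R vf_rep Y c z)"
      by (simp add: vf_rep_def vf_scale_def fun_eq_iff)
    then have D: "dwithin H (vf_rep (vf_scale f Y) c) (snd c p) =
        (\<lambda>v. f p *\<^sub>R dwithin H (vf_rep Y c) (snd c p) v + dwithin H (f \<circ> inv_chart c) (snd c p) v *\<^sub>R Y p c)"
      using dwithin_eq[OF upward model_point[OF c(1,3)] has_derivative_scaleR[OF f'
            vf_rep_has_derivative[OF Y True]]] c by (simp add: vf_rep_chart inv_chart)
    have "vf_apply M X f p = dwithin H (f \<circ> inv_chart c) (snd c p) (X p c)"
      unfolding vf_apply_def by (rule dfun_eq[OF f True vector_fields_tangent[OF X chart_point[OF c(1,3)]]])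
    then show ?thesis
      by (simp add: connection_chart[OF True] D)
        (simp add: vf_add_def vf_scale_def connection_chart[OF True] scaleR_add_right
          linear_scale[OF christoffel_linear[OF c(1,2)]])
  next
    case False
    then show ?thesis
      using vector_fields_zero[OF Y False] by (simp add: christoffel_connection_def vf_scale_def vf_add_def)
  qed
qed

lemma connection_affine: "affine_connection M nabla"
  unfolding affine_connection_def
  by (intro conjI ballI allI impI connection_vector_field connection_add_left connection_add_right
      connection_scale_left connection_scale_right)

text \<open>The first summand becomes symmetric in the two fields, so the commutator only retains
  the second. The chart is the chosen one because the outer derivative is evaluated by
  \<open>dfun_some_chart\<close>.\<close>

lemma vf_apply_vf_apply:
  assumes X: "X \<in> vector_fields M" and Y: "Y \<in> vector_fields M" and f: "smooth_function M f"
    and p: "p \<in> points M" and c_def: "c = some_chart M p"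
  shows "vf_apply M X (vf_apply M Y f) p =
    dwithin H (\<lambda>z. dwithin H (f \<circ> inv_chart c) z (Y p c)) (snd c p) (X p c) +
    dwithin H (f \<circ> inv_chart c) (snd c p) (dwithin H (vf_rep Y c) (snd c p) (X p c))"
proof -
  have c: "c \<in> charts_at M p"
    unfolding c_def by (rule some_chart_at[OF p])
  then have cc: "c \<in> charts M" "p \<in> fst c" "snd c p \<in> chart_image c"
    by (auto simp: charts_at_iff)
  have fs: "smooth_on (f \<circ> inv_chart c) (chart_image c)"
    using f cc(1) by (simp add: smooth_function_def)
  note op = chart_image_openin[OF cc(1)]
  have D: "((\<lambda>z. dwithin H (f \<circ> inv_chart c) z (vf_rep Y c z)) has_derivative
      (\<lambda>v. dwithin H (\<lambda>z. dwithin H (f \<circ> inv_chart c) z (vf_rep Y c (snd c p))) (snd c p) v +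
        dwithin H (f \<circ> inv_chart c) (snd c p) (dwithin H (vf_rep Y c) (snd c p) v)))
      (at (snd c p) within H)"
  proof (rule has_derivative_linear_apply[OF upward op cc(3) _ _ vf_rep_has_derivative[OF Y c]])
    show "linear (dwithin H (f \<circ> inv_chart c) z)" if "z \<in> chart_image c" for z
      by (rule linear_dwithin[OF upward op fs that])
    show "\<exists>l. ((\<lambda>z. dwithin H (f \<circ> inv_chart c) z u) has_derivative l) (at (snd c p) within H)" for u
      using smooth_on_has_derivative[OF upward op smooth_on_dwithin[OF upward op fs] cc(3)] by blast
  qed
  have "vf_apply M X (vf_apply M Y f) p = dwithin H (vf_apply M Y f \<circ> inv_chart c) (snd c p) (X p c)"
    unfolding vf_apply_def[of M X] dfun_some_chart[OF p] c_def ..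
  also have "dwithin H (vf_apply M Y f \<circ> inv_chart c) (snd c p) =
      dwithin H (\<lambda>z. dwithin H (f \<circ> inv_chart c) z (vf_rep Y c z)) (snd c p)"
    by (rule dwithin_cong[OF op cc(3)]) (rule vf_apply_rep[OF f Y cc(1)])
  also have "\<dots> (X p c) = dwithin H (\<lambda>z. dwithin H (f \<circ> inv_chart c) z (Y p c)) (snd c p) (X p c) +
      dwithin H (f \<circ> inv_chart c) (snd c p) (dwithin H (vf_rep Y c) (snd c p) (X p c))"
    using dwithin_eq[OF upward model_point[OF cc(1,2)] D] cc by (simp add: vf_rep_chart)
  finally show ?thesis .
qed

text \<open>The symbols cancel on the left by their symmetry, the second derivatives of
  \<open>f\<close> on the right by theirs; both sides reduce to the derivative of \<open>f\<close>
  along the coordinate bracket of \<open>X\<close> and \<open>Y\<close>.\<close>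

lemma connection_torsion_free: "torsion_free M nabla"
  unfolding torsion_free_def
proof (intro ballI allI impI)
  fix X Y f p
  assume X: "X \<in> vector_fields M" and Y: "Y \<in> vector_fields M" and f: "smooth_function M f"
    and p: "p \<in> points M"
  define c where "c = some_chart M p"
  have c: "c \<in> charts_at M p"
    unfolding c_def by (rule some_chart_at[OF p])
  then have cc: "c \<in> charts M" "p \<in> fst c" "snd c p \<in> chart_image c"
    by (auto simp: charts_at_iff)
  have fs: "smooth_on (f \<circ> inv_chart c) (chart_image c)"
    using f cc(1) by (simp add: smooth_function_def)
  note op = chart_image_openin[OF cc(1)]
  note lin = linear_add[OF linear_dwithin[OF upward op fs cc(3)]]
  have 1: "vf_apply M (nabla A B) f p =
      dwithin H (f \<circ> inv_chart c) (snd c p) (dwithin H (vf_rep B c) (snd c p) (A p c)) +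
      dwithin H (f \<circ> inv_chart c) (snd c p) (\<Gamma> c (snd c p) (A p c) (B p c))"
    if "A \<in> vector_fields M" "B \<in> vector_fields M" for A B
    unfolding vf_apply_def dfun_eq[OF f c connection_tangent[OF that p]] connection_chart[OF c] lin ..
  show "vf_apply M (nabla X Y) f p - vf_apply M (nabla Y X) f p =
      vf_apply M X (vf_apply M Y f) p - vf_apply M Y (vf_apply M X f) p"
    unfolding 1[OF X Y] 1[OF Y X] vf_apply_vf_apply[OF X Y f p c_def] vf_apply_vf_apply[OF Y X f p c_def]
      christoffel_sym[OF cc(1,3), of "X p c"] dwithin_symmetric[OF upward op fs cc(3), of "X p c"]
    by simp
qed

lemma connection_metric_compatible: "metric_compatible M g nabla"
  unfolding metric_compatible_def
proof (intro ballI)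
  fix X Y Z p
  assume X: "X \<in> vector_fields M" and Y: "Y \<in> vector_fields M" and Z: "Z \<in> vector_fields M"
    and p: "p \<in> points M"
  define c where "c = some_chart M p"
  have c: "c \<in> charts_at M p"
    unfolding c_def by (rule some_chart_at[OF p])
  then have cc: "c \<in> charts M" "p \<in> fst c" "snd c p \<in> chart_image c"
    by (auto simp: charts_at_iff)
  note op = chart_image_openin[OF cc(1)] and zH = model_point[OF cc(1,2)]
  let ?B = "metric_rep M g c" and ?z = "snd c p"
  have DB: "\<exists>l. ((\<lambda>z. ?B z u v) has_derivative l) (at ?z within H)" for u v
    using smooth_on_has_derivative[OF upward op metric_rep_smooth[OF metric cc(1)] cc(3)] by blast
  \<comment> \<open>The function \<open>?B z (Y z) (Z z)\<close> depends on the point in three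
    places. The product rule is applied in the slot of \<open>Z\<close> first and then in the slot
    of \<open>Y\<close>; the inner use supplies the differentiability asked for by the outer
    one.\<close>
  have D1: "((\<lambda>z. ?B z u (vf_rep Z c z)) has_derivative
      (\<lambda>v. dwithin H (\<lambda>z. ?B z u (vf_rep Z c ?z)) ?z v + ?B ?z u (dwithin H (vf_rep Z c) ?z v)))
      (at ?z within H)" for u
    by (rule has_derivative_linear_apply[where L="\<lambda>z w. ?B z u w", OF upward op cc(3) _ DB
          vf_rep_has_derivative[OF Z c]])
      (rule metric_rep_linear_right[OF metric cc(1)])
  have D2: "((\<lambda>z. ?B z (vf_rep Y c z) (vf_rep Z c z)) has_derivative
      (\<lambda>v. dwithin H (\<lambda>z. ?B z (vf_rep Y c ?z) (vf_rep Z c z)) ?z v +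
        ?B ?z (dwithin H (vf_rep Y c) ?z v) (vf_rep Z c ?z))) (at ?z within H)"
  proof (rule has_derivative_linear_apply[where L="\<lambda>z w. ?B z w (vf_rep Z c z)", OF upward op cc(3) _ _
          vf_rep_has_derivative[OF Y c]])
    show "linear (\<lambda>w. ?B z w (vf_rep Z c z))" if "z \<in> chart_image c" for z
      by (rule metric_rep_linear_left[OF metric cc(1) that])
    show "\<exists>l. ((\<lambda>z. ?B z u (vf_rep Z c z)) has_derivative l) (at ?z within H)" for u
      by (rule exI, rule D1)
  qed
  have eq: "dwithin H ((\<lambda>q. g q (Y q) (Z q)) \<circ> inv_chart c) ?z =
      dwithin H (\<lambda>z. ?B z (vf_rep Y c z) (vf_rep Z c z)) ?z"
  proof (rule dwithin_cong[OF op cc(3)])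
    fix z assume "z \<in> chart_image c"
    then obtain q where q: "q \<in> fst c" "z = snd c q"
      by blast
    then have cq: "c \<in> charts_at M q" "q \<in> points M"
      using cc(1) chart_point by (auto simp: charts_at_iff)
    show "((\<lambda>q. g q (Y q) (Z q)) \<circ> inv_chart c) z = ?B z (vf_rep Y c z) (vf_rep Z c z)"
      using metric_rep_eq[OF cq(1) vector_fields_tangent[OF Y cq(2)] vector_fields_tangent[OF Z cq(2)], of g]
        q cc(1) by (simp add: inv_chart vf_rep_chart)
  qed
  note nt = connection_tangent[OF X _ p]
  have "vf_apply M X (\<lambda>q. g q (Y q) (Z q)) p =
      dwithin H (\<lambda>z. ?B z (Y p c) (Z p c)) ?z (X p c) +
      ?B ?z (Y p c) (dwithin H (vf_rep Z c) ?z (X p c)) + ?B ?z (dwithin H (vf_rep Y c) ?z (X p c)) (Z p c)"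
    unfolding vf_apply_def dfun_some_chart[OF p] c_def[symmetric] eq
      dwithin_eq[OF upward zH D2] dwithin_eq[OF upward zH D1] vf_rep_chart[OF cc(1,2)] ..
  also have "\<dots> = ?B ?z (nabla X Y p c) (Z p c) + ?B ?z (Y p c) (nabla X Z p c)"
    unfolding connection_chart[OF c] christoffel_metric[OF cc(1,3)]
      linear_add[OF metric_rep_linear_left[OF metric cc(1,3)]]
      linear_add[OF metric_rep_linear_right[OF metric cc(1,3)]] by simp
  also have "\<dots> = g p (nabla X Y p) (Z p) + g p (Y p) (nabla X Z p)"
    unfolding metric_rep_eq[OF c nt[OF Y] vector_fields_tangent[OF Z p]]
      metric_rep_eq[OF c vector_fields_tangent[OF Y p] nt[OF Z]] ..
  finally show "vf_apply M X (\<lambda>q. g q (Y q) (Z q)) p =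
      g p (nabla X Y p) (Z p) + g p (Y p) (nabla X Z p)" .
qed

lemma levi_civita_christoffel_connection: "levi_civita M g nabla"
  unfolding levi_civita_def
  using connection_affine connection_torsion_free connection_metric_compatible by blast

end

end

section \<open>Christoffel symbols of a metric\<close>

subsection \<open>Smooth families of linear isomorphisms\<close>

text \<open>The factor \<open>c\<close> is only continuous. Since \<open>F\<close> vanishes at
  \<open>z\<close>, the variation of \<open>c\<close> contributes
  \<open>(c y - c z) F'(y - z)\<close>, which is of smaller order than \<open>y - z\<close>. This
  allows inverse maps to be differentiated when only their continuity is known.\<close>

lemma has_derivative_scaleR_vanishing:
  fixes F :: "'e::euclidean_space \<Rightarrow> 'f::real_normed_vector"
  assumes "isCont c z" "(F has_derivative F') (at z)" "F z = 0"
  shows "((\<lambda>x. c x *\<^sub>R F x) has_derivative (\<lambda>h. c z *\<^sub>R F' h)) (at z)"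
proof -
  have F': "bounded_linear F'"
    using assms(2) has_derivative_bounded_linear by blast
  obtain K where K: "\<And>h. norm (F' h) \<le> norm h * K"
    using bounded_linear.bounded[OF F'] by blast
  have q: "((\<lambda>y. (1 / norm (y - z)) *\<^sub>R (F y - (F z + F' (y - z)))) \<longlongrightarrow> 0) (at z)"
    using assms(2) unfolding has_derivative_within by blast
  have c: "(c \<longlongrightarrow> c z) (at z)"
    using assms(1) by (simp add: isCont_def)
  have 1: "((\<lambda>y. c y *\<^sub>R ((1 / norm (y - z)) *\<^sub>R (F y - (F z + F' (y - z))))) \<longlongrightarrow> 0) (at z)"
    using tendsto_scaleR[OF c q] by simp
  have "((\<lambda>y. \<bar>c y - c z\<bar> * \<bar>K\<bar>) \<longlongrightarrow> \<bar>c z - c z\<bar> * \<bar>K\<bar>) (at z)"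
    by (intro tendsto_intros c)
  then have lim: "((\<lambda>y. \<bar>c y - c z\<bar> * \<bar>K\<bar>) \<longlongrightarrow> 0) (at z)"
    by simp
  have 2: "((\<lambda>y. (1 / norm (y - z)) *\<^sub>R ((c y - c z) *\<^sub>R F' (y - z))) \<longlongrightarrow> 0) (at z)"
  proof (rule Lim_null_comparison[OF _ lim], rule always_eventually, rule allI)
    fix y
    have "norm (F' (y - z)) / norm (y - z) \<le> \<bar>K\<bar>"
    proof (cases "y = z")
      case False
      have "norm (F' (y - z)) \<le> norm (y - z) * \<bar>K\<bar>"
        by (rule order_trans[OF K mult_left_mono]) auto
      then show ?thesis
        using False by (simp add: divide_le_eq mult.commute)
    qed simp
    then have "\<bar>c y - c z\<bar> * (norm (F' (y - z)) / norm (y - z)) \<le> \<bar>c y - c z\<bar> * \<bar>K\<bar>"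
      by (rule mult_left_mono) simp
    then show "norm ((1 / norm (y - z)) *\<^sub>R ((c y - c z) *\<^sub>R F' (y - z))) \<le> \<bar>c y - c z\<bar> * \<bar>K\<bar>"
      by simp
  qed
  have "((\<lambda>y. (1 / norm (y - z)) *\<^sub>R (c y *\<^sub>R F y - (c z *\<^sub>R F z + c z *\<^sub>R F' (y - z)))) \<longlongrightarrow> 0) (at z)"
    using tendsto_add[OF 1 2] assms(3) by (simp add: algebra_simps)
  moreover have "bounded_linear (\<lambda>h. c z *\<^sub>R F' h)"
    by (rule bounded_linear_scaleR_right[THEN bounded_linear_compose, OF F'])
  ultimately show ?thesis
    unfolding has_derivative_within by blast
qed

context
  fixes A :: "'e::euclidean_space \<Rightarrow> 'f::euclidean_space \<Rightarrow> 'f" and S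
  assumes op: "open S" and lin: "\<And>z. z \<in> S \<Longrightarrow> linear (A z)" and inj: "\<And>z. z \<in> S \<Longrightarrow> inj (A z)"
begin

lemma apply_inv: "z \<in> S \<Longrightarrow> A z (inv (A z) u) = u"
  using linear_injective_imp_surjective[OF lin inj] by (simp add: surj_f_inv_f)

lemma linear_inv:
  assumes "z \<in> S"
  shows "linear (inv (A z))"
  by (rule linearI; rule injD[OF inj[OF assms]])
    (simp_all add: apply_inv[OF assms] linear_add[OF lin[OF assms]] linear_scale[OF lin[OF assms]])

lemma apply_diff_expand:
  "z \<in> S \<Longrightarrow> y \<in> S \<Longrightarrow> A y x - A z x = (\<Sum>i\<in>Basis. (x \<bullet> i) *\<^sub>R (A y i - A z i))"
  by (simp add: linear_expand_basis[OF lin, of _ x] scaleR_diff_right sum_subtractf)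

text \<open>A bound \<open>m |x| \<le> |A z x|\<close> survives with \<open>m / 2\<close> for
  \<open>A y\<close> once the columns of \<open>A y - A z\<close> are small in sum. For
  \<open>x = inv (A y) u - w\<close> with \<open>w = inv (A z) u\<close> it estimates the change of
  the inverse by \<open>A z w - A y w\<close>, which tends to 0.\<close>

lemma isCont_inv:
  assumes cont: "\<And>u. continuous_on S (\<lambda>z. A z u)" and z: "z \<in> S"
  shows "isCont (\<lambda>z. inv (A z) u) z"
proof -
  have ct: "((\<lambda>y. A y u) \<longlongrightarrow> A z u) (at z)" for u
    using continuous_on_interior[OF cont, of z u] op z
    by (simp add: interior_open isCont_def)
  obtain m where m: "m > 0" "\<And>x. m * norm x \<le> norm (A z x)"
    using linear_inj_bounded_below_pos[OF lin[OF z] inj[OF z]] by blast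
  have "((\<lambda>y. \<Sum>i\<in>Basis. norm (A y i - A z i)) \<longlongrightarrow> (\<Sum>i\<in>(Basis::'f set). norm (A z i - A z i))) (at z)"
    by (intro tendsto_intros ct)
  then have "((\<lambda>y. \<Sum>i\<in>Basis. norm (A y i - A z i)) \<longlongrightarrow> 0) (at z)"
    by simp
  then have small: "\<forall>\<^sub>F y in at z. (\<Sum>i\<in>Basis. norm (A y i - A z i)) < m / 2"
    using m(1) by (intro order_tendstoD) auto
  have near: "\<forall>\<^sub>F y in at z. y \<in> S"
    using op z by (rule eventually_at_in_open')
  define w where "w = inv (A z) u"
  have "((\<lambda>y. (2 / m) * norm (A z w - A y w)) \<longlongrightarrow> (2 / m) * norm (A z w - A z w)) (at z)"
    by (intro tendsto_intros ct)
  then have lim: "((\<lambda>y. (2 / m) * norm (A z w - A y w)) \<longlongrightarrow> 0) (at z)"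
    by simp
  have "((\<lambda>y. inv (A y) u - w) \<longlongrightarrow> 0) (at z)"
  proof (rule Lim_null_comparison[OF _ lim], rule eventually_mono[OF eventually_conj[OF small near]])
    fix y assume y: "(\<Sum>i\<in>Basis. norm (A y i - A z i)) < m / 2 \<and> y \<in> S"
    have below: "m / 2 * norm x \<le> norm (A y x)" for x
    proof -
      have "norm (A y x - A z x) \<le> (\<Sum>i\<in>Basis. norm ((x \<bullet> i) *\<^sub>R (A y i - A z i)))"
        by (subst apply_diff_expand[OF z conjunct2[OF y]]) (rule norm_sum)
      also have "\<dots> \<le> (\<Sum>i\<in>Basis. norm x * norm (A y i - A z i))"
        unfolding norm_scaleR by (intro sum_mono mult_right_mono Basis_le_norm) auto
      also have "\<dots> = norm x * (\<Sum>i\<in>Basis. norm (A y i - A z i))"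
        by (rule sum_distrib_left[symmetric])
      also have "\<dots> \<le> norm x * (m / 2)"
        by (rule mult_left_mono[OF less_imp_le[OF conjunct1[OF y]] norm_ge_zero])
      finally have "norm (A y x - A z x) \<le> m / 2 * norm x"
        by (simp add: mult.commute)
      moreover have "norm (A z x) \<le> norm (A y x) + norm (A y x - A z x)"
        unfolding norm_minus_commute[of "A y x"] by (rule norm_triangle_sub)
      ultimately show ?thesis
        using m(2)[of x] by linarith
    qed
    have "A y (inv (A y) u - w) = A z w - A y w"
      using y z by (simp add: linear_diff[OF lin] apply_inv w_def)
    then have "m / 2 * norm (inv (A y) u - w) \<le> norm (A z w - A y w)"
      using below[of "inv (A y) u - w"] by simp
    then show "norm (inv (A y) u - w) \<le> 2 / m * norm (A z w - A y w)"
      using m(1) by (simp add: field_simps)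
  qed
  then show ?thesis
    unfolding isCont_def w_def by (rule LIM_zero_cancel)
qed

text \<open>With \<open>w = inv (A y) u\<close>, the identity
  \<open>w = inv (A z) u - inv (A z) (A y w - A z w)\<close> is expanded in the basis. The
  coefficients of \<open>w\<close> are merely continuous in \<open>y\<close>, but they multiply
  \<open>A y i - A z i\<close>, which vanishes at \<open>y = z\<close>. Continuity of the inverse
  thus already yields its derivative.\<close>

lemma inv_has_derivative:
  assumes deriv: "\<And>u z. z \<in> S \<Longrightarrow> ((\<lambda>z. A z u) has_derivative A' u z) (at z)" and z: "z \<in> S"
  shows "((\<lambda>z. inv (A z) u) has_derivative
    (\<lambda>h. - inv (A z) (\<Sum>i\<in>Basis. (inv (A z) u \<bullet> i) *\<^sub>R A' i z h))) (at z)"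
proof -
  have cA: "continuous_on S (\<lambda>z. A z u)" for u
    using deriv has_derivative_continuous continuous_at_imp_continuous_on by blast
  have cont: "isCont (\<lambda>y. inv (A y) u \<bullet> i) z" for i
    by (intro continuous_intros isCont_inv[OF cA z])
  have 1: "((\<lambda>y. (inv (A y) u \<bullet> i) *\<^sub>R (A y i - A z i)) has_derivative
      (\<lambda>h. (inv (A z) u \<bullet> i) *\<^sub>R A' i z h)) (at z)" for i
    using has_derivative_diff[OF deriv[OF z, of i] has_derivative_const[of "A z i"]]
    by (intro has_derivative_scaleR_vanishing[OF cont]) simp_all
  have 2: "((\<lambda>y. \<Sum>i\<in>Basis. (inv (A y) u \<bullet> i) *\<^sub>R (A y i - A z i)) has_derivative
      (\<lambda>h. \<Sum>i\<in>Basis. (inv (A z) u \<bullet> i) *\<^sub>R A' i z h)) (at z)"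
    by (rule has_derivative_sum[OF 1])
  have bl: "bounded_linear (inv (A z))"
    using linear_inv[OF z] by (simp add: linear_conv_bounded_linear)
  have 3: "((\<lambda>y. inv (A z) u - inv (A z) (\<Sum>i\<in>Basis. (inv (A y) u \<bullet> i) *\<^sub>R (A y i - A z i))) has_derivative
      (\<lambda>h. 0 - inv (A z) (\<Sum>i\<in>Basis. (inv (A z) u \<bullet> i) *\<^sub>R A' i z h))) (at z)"
    by (rule has_derivative_diff[OF has_derivative_const bounded_linear.has_derivative[OF bl 2]])
  have 4: "inv (A z) u - inv (A z) (\<Sum>i\<in>Basis. (inv (A y) u \<bullet> i) *\<^sub>R (A y i - A z i)) = inv (A y) u"
    if y: "y \<in> S" for y
  proof (rule injD[OF inj[OF z]])
    show "A z (inv (A z) u - inv (A z) (\<Sum>i\<in>Basis. (inv (A y) u \<bullet> i) *\<^sub>R (A y i - A z i))) =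
        A z (inv (A y) u)"
      unfolding apply_diff_expand[OF z y, symmetric]
      by (simp add: linear_diff[OF lin[OF z]] apply_inv z y)
  qed
  show ?thesis
    using has_derivative_transform_within_open[OF 3 op z 4] by simp
qed

text \<open>The derivative of the inverse is built from the inverse and the derivative of
  \<open>A\<close>, so each step of the induction gains one order.\<close>

lemma Ck_on_inv_linear:
  assumes "\<And>u k. Ck_on k (\<lambda>z. A z u) S"
  shows "Ck_on k (\<lambda>z. inv (A z) u) S"
proof (induction k arbitrary: u)
  case 0
  have "continuous_on S (\<lambda>z. A z u)" for u
    using assms[where k=0] by simp
  then show ?case
    using isCont_inv by (simp add: continuous_at_imp_continuous_on)
next
  case (Suc k)
  have deriv: "((\<lambda>z. A z u) has_derivative frechet_derivative (\<lambda>z. A z u) (at z)) (at z)" if "z \<in> S" for u z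
    by (rule Ck_on_SucD[OF assms[where k="Suc 0"] that])
  show ?case
  proof (rule Ck_on_SucI[OF op inv_has_derivative[OF deriv]])
    have "Ck_on k (\<lambda>z. (- 1) *\<^sub>R inv (A z)
        (\<Sum>i\<in>Basis. (inv (A z) u \<bullet> i) *\<^sub>R frechet_derivative (\<lambda>z. A z i) (at z) v)) S" for v
    proof (rule bounded_bilinear.Ck_on[OF bounded_bilinear_scaleR op Ck_on_const])
      have Y: "Ck_on k (\<lambda>z. \<Sum>i\<in>Basis. (inv (A z) u \<bullet> i) *\<^sub>R frechet_derivative (\<lambda>z. A z i) (at z) v) S"
        by (rule Ck_on_sum[OF op], rule bounded_bilinear.Ck_on[OF bounded_bilinear_scaleR op
              bounded_bilinear.Ck_on[OF bounded_bilinear_inner op Suc Ck_on_const]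
              Ck_on_frechet_derivative[OF assms]])
      show "Ck_on k (\<lambda>z. inv (A z)
          (\<Sum>i\<in>Basis. (inv (A z) u \<bullet> i) *\<^sub>R frechet_derivative (\<lambda>z. A z i) (at z) v)) S"
      proof (rule Ck_on_linear_apply[where L="\<lambda>z. inv (A z)", OF op _ _ Y])
        show "linear (inv (A z))" if "z \<in> S" for z
          by (rule linear_inv[OF that])
      qed (rule Suc)
    qed
    then show "Ck_on k (\<lambda>z. - inv (A z)
        (\<Sum>i\<in>Basis. (inv (A z) u \<bullet> i) *\<^sub>R frechet_derivative (\<lambda>z. A z i) (at z) v)) S" for v
      by simp
  qed
qed

lemma smooth_on_inv_linear:
  assumes "\<And>u. smooth_on (\<lambda>z. A z u) S"
  shows "smooth_on (\<lambda>z. inv (A z) u) S"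
  by (rule Ck_on_imp_smooth_on[OF op Ck_on_inv_linear order_refl])
    (rule open_smooth_on_imp_Ck_on[OF op assms])

end

subsection \<open>Existence\<close>

lemma linear_dwithin_param:
  assumes "upward H" "openin (top_of_set H) S" "z \<in> S" "\<And>x. x \<in> S \<Longrightarrow> linear (L x)"
    and "\<And>u. smooth_on (\<lambda>x. L x u) S"
  shows "linear (\<lambda>u. dwithin H (\<lambda>x. L x u) z v)"
proof -
  have zH: "z \<in> H"
    using assms(2,3) openin_imp_subset by blast
  note D = smooth_on_has_derivative[OF assms(1,2,5,3)]
  show ?thesis
  proof (rule linearI)
    fix a b
    have "dwithin H (\<lambda>x. L x (a + b)) z = dwithin H (\<lambda>x. L x a + L x b) z"
      by (rule dwithin_cong[OF assms(2,3)]) (rule linear_add[OF assms(4)])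
    also have "\<dots> = (\<lambda>v. dwithin H (\<lambda>x. L x a) z v + dwithin H (\<lambda>x. L x b) z v)"
      by (rule dwithin_eq[OF assms(1) zH has_derivative_add[OF D D]])
    finally show "dwithin H (\<lambda>x. L x (a + b)) z v = dwithin H (\<lambda>x. L x a) z v + dwithin H (\<lambda>x. L x b) z v"
      by (rule fun_cong)
  next
    fix r a
    have "dwithin H (\<lambda>x. L x (r *\<^sub>R a)) z = dwithin H (\<lambda>x. r *\<^sub>R L x a) z"
      by (rule dwithin_cong[OF assms(2,3)]) (rule linear_scale[OF assms(4)])
    also have "\<dots> = (\<lambda>v. r *\<^sub>R dwithin H (\<lambda>x. L x a) z v)"
      by (rule dwithin_eq[OF assms(1) zH has_derivative_scaleR_right[OF D]])
    finally show "dwithin H (\<lambda>x. L x (r *\<^sub>R a)) z v = r *\<^sub>R dwithin H (\<lambda>x. L x a) z v"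
      by (rule fun_cong)
  qed
qed

text \<open>This is the only setting in which a metric is inverted. With the whole space as model
  the chart images are open, as the regularity of inverses of linear families requires.\<close>

locale boundaryless_metric = model_manifold UNIV M for M :: "('a, 'e::euclidean_space) mfd" +
  fixes g :: "('a, 'e) metric"
  assumes metric: "pseudo_riemannian_metric M g"
begin

abbreviation "B \<equiv> metric_rep M g"

text \<open>The Koszul formula on constant coordinate fields, whose brackets vanish: the Christoffel
  symbols of the first kind, that is \<open>g(nabla_u v, w)\<close>.\<close>

definition koszul :: "('a, 'e) chart \<Rightarrow> 'e \<Rightarrow> 'e \<Rightarrow> 'e \<Rightarrow> 'e \<Rightarrow> real" where
  "koszul c z u v w = (dwithin UNIV (\<lambda>y. B c y v w) z u + dwithin UNIV (\<lambda>y. B c y u w) z v -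
     dwithin UNIV (\<lambda>y. B c y u v) z w) / 2"

text \<open>Lowering of an index: the covector \<open>g(u, .)\<close> written as a vector by means
  of the Euclidean inner product.\<close>

definition lower :: "('a, 'e) chart \<Rightarrow> 'e \<Rightarrow> 'e \<Rightarrow> 'e" where
  "lower c z u = (\<Sum>i\<in>Basis. B c z u i *\<^sub>R i)"

definition levi_civita_symbols :: "('a, 'e) chart \<Rightarrow> 'e \<Rightarrow> 'e \<Rightarrow> 'e \<Rightarrow> 'e" where
  "levi_civita_symbols c z u v = inv (lower c z) (\<Sum>i\<in>Basis. koszul c z u v i *\<^sub>R i)"

context
  fixes c
  assumes c: "c \<in> charts M"
begin

lemmas B_smooth = metric_rep_smooth[OF metric c]
  and B_sym = metric_rep_sym[OF metric c]
  and B_lin1 = metric_rep_linear_left[OF metric c]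
  and B_lin2 = metric_rep_linear_right[OF metric c]
  and op = chart_image_openin[OF c]

lemma open_image: "open (chart_image c)"
  using op by simp

lemma dB_sym: "z \<in> chart_image c \<Longrightarrow> dwithin UNIV (\<lambda>y. B c y u v) z = dwithin UNIV (\<lambda>y. B c y v u) z"
  by (rule dwithin_cong[OF op]) (simp_all add: B_sym)

lemma dB_linear:
  assumes "z \<in> chart_image c"
  shows "linear (dwithin UNIV (\<lambda>y. B c y u v) z)" "linear (\<lambda>u. dwithin UNIV (\<lambda>y. B c y u v) z w)"
    "linear (\<lambda>v. dwithin UNIV (\<lambda>y. B c y u v) z w)"
  by (rule linear_dwithin[OF upward op B_smooth assms])
    (rule linear_dwithin_param[where L="\<lambda>y u. B c y u v", OF upward op assms B_lin1 B_smooth],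
     assumption, rule linear_dwithin_param[where L="\<lambda>y v. B c y u v", OF upward op assms B_lin2 B_smooth],
     assumption)

lemma koszul_linear2: "z \<in> chart_image c \<Longrightarrow> linear (\<lambda>v. koszul c z u v w)"
  by (rule linearI) (simp_all add: koszul_def linear_add[OF dB_linear(1)] linear_scale[OF dB_linear(1)]
      linear_add[OF dB_linear(2)] linear_scale[OF dB_linear(2)]
      linear_add[OF dB_linear(3)] linear_scale[OF dB_linear(3)] field_simps)

lemma koszul_linear3: "z \<in> chart_image c \<Longrightarrow> linear (\<lambda>w. koszul c z u v w)"
  by (rule linearI) (simp_all add: koszul_def linear_add[OF dB_linear(1)] linear_scale[OF dB_linear(1)]
      linear_add[OF dB_linear(2)] linear_scale[OF dB_linear(2)]
      linear_add[OF dB_linear(3)] linear_scale[OF dB_linear(3)] field_simps)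

lemma koszul_sym: "z \<in> chart_image c \<Longrightarrow> koszul c z u v w = koszul c z v u w"
  by (simp add: koszul_def dB_sym[of z u v])

lemma lower_inner: "i \<in> Basis \<Longrightarrow> lower c z u \<bullet> i = B c z u i"
  by (simp add: lower_def inner_sum_left inner_Basis if_distrib cong: if_cong)

lemma lower_linear: "z \<in> chart_image c \<Longrightarrow> linear (lower c z)"
  by (rule linearI) (simp_all add: lower_def linear_add[OF B_lin1] linear_scale[OF B_lin1]
      scaleR_add_left sum.distrib scaleR_sum_right)

lemma lower_inj:
  assumes z: "z \<in> chart_image c"
  shows "inj (lower c z)"
  unfolding linear_injective_0[OF lower_linear[OF z]]
proof (intro allI impI)
  fix u assume "lower c z u = 0"
  then have "B c z u i = 0" if "i \<in> Basis" for i
    using lower_inner[OF that, of z u] by simp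
  then have "B c z u v = 0" for v
    using linear_expand_basis[OF B_lin2[OF z], of u v] by simp
  then show "u = 0"
    by (rule metric_rep_nondeg[OF metric c z])
qed

lemma lower_smooth: "smooth_on (\<lambda>z. lower c z u) (chart_image c)"
  unfolding lower_def by (intro smooth_on_sum smooth_on_scaleR smooth_on_const B_smooth)

lemma koszul_smooth: "smooth_on (\<lambda>z. koszul c z u v w) (chart_image c)"
  unfolding koszul_def
  by (intro smooth_on_divide smooth_on_add smooth_on_diff smooth_on_const
      smooth_on_dwithin[OF upward op B_smooth]) simp

lemma lower_inv: "z \<in> chart_image c \<Longrightarrow> lower c z (inv (lower c z) u) = u"
  by (rule apply_inv[of "chart_image c" "lower c"]) (auto intro: open_image lower_linear lower_inj)

lemma lower_inv_linear: "z \<in> chart_image c \<Longrightarrow> linear (inv (lower c z))"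
  by (rule linear_inv[of "chart_image c" "lower c"]) (auto intro: open_image lower_linear lower_inj)

lemma symbols_smooth: "smooth_on (\<lambda>z. levi_civita_symbols c z u v) (chart_image c)"
  unfolding levi_civita_symbols_def
proof (rule smooth_on_linear_apply[where L="\<lambda>z. inv (lower c z)"])
  show "smooth_on (\<lambda>z. inv (lower c z) w) (chart_image c)" for w
    by (rule smooth_on_inv_linear[of "chart_image c" "lower c"])
      (auto intro: open_image lower_linear lower_inj lower_smooth)
  show "smooth_on (\<lambda>z. \<Sum>i\<in>Basis. koszul c z u v i *\<^sub>R i) (chart_image c)"
    by (intro smooth_on_sum smooth_on_scaleR smooth_on_const koszul_smooth)
qed (rule lower_inv_linear)

lemma symbols_koszul:
  assumes z: "z \<in> chart_image c"
  shows "B c z (levi_civita_symbols c z u v) w = koszul c z u v w"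
proof -
  have i: "B c z (levi_civita_symbols c z u v) i = koszul c z u v i" if "i \<in> Basis" for i
    unfolding lower_inner[OF that, symmetric] levi_civita_symbols_def lower_inv[OF z]
    using that by (simp add: inner_sum_left inner_Basis if_distrib cong: if_cong)
  show ?thesis
    unfolding linear_expand_basis[OF B_lin2[OF z], of _ w]
      linear_expand_basis[OF koszul_linear3[OF z], of _ _ w]
    by (rule sum.cong) (simp_all add: i)
qed

lemma symbols_linear: "z \<in> chart_image c \<Longrightarrow> linear (levi_civita_symbols c z u)"
  unfolding levi_civita_symbols_def
  by (rule linearI)
    (simp_all add: linear_add[OF koszul_linear2] linear_scale[OF koszul_linear2] scaleR_add_left sum.distrib
      linear_add[OF lower_inv_linear] scaleR_sum_right flip: linear_scale[OF lower_inv_linear])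

lemma symbols_sym: "z \<in> chart_image c \<Longrightarrow> levi_civita_symbols c z u v = levi_civita_symbols c z v u"
  by (simp add: levi_civita_symbols_def koszul_sym[of z u v])

text \<open>The two pairings are \<open>koszul c z w u v\<close> and
  \<open>koszul c z w v u\<close>. Their leading terms add up to the derivative along
  \<open>w\<close>, and the other four cancel by symmetry of the metric.\<close>

lemma symbols_metric:
  assumes z: "z \<in> chart_image c"
  shows "dwithin UNIV (\<lambda>y. B c y u v) z w =
    B c z (levi_civita_symbols c z w u) v + B c z u (levi_civita_symbols c z w v)"
  unfolding B_sym[OF z, of u "levi_civita_symbols c z w v"] symbols_koszul[OF z] koszul_def
    dB_sym[OF z, of v u] dB_sym[OF z, of v w] dB_sym[OF z, of u w]
  by (simp add: field_simps)

end

text \<open>The representative in \<open>c\<close> is the one in \<open>d\<close> evaluated on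
  Jacobians. It is differentiated in three places: the base point and the two Jacobians, whose
  derivatives are second derivatives of the transition.\<close>

lemma metric_rep_change_derivative:
  assumes c: "c \<in> charts_at M p" and d: "d \<in> charts_at M p"
  defines "D2 \<equiv> \<lambda>u h. dwithin UNIV (\<lambda>z. dwithin UNIV (local_rep id c d) z u) (snd c p) h"
    and "J \<equiv> local_deriv id c d p"
  shows "dwithin UNIV (\<lambda>z. B c z u v) (snd c p) h =
    dwithin UNIV (\<lambda>z. B d z (J u) (J v)) (snd d p) (J h) +
    B d (snd d p) (D2 u h) (J v) + B d (snd d p) (J u) (D2 v h)"
proof -
  have cc: "c \<in> charts M" "p \<in> fst c" "d \<in> charts M" "p \<in> fst d"
    using c d by (auto simp: charts_at_iff)
  let ?\<phi> = "local_rep id c d" and ?z = "snd c p"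
  define S where "S = snd c ` (fst c \<inter> fst d)"
  have S: "openin (top_of_set UNIV) S" "?z \<in> S" "smooth_on ?\<phi> S"
    unfolding S_def using local_dom_openin[OF cc(1,3)] transition_smooth[OF cc(1,3)] cc by blast+
  have img: "?\<phi> y \<in> chart_image d" if "y \<in> S" for y
    using that cc by (auto simp: S_def local_rep_eq)
  have \<phi>z: "?\<phi> ?z = snd d p"
    using cc by (simp add: local_rep_eq)
  have J: "dwithin UNIV ?\<phi> ?z = J"
    by (simp add: J_def local_deriv_id[OF c d])
  have D: "((\<lambda>y. dwithin UNIV ?\<phi> y u) has_derivative D2 u) (at ?z within UNIV)" for u
    unfolding D2_def by (rule smooth_on_has_derivative[OF upward S(1) smooth_on_dwithin[OF upward S(1,3)] S(2)])
  have D0: "((\<lambda>y. B d (?\<phi> y) a b) has_derivative (\<lambda>h. dwithin UNIV (\<lambda>y. B d y a b) (?\<phi> ?z) (J h)))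
      (at ?z within UNIV)" for a b
    unfolding J[symmetric]
    by (rule has_derivative_chain_openin[OF upward S(1) chart_image_openin[OF cc(3)] S(2) _
          smooth_on_has_derivative[OF upward S(1,3,2)] B_smooth[OF cc(3)]]) (use img in blast)
  have D1: "((\<lambda>y. B d (?\<phi> y) a (dwithin UNIV ?\<phi> y v)) has_derivative
      (\<lambda>h. dwithin UNIV (\<lambda>y. B d (?\<phi> y) a (dwithin UNIV ?\<phi> ?z v)) ?z h + B d (?\<phi> ?z) a (D2 v h)))
      (at ?z within UNIV)" for a
  proof (rule has_derivative_linear_apply[where L="\<lambda>y w. B d (?\<phi> y) a w", OF upward S(1,2) _ _ D])
    show "linear (\<lambda>w. B d (?\<phi> y) a w)" if "y \<in> S" for y
      by (rule B_lin2[OF cc(3) img[OF that]])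
    show "\<exists>l. ((\<lambda>y. B d (?\<phi> y) a b) has_derivative l) (at ?z within UNIV)" for b
      by (rule exI, rule D0)
  qed
  have D2: "((\<lambda>y. B d (?\<phi> y) (dwithin UNIV ?\<phi> y u) (dwithin UNIV ?\<phi> y v)) has_derivative
      (\<lambda>h. dwithin UNIV (\<lambda>y. B d (?\<phi> y) (dwithin UNIV ?\<phi> ?z u) (dwithin UNIV ?\<phi> y v)) ?z h +
        B d (?\<phi> ?z) (D2 u h) (dwithin UNIV ?\<phi> ?z v)))
      (at ?z within UNIV)"
  proof (rule has_derivative_linear_apply[where L="\<lambda>y w. B d (?\<phi> y) w (dwithin UNIV ?\<phi> y v)",
        OF upward S(1,2) _ _ D])
    show "linear (\<lambda>w. B d (?\<phi> y) w (dwithin UNIV ?\<phi> y v))" if "y \<in> S" for y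
      by (rule B_lin1[OF cc(3) img[OF that]])
    show "\<exists>l. ((\<lambda>y. B d (?\<phi> y) a (dwithin UNIV ?\<phi> y v)) has_derivative l) (at ?z within UNIV)" for a
      by (rule exI, rule D1)
  qed
  have "dwithin UNIV (\<lambda>z. B c z u v) ?z =
      dwithin UNIV (\<lambda>y. B d (?\<phi> y) (dwithin UNIV ?\<phi> y u) (dwithin UNIV ?\<phi> y v)) ?z"
  proof (rule dwithin_cong[OF S(1,2)])
    fix y assume "y \<in> S"
    then obtain q where q: "q \<in> fst c" "q \<in> fst d" "y = snd c q"
      by (auto simp: S_def)
    then have "c \<in> charts_at M q" "d \<in> charts_at M q"
      using cc by (auto simp: charts_at_iff)
    from metric_rep_change[OF this, of g u v] show
      "B c y u v = B d (?\<phi> y) (dwithin UNIV ?\<phi> y u) (dwithin UNIV ?\<phi> y v)"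
      using q cc local_deriv_id[OF \<open>c \<in> charts_at M q\<close> \<open>d \<in> charts_at M q\<close>]
      by (simp add: local_rep_eq)
  qed
  then show ?thesis
    unfolding dwithin_eq[OF upward UNIV_I D2] dwithin_eq[OF upward UNIV_I D1]
      dwithin_eq[OF upward UNIV_I D0] J \<phi>z by simp
qed

text \<open>In the Koszul formula six terms with second derivatives appear. By symmetry of
  \<open>?D2\<close> and of the metric four of them cancel, while the other two coincide and absorb
  the factor 1/2. Nondegeneracy then removes the pairing with a test vector.\<close>

lemma symbols_change:
  assumes c: "c \<in> charts_at M p" and d: "d \<in> charts_at M p"
  shows "local_deriv id c d p (levi_civita_symbols c (snd c p) u v) =
    dwithin UNIV (\<lambda>z. dwithin UNIV (local_rep id c d) z v) (snd c p) u +
    levi_civita_symbols d (snd d p) (local_deriv id c d p u) (local_deriv id c d p v)"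
proof -
  have cc: "c \<in> charts M" "p \<in> fst c" "d \<in> charts M" "p \<in> fst d"
    using c d by (auto simp: charts_at_iff)
  then have z: "snd c p \<in> chart_image c" "snd d p \<in> chart_image d"
    by auto
  let ?J = "local_deriv id c d p"
  let ?D2 = "\<lambda>u h. dwithin UNIV (\<lambda>z. dwithin UNIV (local_rep id c d) z u) (snd c p) h"
  have S: "openin (top_of_set UNIV) (snd c ` (fst c \<inter> fst d))" "snd c p \<in> snd c ` (fst c \<inter> fst d)"
    using local_dom_openin[OF cc(1,3)] cc by blast+
  have D2: "?D2 a b = ?D2 b a" for a b
    by (rule dwithin_symmetric[OF upward S(1) transition_smooth[OF cc(1,3)] S(2)])
  note Bs = B_sym[OF cc(3) z(2)]
  have K: "koszul c (snd c p) u v w = koszul d (snd d p) (?J u) (?J v) (?J w) + B d (snd d p) (?D2 v u) (?J w)"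
    for w
    unfolding koszul_def metric_rep_change_derivative[OF c d]
      D2[of u v] D2[of u w] D2[of v w] Bs[of "?J w"] Bs[of "?J u" "?D2 w v"] Bs[of "?J v" "?D2 w u"]
      Bs[of "?J u" "?D2 v w"] Bs[of "?J v" "?D2 u w"]
    by (simp add: field_simps Bs)
  have "?J (levi_civita_symbols c (snd c p) u v) - (?D2 v u + levi_civita_symbols d (snd d p) (?J u) (?J v)) = 0"
  proof (rule metric_rep_nondeg[OF metric cc(3) z(2)])
    fix w
    \<comment> \<open>The Jacobian is invertible, with the Jacobian of the opposite transition as
      inverse; hence test vectors of the form \<open>?J w'\<close> exhaust all vectors.\<close>
    define w' where "w' = local_deriv id d c p w"
    have w: "w = ?J w'"
      by (simp add: w'_def local_deriv_cocycle[OF d c d] local_deriv_same[OF d])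
    show "B d (snd d p) (?J (levi_civita_symbols c (snd c p) u v) -
        (?D2 v u + levi_civita_symbols d (snd d p) (?J u) (?J v))) w = 0"
      unfolding w linear_diff[OF B_lin1[OF cc(3) z(2)]] linear_add[OF B_lin1[OF cc(3) z(2)]]
        metric_rep_change[OF c d] symbols_koszul[OF cc(1) z(1)] symbols_koszul[OF cc(3) z(2)] K
      by simp
  qed
  then show ?thesis
    by simp
qed

lemma christoffel_levi_civita_symbols: "christoffel_symbols UNIV M g levi_civita_symbols"
  unfolding christoffel_symbols_def
  by (intro conjI ballI allI symbols_linear symbols_sym symbols_metric symbols_smooth symbols_change)

end

section \<open>Products with an interval\<close>

lemma second_countable_euclidean: "second_countable (euclidean :: 'a::second_countable_topology topology)"
proof -
  obtain \<B> :: "'a set set" where \<B>: "countable \<B>" "topological_basis \<B>"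
    using ex_countable_basis by blast
  show ?thesis
    unfolding second_countable_def
  proof (intro exI[of _ \<B>] conjI ballI allI impI)
    fix U and x :: 'a assume "openin euclidean U \<and> x \<in> U"
    then have "open U" "x \<in> U"
      by simp_all
    then show "\<exists>V\<in>\<B>. x \<in> V \<and> V \<subseteq> U"
      by (metis topological_basisE[OF \<B>(2)])
  qed (use \<B> topological_basis_open in auto)
qed

lemma second_countable_prod_topology:
  assumes "second_countable X" "second_countable Y"
  shows "second_countable (prod_topology X Y)"
proof -
  obtain A where A: "countable A" "\<forall>V\<in>A. openin X V"
      "\<forall>U x. openin X U \<and> x \<in> U \<longrightarrow> (\<exists>V\<in>A. x \<in> V \<and> V \<subseteq> U)"
    using assms(1) unfolding second_countable_def by (elim exE conjE)
  obtain B where B: "countable B" "\<forall>V\<in>B. openin Y V"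
      "\<forall>U x. openin Y U \<and> x \<in> U \<longrightarrow> (\<exists>V\<in>B. x \<in> V \<and> V \<subseteq> U)"
    using assms(2) unfolding second_countable_def by (elim exE conjE)
  show ?thesis
    unfolding second_countable_def
  proof (intro exI[of _ "(\<lambda>(V, W). V \<times> W) ` (A \<times> B)"] conjI ballI allI impI)
    show "countable ((\<lambda>(V, W). V \<times> W) ` (A \<times> B))"
      using A(1) B(1) by simp
    show "openin (prod_topology X Y) V" if "V \<in> (\<lambda>(V, W). V \<times> W) ` (A \<times> B)" for V
      using that A(2) B(2) by (auto simp: openin_prod_Times_iff)
    fix U p assume U: "openin (prod_topology X Y) U \<and> p \<in> U"
    obtain x y where p: "p = (x, y)"
      by fastforce
    obtain V W where VW: "openin X V" "openin Y W" "x \<in> V" "y \<in> W" "V \<times> W \<subseteq> U"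
      using U unfolding p openin_prod_topology_alt by meson
    obtain V' where V': "V' \<in> A" "x \<in> V'" "V' \<subseteq> V"
      using A(3) VW by meson
    obtain W' where W': "W' \<in> B" "y \<in> W'" "W' \<subseteq> W"
      using B(3) VW by meson
    show "\<exists>V\<in>(\<lambda>(V, W). V \<times> W) ` (A \<times> B). p \<in> V \<and> V \<subseteq> U"
    proof (rule bexI)
      show "p \<in> V' \<times> W' \<and> V' \<times> W' \<subseteq> U"
        using V' W' VW(5) p by blast
      show "V' \<times> W' \<in> (\<lambda>(V, W). V \<times> W) ` (A \<times> B)"
        using V'(1) W'(1) by force
    qed
  qed
qed

definition line_mfd :: "real set \<Rightarrow> (real, real) mfd" where
  "line_mfd I = \<lparr>mtop = top_of_set I, charts = {(I, id)}\<rparr>"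

definition lift_chart :: "real set \<Rightarrow> ('a, 'e) chart \<Rightarrow> ('a \<times> real, 'e \<times> real) chart" where
  "lift_chart I c = (fst c \<times> I, map_prod (snd c) id)"

text \<open>Recovers \<^term>\<open>c\<close> from \<^term>\<open>lift_chart I c\<close>; the argument \<open>0\<close> is arbitrary because
  coordinate maps are total functions.\<close>

definition base_chart :: "('a \<times> real, 'e \<times> real) chart \<Rightarrow> ('a, 'e) chart" where
  "base_chart k = (fst ` fst k, \<lambda>x. fst (snd k (x, 0)))"

lemma base_lift_chart: "I \<noteq> {} \<Longrightarrow> base_chart (lift_chart I c) = c"
  by (auto simp: base_chart_def lift_chart_def prod_eq_iff)

lemma map_prod_id_image: "map_prod f id ` (A \<times> B) = f ` A \<times> B"
  by force

lemma chart_image_lift: "chart_image (lift_chart I c) = chart_image c \<times> I"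
  by (simp add: lift_chart_def map_prod_id_image)

lemma fst_lift_chart: "fst (lift_chart I c) = fst c \<times> I"
  and snd_lift_chart: "snd (lift_chart I c) (x, t) = (snd c x, t)"
  by (simp_all add: lift_chart_def)

text \<open>\<open>J\<close> is the model of the second factor and \<open>I\<close> a relatively
  open part of it: \<open>UNIV\<close> and \<open>{0<..}\<close> for the cone, \<open>{0..}\<close>
  in both roles for the compactification. The model of the product is accordingly a whole space or a
  half-space.\<close>

locale line_product = base: model_manifold UNIV N for N :: "('a, 'e::euclidean_space) mfd" +
  fixes J I :: "real set"
  assumes J: "upward J" and I: "openin (top_of_set J) I" and ne: "I \<noteq> {}"
begin

abbreviation "H \<equiv> (UNIV :: 'e set) \<times> J"

abbreviation "lift \<equiv> lift_chart I :: ('a, 'e) chart \<Rightarrow> _"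

definition W :: "('a \<times> real, 'e \<times> real) mfd" where
  "W = prod_manifold N (line_mfd I)"

lemma charts_W: "charts W = lift ` charts N"
proof -
  have "charts N \<times> {(I, id :: real \<Rightarrow> real)} = (\<lambda>c. (c, (I, id))) ` charts N"
    by auto
  then show ?thesis
    by (simp add: W_def prod_manifold_def line_mfd_def image_image lift_chart_def)
qed

lemma mtop_W: "mtop W = prod_topology (mtop N) (top_of_set I)"
  by (simp add: W_def prod_manifold_def line_mfd_def)

lemma points_W: "points W = points N \<times> I"
  by (simp add: mtop_W)

lemma upward_H: "upward H"
  by (rule upward_Times[OF upward_UNIV J])

lemma I_subset: "I \<subseteq> J"
  using I openin_imp_subset by blast

lemma lift_homeomorphic:
  assumes c: "c \<in> charts N"
  shows "homeomorphic_map (subtopology (mtop W) (fst (lift c))) (top_of_set (chart_image (lift c))) (snd (lift c))"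
proof -
  obtain k where k: "homeomorphic_maps (subtopology (mtop N) (fst c)) (top_of_set (chart_image c)) (snd c) k"
    using base.chart_homeomorphic[OF c] unfolding homeomorphic_map_maps ..
  have "homeomorphic_maps (prod_topology (subtopology (mtop N) (fst c)) (top_of_set I))
      (prod_topology (top_of_set (chart_image c)) (top_of_set I)) (\<lambda>(x, y). (snd c x, id y)) (\<lambda>(x, y). (k x, id y))"
    using k unfolding homeomorphic_maps_prod by (simp add: homeomorphic_maps_def)
  moreover have "prod_topology (subtopology (mtop N) (fst c)) (top_of_set I) =
      subtopology (mtop W) (fst (lift c))"
    unfolding mtop_W fst_lift_chart subtopology_Times[symmetric]
    by (simp add: subtopology_Times subtopology_subtopology)
  moreover have "prod_topology (top_of_set (chart_image c)) (top_of_set I) = top_of_set (chart_image (lift c))"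
    unfolding chart_image_lift by (simp add: subtopology_Times flip: euclidean_product_topology)
  moreover have "(\<lambda>(x, y). (snd c x, id y)) = snd (lift c)"
    by (auto simp: lift_chart_def)
  ultimately show ?thesis
    unfolding homeomorphic_map_maps by auto
qed

lemma chart_image_lift_openin:
  assumes "c \<in> charts N"
  shows "openin (top_of_set H) (chart_image (lift c))"
  unfolding chart_image_lift by (rule openin_Times[OF base.chart_image_openin[OF assms] I])

lemma inv_chart_lift:
  assumes "c \<in> charts N" "z \<in> chart_image c" "t \<in> I"
  shows "inv_chart (lift c) (z, t) = (inv_chart c z, t)"
proof -
  obtain x where x: "x \<in> fst c" "z = snd c x"
    using assms(2) by blast
  have "inj_on (snd (lift c)) (fst (lift c))"
    using base.chart_inj[OF assms(1)] by (auto simp: lift_chart_def inj_on_def)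
  then have "inv_chart (lift c) (snd (lift c) (x, t)) = (x, t)"
    by (rule inv_into_f_f) (use x assms in \<open>simp add: fst_lift_chart\<close>)
  then show ?thesis
    using x assms(1) by (simp add: snd_lift_chart base.inv_chart)
qed

text \<open>All lifted charts use the identity on \<open>I\<close>, so transitions are products with
  the identity. Every derivative of a transition on the product reduces to the base through
  this.\<close>

lemma transition_lift:
  assumes "c \<in> charts N" "z \<in> chart_image c" "t \<in> I"
  shows "local_rep id (lift c) (lift d) (z, t) = (local_rep id c d z, t)"
  by (simp add: local_rep_def inv_chart_lift[OF assms] snd_lift_chart)

lemma local_dom_lift: "snd (lift c) ` (fst (lift c) \<inter> fst (lift d)) = snd c ` (fst c \<inter> fst d) \<times> I"
  by (simp add: lift_chart_def Times_Int_Times map_prod_id_image)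

lemma manifold_W: "smooth_manifold_on H W"
  unfolding smooth_manifold_on_def
proof (intro conjI ballI)
  have N: "Hausdorff_space (mtop N)" "second_countable (mtop N)" "points N \<noteq> {}"
      "(\<Union>c\<in>charts N. fst c) = points N"
    using base.manifold by (simp_all add: smooth_manifold_on_def)
  show "Hausdorff_space (mtop W)"
    unfolding mtop_W by (simp add: Hausdorff_space_prod_topology N(1) Hausdorff_space_subtopology)
  show "second_countable (mtop W)"
    unfolding mtop_W
    by (intro second_countable_prod_topology N(2) second_countable_subtopology second_countable_euclidean)
  show "points W \<noteq> {}"
    using N(3) ne by (simp add: points_W)
  show "(\<Union>c\<in>charts W. fst c) = points W"
    unfolding charts_W points_W N(4)[symmetric] by (auto simp: fst_lift_chart)
next
  fix k assume "k \<in> charts W"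
  then obtain c where c: "c \<in> charts N" "k = lift c"
    unfolding charts_W by blast
  show "openin (mtop W) (fst k)"
    unfolding c(2) fst_lift_chart mtop_W openin_prod_Times_iff
    using base.chart_openin[OF c(1)] by simp
  show "openin (top_of_set H) (chart_image k)"
    unfolding c(2) by (rule chart_image_lift_openin[OF c(1)])
  show "homeomorphic_map (subtopology (mtop W) (fst k)) (top_of_set (chart_image k)) (snd k)"
    unfolding c(2) by (rule lift_homeomorphic[OF c(1)])
  fix l assume "l \<in> charts W"
  then obtain d where d: "d \<in> charts N" "l = lift d"
    unfolding charts_W by blast
  show "smooth_on (local_rep id k l) (local_dom id k l)"
    unfolding c(2) d(2) local_dom_id local_dom_lift
  proof (rule smooth_on_cong)
    show "smooth_on (\<lambda>p. (local_rep id c d (fst p), snd p)) (snd c ` (fst c \<inter> fst d) \<times> I)"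
      by (intro smooth_on_Pair smooth_on_compose[OF smooth_on_fst[OF smooth_on_id]
            base.transition_smooth[OF c(1) d(1)]] smooth_on_snd smooth_on_id) auto
    show "(local_rep id c d (fst p), snd p) = local_rep id (lift c) (lift d) p"
      if "p \<in> snd c ` (fst c \<inter> fst d) \<times> I" for p
      using transition_lift[OF c(1), of "fst p" "snd p" d] that by auto
  qed
qed

sublocale total: model_manifold H W
  by unfold_locales (rule upward_H, rule manifold_W)

lemma lift_charts: "c \<in> charts N \<Longrightarrow> lift c \<in> charts W"
  by (simp add: charts_W)

lemma charts_at_W: "charts_at W (x, t) = (if t \<in> I then lift ` charts_at N x else {})"
proof -
  have "charts_at W (x, t) = lift ` {c \<in> charts N. (x, t) \<in> fst (lift c)}"
    unfolding charts_at_def charts_W by blast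
  then show ?thesis
    by (simp add: fst_lift_chart charts_at_def)
qed

lemma lift_charts_at: "c \<in> charts_at N x \<Longrightarrow> t \<in> I \<Longrightarrow> lift c \<in> charts_at W (x, t)"
  by (simp add: charts_at_W)

lemma charts_at_WE:
  assumes "k \<in> charts_at W (x, t)"
  obtains c where "c \<in> charts_at N x" "t \<in> I" "k = lift c"
  using assms by (auto simp: charts_at_W split: if_splits)

lemma has_derivative_fst_comp:
  assumes "(F has_derivative F') (at z)"
  shows "((\<lambda>p. F (fst p)) has_derivative (\<lambda>v. F' (fst v))) (at (z, t) within S)"
  by (rule has_derivative_compose[OF has_derivative_fst[OF has_derivative_ident]]) (simp add: assms)

lemma has_derivative_snd_comp:
  fixes h :: "real \<Rightarrow> real"
  assumes "(h has_real_derivative h') (at t)"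
  shows "((\<lambda>p. h (snd p)) has_derivative (\<lambda>v. h' * snd v)) (at (z, t) within S)"
  by (rule has_derivative_compose[OF has_derivative_snd[OF has_derivative_ident]])
    (use assms in \<open>simp add: has_field_derivative_def\<close>)

lemma transition_lift_has_derivative:
  assumes c: "c \<in> charts_at N x" and d: "d \<in> charts_at N x" and t: "t \<in> I"
  shows "(local_rep id (lift c) (lift d) has_derivative (\<lambda>v. (local_deriv id c d x (fst v), snd v)))
    (at (snd c x, t) within H)"
proof -
  have cc: "c \<in> charts N" "x \<in> fst c" "d \<in> charts N" "x \<in> fst d"
    using c d by (auto simp: charts_at_iff)
  have "((\<lambda>p. (local_rep id c d (fst p), snd p)) has_derivative (\<lambda>v. (local_deriv id c d x (fst v), snd v)))
      (at (snd c x, t) within H)"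
    by (intro has_derivative_Pair has_derivative_fst_comp has_derivative_snd has_derivative_ident
        base.transition_has_derivative[OF c d])
  then show ?thesis
  proof (rule has_derivative_cong_openin[OF chart_image_lift_openin[OF cc(1)], rotated 2])
    show "(snd c x, t) \<in> chart_image (lift c)"
      unfolding chart_image_lift using cc t by auto
    show "(local_rep id c d (fst p), snd p) = local_rep id (lift c) (lift d) p"
      if "p \<in> chart_image (lift c)" for p
      using transition_lift[OF cc(1), of "fst p" "snd p" d] that unfolding chart_image_lift by auto
  qed
qed

lemma local_deriv_lift:
  assumes "c \<in> charts_at N x" "d \<in> charts_at N x" "t \<in> I"
  shows "local_deriv id (lift c) (lift d) (x, t) v = (local_deriv id c d x (fst v), snd v)"
proof -
  have z: "(snd c x, t) \<in> H"
    using assms(3) I_subset by auto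
  show ?thesis
    unfolding total.local_deriv_id[OF lift_charts_at[OF assms(1,3)] lift_charts_at[OF assms(2,3)]]
      snd_lift_chart dwithin_eq[OF upward_H z transition_lift_has_derivative[OF assms]] ..
qed

lemma tangent_lift:
  assumes "v \<in> tangent_space W (x, t)" "c \<in> charts_at N x" "d \<in> charts_at N x" "t \<in> I"
  shows "v (lift d) = (local_deriv id c d x (fst (v (lift c))), snd (v (lift c)))"
  using tangent_space_change[OF assms(1) lift_charts_at[OF assms(2,4)] lift_charts_at[OF assms(3,4)]]
  unfolding local_deriv_lift[OF assms(2-4)] .

lemma some_chart_W:
  assumes "x \<in> points N" "t \<in> I"
  obtains c where "c \<in> charts_at N x" "some_chart W (x, t) = lift c"
  using total.some_chart_at[of "(x, t)"] charts_at_WE[of "some_chart W (x, t)" x t] assms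
  by (auto simp: points_W)

text \<open>Lifted transitions leave the second coordinate alone, so the value found in the chosen
  chart can be read off in any lifted chart. The derivative of \<open>h\<close> is two-sided, also
  at an endpoint of \<open>I\<close>.\<close>

lemma dfun_snd_comp:
  assumes c: "c \<in> charts_at N x" and t: "t \<in> I" and v: "v \<in> tangent_space W (x, t)"
    and f: "\<And>y s. s \<in> I \<Longrightarrow> f (y, s) = h s" and h: "(h has_real_derivative h') (at t)"
  shows "dfun W f (x, t) v = h' * snd (v (lift c))"
proof -
  have x: "x \<in> points N"
    using c base.chart_point unfolding charts_at_iff by blast
  obtain d where d: "d \<in> charts_at N x" "some_chart W (x, t) = lift d"
    by (rule some_chart_W[OF x t])
  then have dd: "d \<in> charts N" "x \<in> fst d"
    by (auto simp: charts_at_iff)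
  have z: "(snd d x, t) \<in> chart_image (lift d)" "(snd d x, t) \<in> H"
    using dd t I_subset by (auto simp: chart_image_lift)
  have "(f \<circ> inv_chart (lift d) has_derivative (\<lambda>v. h' * snd v)) (at (snd d x, t) within H)"
  proof (rule has_derivative_cong_openin[OF chart_image_lift_openin[OF dd(1)] z(1) _
        has_derivative_snd_comp[OF h]])
    fix p assume "p \<in> chart_image (lift d)"
    then show "h (snd p) = (f \<circ> inv_chart (lift d)) p"
      using inv_chart_lift[OF dd(1), of "fst p" "snd p"] f unfolding chart_image_lift by auto
  qed
  from dwithin_eq[OF upward_H z(2) this]
  have "dfun W f (x, t) v = h' * snd (v (lift d))"
    using total.dfun_some_chart[of "(x, t)" f v] x t d(2) by (simp add: points_W snd_lift_chart)
  then show ?thesis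
    using tangent_lift[OF v c d(1) t] by simp
qed

text \<open>The chosen source chart lies over some base chart \<open>e\<close>; the cocycle rule
  replaces \<open>e\<close> by the given \<open>c\<close>.\<close>

lemma differential_fst:
  assumes c: "c \<in> charts_at N x" and t: "t \<in> I" and v: "v \<in> tangent_space W (x, t)"
  shows "differential W N fst (x, t) v = coord_vector N c x (fst (v (lift c)))"
proof
  fix d
  have x: "x \<in> points N"
    using c base.chart_point unfolding charts_at_iff by blast
  obtain e where e: "e \<in> charts_at N x" "some_chart W (x, t) = lift e"
    by (rule some_chart_W[OF x t])
  then have ee: "e \<in> charts N" "x \<in> fst e"
    by (auto simp: charts_at_iff)
  show "differential W N fst (x, t) v d = coord_vector N c x (fst (v (lift c))) d"
  proof (cases "d \<in> charts_at N x")
    case True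
    then have dd: "d \<in> charts N" "x \<in> fst d"
      by (auto simp: charts_at_iff)
    have dom: "local_dom fst (lift e) d = snd e ` (fst e \<inter> fst d) \<times> I"
    proof -
      have "fst (lift e) \<inter> fst -` fst d = (fst e \<inter> fst d) \<times> I"
        by (auto simp: fst_lift_chart)
      then show ?thesis
        by (simp add: local_dom_def lift_chart_def map_prod_id_image)
    qed
    have op: "openin (top_of_set H) (snd e ` (fst e \<inter> fst d) \<times> I)"
      by (rule openin_Times[OF base.local_dom_openin[OF ee(1) dd(1)] I])
    have z: "(snd e x, t) \<in> snd e ` (fst e \<inter> fst d) \<times> I" "(snd e x, t) \<in> H"
      using ee dd t I_subset by auto
    have "(local_rep fst (lift e) d has_derivative (\<lambda>v. local_deriv id e d x (fst v)))
        (at (snd e x, t) within H)"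
    proof (rule has_derivative_cong_openin[OF op z(1) _ has_derivative_fst_comp])
      show "(local_rep id e d has_derivative local_deriv id e d x) (at (snd e x))"
        by (rule base.transition_has_derivative[OF e(1) True])
      fix p assume "p \<in> snd e ` (fst e \<inter> fst d) \<times> I"
      then show "local_rep id e d (fst p) = local_rep fst (lift e) d p"
        using inv_chart_lift[OF ee(1), of "fst p" "snd p"] by (auto simp: local_rep_def)
    qed
    then have "local_deriv fst (lift e) d (x, t) (v (lift e)) = local_deriv id e d x (fst (v (lift e)))"
      unfolding local_deriv_def[of fst] dom snd_lift_chart frechet_derivative_openin[OF op z(1)]
      by (simp add: dwithin_eq[OF upward_H z(2)])
    then show ?thesis
      using tangent_lift[OF v c e(1) t] base.local_deriv_cocycle[OF c e(1) True]
      by (simp add: differential_def e(2) True coord_vector_def)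
  qed (simp add: differential_def coord_vector_def)
qed

end

section \<open>Warped products\<close>

text \<open>The derivatives \<open>a'\<close> and \<open>b'\<close> are parameters of their own, so
  that the symbols become explicit expressions in given functions. The warping functions are only
  asked to be nonzero, in keeping with arbitrary signature.\<close>

locale warped_product = line_product N J I for N :: "('a, 'e::euclidean_space) mfd" and J I +
  fixes \<gamma> :: "('a, 'e) metric" and a a' b b' :: "real \<Rightarrow> real"
    and \<Gamma> :: "('a, 'e) chart \<Rightarrow> 'e \<Rightarrow> 'e \<Rightarrow> 'e \<Rightarrow> 'e"
  assumes \<gamma>: "pseudo_riemannian_metric N \<gamma>" and \<Gamma>: "christoffel_symbols UNIV N \<gamma> \<Gamma>"
    and da: "\<And>t. t \<in> I \<Longrightarrow> (a has_real_derivative a' t) (at t)"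
    and db: "\<And>t. t \<in> I \<Longrightarrow> (b has_real_derivative b' t) (at t)"
    and smooth_a: "smooth_on a I" and smooth_a': "smooth_on a' I"
    and smooth_b: "smooth_on b I" and smooth_b': "smooth_on b' I"
    and a_nz: "\<And>t. t \<in> I \<Longrightarrow> a t \<noteq> 0" and b_nz: "\<And>t. t \<in> I \<Longrightarrow> b t \<noteq> 0"
begin

definition warped_metric :: "('a \<times> real, 'e \<times> real) metric" where
  "warped_metric q v w = a (snd q) * (dfun W snd q v * dfun W snd q w) +
     b (snd q) * \<gamma> (fst q) (differential W N fst q v) (differential W N fst q w)"

text \<open>The outcome of the Koszul formula for \<open>a dt^2 + b \<gamma>\<close>: mixed terms
  \<open>b' / (2 b)\<close>, and in the radial component \<open>a' / (2 a)\<close> on radial vectors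
  and \<open>- b' / (2 a)\<close> times \<open>\<gamma>\<close> on base vectors. Symbols are indexed
  by charts of the product, so the base chart has to be recovered from \<open>k\<close>.\<close>

definition warped_symbols ::
  "('a \<times> real, 'e \<times> real) chart \<Rightarrow> 'e \<times> real \<Rightarrow> 'e \<times> real \<Rightarrow> 'e \<times> real \<Rightarrow> 'e \<times> real" where
  "warped_symbols k p u v =
     (\<Gamma> (base_chart k) (fst p) (fst u) (fst v) +
        (b' (snd p) / (2 * b (snd p))) *\<^sub>R (snd u *\<^sub>R fst v + snd v *\<^sub>R fst u),
      (a' (snd p) * (snd u * snd v) - b' (snd p) * metric_rep N \<gamma> (base_chart k) (fst p) (fst u) (fst v)) /
        (2 * a (snd p)))"

abbreviation "B \<equiv> metric_rep N \<gamma>"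

lemmas B_sym = base.metric_rep_sym[OF \<gamma>]
  and B_lin1 = base.metric_rep_linear_left[OF \<gamma>]
  and B_lin2 = base.metric_rep_linear_right[OF \<gamma>]
  and B_smooth = base.metric_rep_smooth[OF \<gamma>]

lemma smooth_on_fst_comp: "smooth_on F S \<Longrightarrow> smooth_on (\<lambda>p. F (fst p)) (S \<times> I)"
  for F :: "'e \<Rightarrow> 'g::real_normed_vector"
  by (rule smooth_on_compose[OF smooth_on_fst[OF smooth_on_id]]) auto

lemma smooth_on_snd_comp: "smooth_on h I \<Longrightarrow> smooth_on (\<lambda>p. h (snd p)) ((S :: 'e set) \<times> I)"
  for h :: "real \<Rightarrow> real"
  by (rule smooth_on_compose[OF smooth_on_snd[OF smooth_on_id]]) auto

lemma warped_metric_eq: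
  assumes c: "c \<in> charts_at N x" and t: "t \<in> I"
    and u: "u \<in> tangent_space W (x, t)" and v: "v \<in> tangent_space W (x, t)"
  shows "warped_metric (x, t) u v = a t * (snd (u (lift c)) * snd (v (lift c))) +
    b t * B c (snd c x) (fst (u (lift c))) (fst (v (lift c)))"
proof -
  have d: "dfun W snd (x, t) w = snd (w (lift c))" if "w \<in> tangent_space W (x, t)" for w
    using dfun_snd_comp[OF c t that, of snd "\<lambda>s. s" 1] by (simp add: DERIV_ident)
  have "inv_chart c (snd c x) = x"
    using c by (simp add: charts_at_iff base.inv_chart)
  then show ?thesis
    unfolding warped_metric_def snd_conv fst_conv d[OF u] d[OF v] differential_fst[OF c t u]
      differential_fst[OF c t v] metric_rep_def by simp
qed

lemma warped_metric_rep:
  assumes c: "c \<in> charts N" and z: "z \<in> chart_image c" and t: "t \<in> I"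
  shows "metric_rep W warped_metric (lift c) (z, t) u v =
    a t * (snd u * snd v) + b t * B c z (fst u) (fst v)"
proof -
  obtain x where x: "x \<in> fst c" "z = snd c x"
    using z by blast
  then have cx: "c \<in> charts_at N x"
    using c by (simp add: charts_at_iff)
  note k = lift_charts_at[OF cx t]
  have "inv_chart (lift c) (z, t) = (x, t)"
    using inv_chart_lift[OF c z t] base.inv_chart[OF c x(1)] x(2) by simp
  then show ?thesis
    unfolding metric_rep_def[of W]
    by (simp add: warped_metric_eq[OF cx t total.coord_vector_tangent[OF k] total.coord_vector_tangent[OF k]]
        total.coord_vector_same[OF k] x(2))
qed

lemma pseudo_riemannian_warped: "pseudo_riemannian_metric W warped_metric"
  unfolding pseudo_riemannian_metric_def
proof (intro conjI ballI allI impI)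
  fix q assume "q \<in> points W"
  then obtain x t where q: "q = (x, t)" "x \<in> points N" "t \<in> I"
    by (auto simp: points_W)
  define c where "c = some_chart N x"
  have c: "c \<in> charts_at N x"
    unfolding c_def by (rule base.some_chart_at[OF q(2)])
  then have cc: "c \<in> charts N" "snd c x \<in> chart_image c"
    by (auto simp: charts_at_iff)
  note eq = warped_metric_eq[OF c q(3)] and k = lift_charts_at[OF c q(3)]
  fix u assume u: "u \<in> tangent_space W q"
  note u' = u[unfolded q(1)]
  {
    fix v assume v: "v \<in> tangent_space W q"
    note v' = v[unfolded q(1)]
    show "warped_metric q u v = warped_metric q v u"
      unfolding q(1) eq[OF u' v'] eq[OF v' u'] B_sym[OF cc, of "fst (u (lift c))"] by simp
    fix w and r s :: real assume w: "w \<in> tangent_space W q"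
    note w' = w[unfolded q(1)]
    show "warped_metric q (\<lambda>d. r *\<^sub>R u d + s *\<^sub>R v d) w = r * warped_metric q u w + s * warped_metric q v w"
      unfolding q(1) eq[OF total.tangent_space_lincomb[OF u' v'] w'] eq[OF u' w'] eq[OF v' w']
      by (simp add: linear_add[OF B_lin1[OF cc]] linear_scale[OF B_lin1[OF cc]] algebra_simps)
  }
  assume *: "\<forall>v\<in>tangent_space W q. warped_metric q u v = 0"
  \<comment> \<open>Testing against \<open>(v, 0)\<close> isolates the base component of
    \<open>u\<close>, testing against \<open>(0, 1)\<close> the radial one.\<close>
  have 0: "a t * (snd (u (lift c)) * \<beta>) + b t * B c (snd c x) (fst (u (lift c))) v = 0" for v \<beta>
    using *[unfolded q(1), rule_format, OF total.coord_vector_tangent[OF k, of "(v, \<beta>)"]]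
    unfolding eq[OF u' total.coord_vector_tangent[OF k]] total.coord_vector_same[OF k] by simp
  have "B c (snd c x) (fst (u (lift c))) v = 0" for v
    using 0[of 0 v] b_nz[OF q(3)] by simp
  then have "fst (u (lift c)) = 0"
    by (rule base.metric_rep_nondeg[OF \<gamma> cc])
  moreover have "snd (u (lift c)) = 0"
    using 0[of 1 0] a_nz[OF q(3)] linear_0[OF B_lin2[OF cc]] by simp
  ultimately have "u (lift c) = 0"
    by (simp add: prod_eq_iff)
  then have "coord_vector W (lift c) (x, t) 0 = u"
    using total.coord_vector_of_tangent[OF k u'] by simp
  moreover have "coord_vector W (lift c) (x, t) 0 = (\<lambda>d. 0)"
    using total.coord_vector_linear[OF k, of 0 0 0 0] by simp
  ultimately show "u = (\<lambda>d. 0)"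
    by simp
next
  fix k and u v :: "'e \<times> real" assume "k \<in> charts W"
  then obtain c where c: "c \<in> charts N" "k = lift c"
    unfolding charts_W by blast
  have "smooth_on (\<lambda>p. metric_rep W warped_metric (lift c) p u v) (chart_image c \<times> I)"
  proof (rule smooth_on_cong)
    show "smooth_on (\<lambda>p. a (snd p) * (snd u * snd v) + b (snd p) * B c (fst p) (fst u) (fst v))
        (chart_image c \<times> I)"
      by (intro smooth_on_add smooth_on_mult smooth_on_const smooth_on_snd_comp smooth_on_fst_comp
          smooth_a smooth_b B_smooth c(1))
    show "a (snd p) * (snd u * snd v) + b (snd p) * B c (fst p) (fst u) (fst v) =
        metric_rep W warped_metric (lift c) p u v" if "p \<in> chart_image c \<times> I" for p
      using warped_metric_rep[OF c(1), of "fst p" "snd p" u v] that by (simp add: mem_Times_iff)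
  qed
  then show "smooth_on (\<lambda>x. let p = inv_chart k x in
      warped_metric p (coord_vector W k p u) (coord_vector W k p v)) (chart_image k)"
    unfolding c(2) chart_image_lift metric_rep_def Let_def .
qed

lemma warped_symbols_lift:
  "warped_symbols (lift c) (z, t) u v =
     (\<Gamma> c z (fst u) (fst v) + (b' t / (2 * b t)) *\<^sub>R (snd u *\<^sub>R fst v + snd v *\<^sub>R fst u),
      (a' t * (snd u * snd v) - b' t * B c z (fst u) (fst v)) / (2 * a t))"
  by (simp add: warped_symbols_def base_lift_chart[OF ne])

lemma warped_symbols_linear:
  assumes "c \<in> charts N" "z \<in> chart_image c"
  shows "linear (warped_symbols (lift c) (z, t) u)"
  by (rule linearI)
    (simp_all add: warped_symbols_lift linear_add[OF B_lin2[OF assms]] linear_scale[OF B_lin2[OF assms]]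
      linear_add[OF base.christoffel_linear[OF \<gamma> \<Gamma> assms]]
      linear_scale[OF base.christoffel_linear[OF \<gamma> \<Gamma> assms]] algebra_simps add_divide_distrib diff_divide_distrib)

lemma warped_symbols_sym:
  assumes "c \<in> charts N" "z \<in> chart_image c"
  shows "warped_symbols (lift c) (z, t) u v = warped_symbols (lift c) (z, t) v u"
  unfolding warped_symbols_lift base.christoffel_sym[OF \<gamma> \<Gamma> assms, of "fst u"]
    B_sym[OF assms, of "fst u"] by (simp add: mult.commute add.commute)

lemma warped_symbols_smooth:
  assumes c: "c \<in> charts N"
  shows "smooth_on (\<lambda>p. warped_symbols (lift c) p u v) (chart_image c \<times> I)"
  unfolding warped_symbols_def base_lift_chart[OF ne]
  by (intro smooth_on_Pair smooth_on_add smooth_on_scaleR smooth_on_diff smooth_on_divide smooth_on_mult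
      smooth_on_const smooth_on_snd_comp smooth_on_fst_comp base.christoffel_smooth[OF \<gamma> \<Gamma>]
      B_smooth smooth_a smooth_a' smooth_b smooth_b' c) (auto simp: a_nz b_nz)

lemma warped_symbols_metric:
  assumes c: "c \<in> charts N" and z: "z \<in> chart_image c" and t: "t \<in> I"
  shows "dwithin H (\<lambda>p. metric_rep W warped_metric (lift c) p u v) (z, t) w =
    metric_rep W warped_metric (lift c) (z, t) (warped_symbols (lift c) (z, t) w u) v +
    metric_rep W warped_metric (lift c) (z, t) u (warped_symbols (lift c) (z, t) w v)"
proof -
  have zt: "(z, t) \<in> chart_image (lift c)" "(z, t) \<in> H"
    using z t I_subset by (auto simp: chart_image_lift)
  have B': "((\<lambda>y. B c y (fst u) (fst v)) has_derivative dwithin UNIV (\<lambda>y. B c y (fst u) (fst v)) z) (at z)"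
    using smooth_on_has_derivative[OF base.upward base.chart_image_openin[OF c] B_smooth[OF c] z] .
  have D: "((\<lambda>p. a (snd p) * (snd u * snd v) + b (snd p) * B c (fst p) (fst u) (fst v)) has_derivative
      (\<lambda>w. a' t * snd w * (snd u * snd v) +
        (b t * dwithin UNIV (\<lambda>y. B c y (fst u) (fst v)) z (fst w) + b' t * snd w * B c z (fst u) (fst v))))
      (at (z, t) within H)"
    by (rule has_derivative_eq_rhs[OF has_derivative_add[OF
          has_derivative_mult_left[OF has_derivative_snd_comp[OF da[OF t]]]
          has_derivative_mult[OF has_derivative_snd_comp[OF db[OF t]] has_derivative_fst_comp[OF B']]]])
      simp
  have D': "((\<lambda>p. metric_rep W warped_metric (lift c) p u v) has_derivative
      (\<lambda>w. a' t * snd w * (snd u * snd v) +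
        (b t * dwithin UNIV (\<lambda>y. B c y (fst u) (fst v)) z (fst w) + b' t * snd w * B c z (fst u) (fst v))))
      (at (z, t) within H)"
  proof (rule has_derivative_cong_openin[OF chart_image_lift_openin[OF c] zt(1) _ D])
    fix p assume "p \<in> chart_image (lift c)"
    then show "a (snd p) * (snd u * snd v) + b (snd p) * B c (fst p) (fst u) (fst v) =
        metric_rep W warped_metric (lift c) p u v"
      using warped_metric_rep[OF c, of "fst p" "snd p" u v] by (simp add: chart_image_lift mem_Times_iff)
  qed
  note lin = linear_add[OF B_lin1[OF c z]] linear_scale[OF B_lin1[OF c z]]
    linear_add[OF B_lin2[OF c z]] linear_scale[OF B_lin2[OF c z]]
  show ?thesis
    unfolding dwithin_eq[OF upward_H zt(2) D'] warped_metric_rep[OF c z t] warped_symbols_lift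
      base.christoffel_metric[OF \<gamma> \<Gamma> c z] fst_conv snd_conv lin B_sym[OF c z, of "fst u" "fst w"]
    using a_nz[OF t] b_nz[OF t] by (simp add: field_simps)
qed

text \<open>The Jacobian of a transition times the identity, applied to a fixed \<open>v\<close>,
  has the constant second component \<open>snd v\<close>. The inhomogeneous part of the
  transformation law is therefore that of the base.\<close>

lemma transition_second_derivative:
  assumes c: "c \<in> charts_at N x" and d: "d \<in> charts_at N x" and t: "t \<in> I"
  shows "dwithin H (\<lambda>p. dwithin H (local_rep id (lift c) (lift d)) p v) (snd c x, t) u =
    (dwithin UNIV (\<lambda>z. dwithin UNIV (local_rep id c d) z (fst v)) (snd c x) (fst u), 0)"
proof -
  have cc: "c \<in> charts N" "x \<in> fst c" "d \<in> charts N" "x \<in> fst d"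
    using c d by (auto simp: charts_at_iff)
  let ?S = "snd c ` (fst c \<inter> fst d)"
  have op: "openin (top_of_set H) (?S \<times> I)"
    by (rule openin_Times[OF base.local_dom_openin[OF cc(1,3)] I])
  have z: "(snd c x, t) \<in> ?S \<times> I" "(snd c x, t) \<in> H" "snd c x \<in> ?S"
    using cc t I_subset by auto
  have "((\<lambda>z. dwithin UNIV (local_rep id c d) z (fst v)) has_derivative
      dwithin UNIV (\<lambda>z. dwithin UNIV (local_rep id c d) z (fst v)) (snd c x)) (at (snd c x))"
    by (rule smooth_on_has_derivative[OF base.upward base.local_dom_openin[OF cc(1,3)]
          smooth_on_dwithin[OF base.upward base.local_dom_openin[OF cc(1,3)]
            base.transition_smooth[OF cc(1,3)]] z(3)])
  then have D: "((\<lambda>p. (dwithin UNIV (local_rep id c d) (fst p) (fst v), snd v)) has_derivative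
      (\<lambda>u. (dwithin UNIV (\<lambda>z. dwithin UNIV (local_rep id c d) z (fst v)) (snd c x) (fst u), 0)))
      (at (snd c x, t) within H)"
    by (intro has_derivative_Pair has_derivative_fst_comp has_derivative_const)
  have "((\<lambda>p. dwithin H (local_rep id (lift c) (lift d)) p v) has_derivative
      (\<lambda>u. (dwithin UNIV (\<lambda>z. dwithin UNIV (local_rep id c d) z (fst v)) (snd c x) (fst u), 0)))
      (at (snd c x, t) within H)"
  proof (rule has_derivative_cong_openin[OF op z(1) _ D])
    fix p assume "p \<in> ?S \<times> I"
    then obtain y s where p: "p = (snd c y, s)" "y \<in> fst c" "y \<in> fst d" "s \<in> I"
      by auto
    then have y: "c \<in> charts_at N y" "d \<in> charts_at N y"
      using cc by (auto simp: charts_at_iff)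
    show "(dwithin UNIV (local_rep id c d) (fst p) (fst v), snd v) =
        dwithin H (local_rep id (lift c) (lift d)) p v"
      using local_deriv_lift[OF y p(4), of v] base.local_deriv_id[OF y]
        total.local_deriv_id[OF lift_charts_at[OF y(1) p(4)] lift_charts_at[OF y(2) p(4)]]
      by (simp add: p(1) snd_lift_chart)
  qed
  from dwithin_eq[OF upward_H z(2) this] show ?thesis
    by simp
qed

text \<open>The base law supplies the inhomogeneous term, the mixed terms are linear in the base
  components, and the radial component is invariant because the metric representative is.\<close>

lemma warped_symbols_change:
  assumes c: "c \<in> charts_at N x" and d: "d \<in> charts_at N x" and t: "t \<in> I"
  shows "local_deriv id (lift c) (lift d) (x, t) (warped_symbols (lift c) (snd c x, t) u v) =
    dwithin H (\<lambda>p. dwithin H (local_rep id (lift c) (lift d)) p v) (snd c x, t) u +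
    warped_symbols (lift d) (snd d x, t) (local_deriv id (lift c) (lift d) (x, t) u)
      (local_deriv id (lift c) (lift d) (x, t) v)"
  unfolding local_deriv_lift[OF assms] transition_second_derivative[OF assms] warped_symbols_lift
    fst_conv snd_conv base.metric_rep_change[OF c d] base.christoffel_change[OF \<gamma> \<Gamma> c d]
    linear_add[OF base.local_deriv_linear[OF c d]] linear_scale[OF base.local_deriv_linear[OF c d]]
  by (simp add: algebra_simps)

lemma christoffel_warped: "christoffel_symbols H W warped_metric warped_symbols"
  unfolding christoffel_symbols_def
proof (intro conjI ballI allI)
  fix k p assume "k \<in> charts W" "p \<in> chart_image k"
  then obtain c where k: "c \<in> charts N" "k = lift c" "p \<in> chart_image (lift c)"
    unfolding charts_W by blast
  then obtain z t where c: "c \<in> charts N" "k = lift c" "p = (z, t)" "z \<in> chart_image c" "t \<in> I"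
    unfolding chart_image_lift by blast
  fix u v w
  show "linear (warped_symbols k p u)" "warped_symbols k p u v = warped_symbols k p v u"
    unfolding c(2,3) by (rule warped_symbols_linear[OF c(1,4)], rule warped_symbols_sym[OF c(1,4)])
  show "dwithin H (\<lambda>y. metric_rep W warped_metric k y u v) p w =
      metric_rep W warped_metric k p (warped_symbols k p w u) v +
      metric_rep W warped_metric k p u (warped_symbols k p w v)"
    unfolding c(2,3) by (rule warped_symbols_metric[OF c(1,4,5)])
next
  fix k u v assume "k \<in> charts W"
  then obtain c where c: "c \<in> charts N" "k = lift c"
    unfolding charts_W by blast
  show "smooth_on (\<lambda>z. warped_symbols k z u v) (chart_image k)"
    unfolding c(2) chart_image_lift by (rule warped_symbols_smooth[OF c(1)])
next
  fix q k l u v assume k: "k \<in> charts_at W q" and l: "l \<in> charts_at W q"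
  obtain x t where q: "q = (x, t)"
    by fastforce
  obtain c where c: "c \<in> charts_at N x" "t \<in> I" "k = lift c"
    by (rule charts_at_WE[OF k[unfolded q]])
  obtain d where d: "d \<in> charts_at N x" "t \<in> I" "l = lift d"
    by (rule charts_at_WE[OF l[unfolded q]])
  show "local_deriv id k l q (warped_symbols k (snd k q) u v) =
      dwithin H (\<lambda>z. dwithin H (local_rep id k l) z v) (snd k q) u +
      warped_symbols l (snd l q) (local_deriv id k l q u) (local_deriv id k l q v)"
    unfolding c(3) d(3) q snd_lift_chart by (rule warped_symbols_change[OF c(1) d(1) c(2)])
qed

lemmas levi_civita_warped =
  total.levi_civita_christoffel_connection[OF pseudo_riemannian_warped christoffel_warped]

end

section \<open>Compactification of the cone\<close>

text \<open>Serves for the inverse in \<open>diffeomorphism\<close>: \<open>inv_into\<close> agrees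
  with an explicit inverse only on the points of the manifold.\<close>

lemma (in model_manifold) smooth_map_cong:
  assumes F: "smooth_map M M' F" and eq: "\<And>p. p \<in> points M \<Longrightarrow> F p = G p"
  shows "smooth_map M M' G"
  unfolding smooth_map_def
proof (intro conjI ballI)
  show "continuous_map (mtop M) (mtop M') G"
    by (rule continuous_map_eq[OF _ eq]) (use F in \<open>simp_all add: smooth_map_def\<close>)
  fix c d assume c: "c \<in> charts M" and d: "d \<in> charts M'"
  have "fst c \<inter> F -` fst d = fst c \<inter> G -` fst d"
    using eq chart_point[OF c] by auto
  then have dom: "local_dom F c d = local_dom G c d"
    by (simp add: local_dom_def)
  have "smooth_on (local_rep F c d) (local_dom F c d)"
    using F c d by (simp add: smooth_map_def)
  then show "smooth_on (local_rep G c d) (local_dom G c d)"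
    unfolding dom
  proof (rule smooth_on_cong)
    fix z assume "z \<in> local_dom G c d"
    then obtain p where "p \<in> fst c" "z = snd c p"
      by (auto simp: local_dom_def)
    then show "local_rep F c d z = local_rep G c d z"
      using local_rep_eq[OF c] eq chart_point[OF c] by metis
  qed
qed

definition invert_radius :: "'a \<times> real \<Rightarrow> 'a \<times> real" where
  "invert_radius q = (fst q, 1 / snd q)"

definition boundary_function :: "'a \<times> real \<Rightarrow> real" where
  "boundary_function q = snd q / sqrt (1 + (snd q)\<^sup>2)"

text \<open>The differential of \<^const>\<open>invert_radius\<close> at radius \<open>r\<close>, in product coordinates.\<close>

definition flip :: "real \<Rightarrow> 'e \<times> real \<Rightarrow> 'e \<times> real" where
  "flip r v = (fst v, - snd v / r\<^sup>2)"

lemma one_plus_square_pos: "1 + (t::real)\<^sup>2 > 0"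
  by (simp add: add_pos_nonneg)

lemma one_plus_square_nz: "1 + (t::real)\<^sup>2 \<noteq> 0"
  using one_plus_square_pos[of t] by linarith

lemma boundary_function_inverse:
  assumes "s > 0"
  shows "boundary_function (invert_radius (y, s)) = 1 / sqrt (1 + s\<^sup>2)"
proof -
  have "sqrt (1 + s\<^sup>2) = sqrt (s\<^sup>2 * (1 + (1 / s)\<^sup>2))"
    using assms by (simp add: field_simps)
  also have "\<dots> = s * sqrt (1 + (1 / s)\<^sup>2)"
    using assms by (simp add: real_sqrt_mult)
  finally show ?thesis
    using assms by (simp add: boundary_function_def invert_radius_def)
qed

locale metric_cone = base: model_manifold UNIV N for N :: "('a, 'e::euclidean_space) mfd" +
  fixes \<gamma> :: "('a, 'e) metric" and \<Gamma> :: "('a, 'e) chart \<Rightarrow> 'e \<Rightarrow> 'e \<Rightarrow> 'e \<Rightarrow> 'e"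
  assumes \<gamma>: "pseudo_riemannian_metric N \<gamma>" and \<Gamma>: "christoffel_symbols UNIV N \<gamma> \<Gamma>"
begin

sublocale cone: warped_product N UNIV "{0<..}" \<gamma> "\<lambda>t. 1" "\<lambda>t. 0" "\<lambda>t. t\<^sup>2" "\<lambda>t. 2 * t" \<Gamma>
proof unfold_locales
  show "((\<lambda>t. t\<^sup>2) has_real_derivative 2 * t) (at t)" for t :: real
    by (auto intro!: derivative_eq_intros)
qed (auto intro!: upward_UNIV \<gamma> \<Gamma> smooth_on_const smooth_on_power smooth_on_mult smooth_on_id
    simp: gt_ex)

text \<open>Since \<open>1 + s^2\<close> never vanishes, the warping functions and their derivatives
  are regular on the whole line, which provides smoothness at the boundary value
  \<open>s = 0\<close>.\<close>

sublocale compact: warped_product N "{0..}" "{0..}" \<gamma> "\<lambda>s. 1 / (1 + s\<^sup>2)\<^sup>2" "\<lambda>s. - 4 * s / (1 + s\<^sup>2) ^ 3"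
  "\<lambda>s. 1 / (1 + s\<^sup>2)" "\<lambda>s. - 2 * s / (1 + s\<^sup>2)\<^sup>2" \<Gamma>
proof unfold_locales
  show "upward {0::real..}"
    by (auto simp: upward_def)
  show "((\<lambda>s. 1 / (1 + s\<^sup>2)\<^sup>2) has_real_derivative - 4 * s / (1 + s\<^sup>2) ^ 3) (at s)" for s :: real
    using one_plus_square_nz[of s]
    by (auto intro!: derivative_eq_intros simp: divide_simps power2_eq_square power3_eq_cube)
  show "((\<lambda>s. 1 / (1 + s\<^sup>2)) has_real_derivative - 2 * s / (1 + s\<^sup>2)\<^sup>2) (at s)" for s :: real
    using one_plus_square_nz[of s]
    by (auto intro!: derivative_eq_intros simp: divide_simps power2_eq_square)
qed (auto intro!: \<gamma> \<Gamma> smooth_on_minus smooth_on_divide smooth_on_add smooth_on_const smooth_on_power smooth_on_mult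
    smooth_on_id simp: one_plus_square_nz)

lemma cone_manifold_eq: "cone_manifold N = cone.W"
  by (simp add: cone_manifold_def cone.W_def positive_reals_def line_mfd_def)

lemma cone_metric_eq: "cone_metric N \<gamma> = cone.warped_metric"
  by (intro ext) (simp add: cone_metric_def cone.warped_metric_def Let_def cone_manifold_eq)

section \<open>Boundary and interior of the compactified cone\<close>

lemma boundary_points_compact: "boundary_points compact.W = points N \<times> {0}"
proof -
  have "(\<exists>c\<in>charts_at compact.W (x, s). snd (snd c (x, s)) = 0) \<longleftrightarrow> s = 0"
    if "x \<in> points N" "s \<ge> 0" for x s
  proof -
    have "\<exists>D k. (D, k) \<in> charts_at N x"
      using base.some_chart_at[OF that(1)] by (metis surj_pair)
    then show ?thesis
      using that by (auto simp: compact.charts_at_W snd_lift_chart)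
  qed
  then show ?thesis
    by (auto simp: boundary_points_def compact.points_W)
qed

lemma interior_points_compact: "interior_points compact.W = points N \<times> {0<..}"
proof -
  have "(\<exists>c\<in>charts_at compact.W (x, s). 0 < snd (snd c (x, s))) \<longleftrightarrow> 0 < s"
    if "x \<in> points N" "s \<ge> 0" for x s
  proof -
    have "\<exists>D k. (D, k) \<in> charts_at N x"
      using base.some_chart_at[OF that(1)] by (metis surj_pair)
    then show ?thesis
      using that by (auto simp: compact.charts_at_W snd_lift_chart)
  qed
  then show ?thesis
    by (auto simp: interior_points_def compact.points_W)
qed

text \<open>Cutting the charts down to \<open>s > 0\<close> gives exactly the lifted charts of the
  cone, so interior and cone are equal as structures and not only diffeomorphic. The identification
  of the cone with the interior can then be a self-map of the cone.\<close>

lemma interior_compact: "open_submanifold compact.W (interior_points compact.W) = cone.W"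
proof (rule mfd.equality)
  have "{0..} \<inter> {0<..} = {0::real<..}"
    by auto
  then show "mtop (open_submanifold compact.W (interior_points compact.W)) = mtop cone.W"
    by (simp add: open_submanifold_def interior_points_compact compact.mtop_W cone.mtop_W
        subtopology_Times subtopology_subtopology)
  have "(fst (compact.lift c) \<inter> points N \<times> {0<..}, snd (compact.lift c)) = cone.lift c" if "c \<in> charts N" for c
    using base.chart_subset[OF that] by (auto simp: lift_chart_def)
  then have "(\<lambda>c. (fst c \<inter> points N \<times> {0<..}, snd c)) ` compact.lift ` charts N = cone.lift ` charts N"
    unfolding image_image by (rule image_cong[OF refl])
  then show "charts (open_submanifold compact.W (interior_points compact.W)) = charts cone.W"
    by (simp add: open_submanifold_def interior_points_compact compact.charts_W cone.charts_W)
qed simp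

section \<open>Inversion of the radius as a diffeomorphism\<close>

lemma local_dom_invert:
  assumes "I' = {0<..} \<or> I' = {0..}"
  shows "local_dom invert_radius (cone.lift c) (lift_chart I' d) = snd c ` (fst c \<inter> fst d) \<times> {0<..}"
proof -
  have "fst (cone.lift c) \<inter> invert_radius -` fst (lift_chart I' d) = (fst c \<inter> fst d) \<times> {0<..}"
    using assms by (auto simp: fst_lift_chart invert_radius_def)
  then show ?thesis
    by (simp add: local_dom_def lift_chart_def map_prod_id_image)
qed

lemma local_rep_invert:
  assumes "c \<in> charts N" "z \<in> chart_image c" "t > 0"
  shows "local_rep invert_radius (cone.lift c) (lift_chart I' d) (z, t) = (local_rep id c d z, 1 / t)"
  using cone.inv_chart_lift[OF assms(1,2), of t] assms(3)
  by (simp add: local_rep_def invert_radius_def snd_lift_chart)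

lemma smooth_invert: "smooth_map cone.W cone.W invert_radius"
  unfolding smooth_map_def
proof (intro conjI ballI)
  have "continuous_map (prod_topology (mtop N) (top_of_set {0<..})) (prod_topology (mtop N) (top_of_set {0<..}))
      (\<lambda>(x, r). (x, 1 / r :: real))"
    unfolding continuous_map_prod_top by (auto intro!: continuous_intros)
  moreover have eq: "invert_radius = (\<lambda>(x, r). (x, 1 / r))"
    by (auto simp: invert_radius_def)
  ultimately show "continuous_map (mtop cone.W) (mtop cone.W) invert_radius"
    unfolding cone.mtop_W eq by blast
  fix k l assume "k \<in> charts cone.W" "l \<in> charts cone.W"
  then obtain c d where c: "c \<in> charts N" "k = cone.lift c" and d: "d \<in> charts N" "l = cone.lift d"
    unfolding cone.charts_W by blast
  show "smooth_on (local_rep invert_radius k l) (local_dom invert_radius k l)"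
    unfolding c(2) d(2) local_dom_invert[OF disjI1[OF refl]]
  proof (rule smooth_on_cong)
    show "smooth_on (\<lambda>p. (local_rep id c d (fst p), 1 / snd p)) (snd c ` (fst c \<inter> fst d) \<times> {0::real<..})"
      by (intro smooth_on_Pair cone.smooth_on_fst_comp base.transition_smooth c(1) d(1) smooth_on_divide
          smooth_on_const smooth_on_snd smooth_on_id) auto
    show "(local_rep id c d (fst p), 1 / snd p) = local_rep invert_radius (cone.lift c) (cone.lift d) p"
      if "p \<in> snd c ` (fst c \<inter> fst d) \<times> {0::real<..}" for p
      using local_rep_invert[OF c(1), of "fst p" "snd p" "{0<..}" d] that by auto
  qed
qed

text \<open>Inversion of the radius is an involution of the cone, so smoothness of the inverse is
  smoothness of the map itself.\<close>

lemma diffeomorphism_invert: "diffeomorphism cone.W cone.W invert_radius"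
  unfolding diffeomorphism_def
proof (intro conjI smooth_invert)
  show bij: "bij_betw invert_radius (points cone.W) (points cone.W)"
    by (rule bij_betwI[where g=invert_radius]) (auto simp: cone.points_W invert_radius_def)
  have "inv_into (points cone.W) invert_radius p = invert_radius p" if "p \<in> points cone.W" for p
  proof (rule inv_into_f_eq[OF bij_betw_imp_inj_on[OF bij]])
    show "invert_radius p \<in> points cone.W" "invert_radius (invert_radius p) = p"
      using that by (auto simp: cone.points_W invert_radius_def)
  qed
  then show "smooth_map cone.W cone.W (inv_into (points cone.W) invert_radius)"
    by (intro cone.total.smooth_map_cong[OF smooth_invert]) simp
qed

section \<open>The boundary defining function and its logarithmic derivative\<close>

lemma smooth_boundary_function: "smooth_function compact.W boundary_function"
  unfolding smooth_function_def
proof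
  fix k assume "k \<in> charts compact.W"
  then obtain c where c: "c \<in> charts N" "k = compact.lift c"
    unfolding compact.charts_W by blast
  show "smooth_on (boundary_function \<circ> inv_chart k) (chart_image k)"
    unfolding c(2) chart_image_lift
  proof (rule smooth_on_cong)
    show "smooth_on (\<lambda>p. snd p / sqrt (1 + (snd p)\<^sup>2)) (chart_image c \<times> {0..})"
      by (intro smooth_on_divide smooth_on_sqrt smooth_on_add smooth_on_power smooth_on_const
          smooth_on_snd smooth_on_id) (auto simp: one_plus_square_pos one_plus_square_nz)
    show "snd p / sqrt (1 + (snd p)\<^sup>2) = (boundary_function \<circ> inv_chart (compact.lift c)) p"
      if "p \<in> chart_image c \<times> {0..}" for p
      using compact.inv_chart_lift[OF c(1), of "fst p" "snd p"] that
      by (auto simp: boundary_function_def)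
  qed
qed

text \<open>The witness is the coordinate vector in the direction of \<open>s\<close>, since
  \<open>s / sqrt (1 + s^2)\<close> has derivative 1 at 0.\<close>

lemma boundary_function_regular:
  assumes "q \<in> boundary_points compact.W"
  shows "\<exists>v\<in>tangent_space compact.W q. dfun compact.W boundary_function q v \<noteq> 0"
proof -
  obtain x where x: "x \<in> points N" "q = (x, 0)"
    using assms unfolding boundary_points_compact by blast
  define c where "c = some_chart N x"
  have c: "c \<in> charts_at N x"
    unfolding c_def by (rule base.some_chart_at[OF x(1)])
  have 0: "(0::real) \<in> {0..}"
    by simp
  note k = compact.lift_charts_at[OF c 0]
  define v where "v = coord_vector compact.W (compact.lift c) (x, 0) (0, 1)"
  have v: "v \<in> tangent_space compact.W (x, 0)"
    unfolding v_def by (rule compact.total.coord_vector_tangent[OF k])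
  have "((\<lambda>s::real. s / sqrt (1 + s\<^sup>2)) has_real_derivative 1) (at 0)"
    by (auto intro!: derivative_eq_intros)
  then have "dfun compact.W boundary_function (x, 0) v = 1 * snd (v (compact.lift c))"
    by (rule compact.dfun_snd_comp[OF c 0 v, rotated]) (simp add: boundary_function_def)
  moreover have "v (compact.lift c) = (0, 1)"
    unfolding v_def by (rule compact.total.coord_vector_same[OF k])
  ultimately show ?thesis
    using v x(2) by (intro bexI[of _ v]) simp_all
qed

text \<open>The form \<open>\<Upsilon> = dT / (\<alpha> T)\<close> is expressed in the radius, where
  the square roots cancel. The factor \<open>1\<close> in the denominator is the order
  \<open>\<alpha>\<close>.\<close>

lemma log_derivative:
  assumes c: "c \<in> charts_at N x" and r: "r > 0" and v: "v \<in> tangent_space cone.W (x, r)"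
  shows "dfun cone.W (boundary_function \<circ> invert_radius) (x, r) v / (1 * boundary_function (invert_radius (x, r))) =
    - r / (1 + r\<^sup>2) * snd (v (cone.lift c))"
proof -
  have s: "sqrt (1 + r\<^sup>2) > 0"
    using one_plus_square_pos[of r] by simp
  have "((\<lambda>s. 1 / sqrt (1 + s\<^sup>2)) has_real_derivative - r / ((1 + r\<^sup>2) * sqrt (1 + r\<^sup>2))) (at r)"
    using s one_plus_square_pos[of r]
    by (auto intro!: derivative_eq_intros simp: field_simps)
  then have "dfun cone.W (boundary_function \<circ> invert_radius) (x, r) v =
      - r / ((1 + r\<^sup>2) * sqrt (1 + r\<^sup>2)) * snd (v (cone.lift c))"
    using r by (intro cone.dfun_snd_comp[OF c _ v]) (simp_all add: boundary_function_inverse)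
  then show ?thesis
    using s by (simp add: boundary_function_inverse[OF r])
qed

section \<open>Inversion acting on tangent vectors, vector fields and their derivatives\<close>

lemma invert_has_derivative:
  fixes r :: real
  assumes "r > 0"
  shows "((\<lambda>p. (fst p, 1 / snd p)) has_derivative flip r) (at (z :: 'e, r) within S)"
proof -
  have "((\<lambda>s. 1 / s) has_real_derivative - 1 / r\<^sup>2) (at r)"
    using assms by (auto intro!: derivative_eq_intros simp: power2_eq_square)
  then have "((\<lambda>p. (fst p, 1 / snd p)) has_derivative (\<lambda>v. (fst v, - 1 / r\<^sup>2 * snd v))) (at (z, r) within S)"
    by (intro has_derivative_Pair has_derivative_fst has_derivative_ident cone.has_derivative_snd_comp)
  then show ?thesis
    by (rule has_derivative_eq_rhs) (simp add: flip_def fun_eq_iff)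
qed

text \<open>For a target chart over a base chart, the source vector is read in the cone chart over
  the same base chart. The base transition drops out and only \<open>flip r\<close> remains.\<close>

lemma differential_invert:
  assumes x: "x \<in> points N" and r: "r > 0" and v: "v \<in> tangent_space cone.W (x, r)"
  shows "differential cone.W compact.W invert_radius (x, r) v k =
    (if k \<in> charts_at compact.W (x, 1 / r) then flip r (v (cone.lift (base_chart k))) else 0)"
proof (cases "k \<in> charts_at compact.W (x, 1 / r)")
  case True
  then obtain d where d: "d \<in> charts_at N x" "k = compact.lift d"
    by (rule compact.charts_at_WE)
  have r': "r \<in> {0<..}"
    using r by simp
  obtain e where e: "e \<in> charts_at N x" "some_chart cone.W (x, r) = cone.lift e"
    by (rule cone.some_chart_W[OF x r'])
  have dd: "d \<in> charts N" "x \<in> fst d" and ee: "e \<in> charts N" "x \<in> fst e"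
    using d(1) e(1) by (auto simp: charts_at_iff)
  let ?S = "snd e ` (fst e \<inter> fst d)"
  have op: "openin (top_of_set cone.H) (?S \<times> {0::real<..})"
    by (rule openin_Times[OF base.local_dom_openin[OF ee(1) dd(1)] cone.I])
  have z: "(snd e x, r) \<in> ?S \<times> {0::real<..}" "(snd e x, r) \<in> cone.H"
    using dd ee r by auto
  have 1: "((\<lambda>s. 1 / s) has_real_derivative - 1 / r\<^sup>2) (at r)"
    using r by (auto intro!: derivative_eq_intros simp: power2_eq_square)
  have D: "((\<lambda>p. (local_rep id e d (fst p), 1 / snd p)) has_derivative
      (\<lambda>v. (local_deriv id e d x (fst v), - 1 / r\<^sup>2 * snd v))) (at (snd e x, r) within cone.H)"
    by (intro has_derivative_Pair cone.has_derivative_fst_comp cone.has_derivative_snd_comp[OF 1]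
        base.transition_has_derivative[OF e(1) d(1)])
  have "(local_rep invert_radius (cone.lift e) k has_derivative
      (\<lambda>v. (local_deriv id e d x (fst v), - 1 / r\<^sup>2 * snd v))) (at (snd e x, r) within cone.H)"
  proof (rule has_derivative_cong_openin[OF op z(1) _ D])
    fix p assume "p \<in> ?S \<times> {0::real<..}"
    then show "(local_rep id e d (fst p), 1 / snd p) = local_rep invert_radius (cone.lift e) k p"
      using local_rep_invert[OF ee(1), of "fst p" "snd p" "{0..}" d] unfolding d(2) by auto
  qed
  from dwithin_eq[OF cone.upward_H z(2) this]
  have "local_deriv invert_radius (cone.lift e) k (x, r) w =
      (local_deriv id e d x (fst w), - 1 / r\<^sup>2 * snd w)" for w
    unfolding local_deriv_def[of invert_radius] d(2) local_dom_invert[OF disjI2[OF refl]] snd_lift_chart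
      frechet_derivative_openin[OF op z(1)] by simp
  then show ?thesis
    using True cone.tangent_lift[OF v e(1) d(1) r']
    by (simp add: differential_def e(2) invert_radius_def flip_def d(2) base_lift_chart)
qed (simp add: differential_def invert_radius_def)

lemma related_rep:
  assumes "X \<in> vector_fields cone.W" "related_vf cone.W compact.W invert_radius X X'"
    and c: "c \<in> charts_at N x" and r: "r > 0"
  shows "X' (x, 1 / r) (compact.lift c) = flip r (X (x, r) (cone.lift c))"
proof -
  have x: "x \<in> points N"
    using c base.chart_point unfolding charts_at_iff by blast
  then have p: "(x, r) \<in> points cone.W"
    using r by (simp add: cone.points_W)
  have "compact.lift c \<in> charts_at compact.W (x, 1 / r)"
    by (rule compact.lift_charts_at[OF c]) (use r in simp)
  then have "differential cone.W compact.W invert_radius (x, r) (X (x, r)) (compact.lift c) =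
      flip r (X (x, r) (cone.lift c))"
    using differential_invert[OF x r vector_fields_tangent[OF assms(1) p], of "compact.lift c"]
    by (simp add: base_lift_chart)
  moreover have "X' (x, 1 / r) = differential cone.W compact.W invert_radius (x, r) (X (x, r))"
    using assms(2) p unfolding related_vf_def invert_radius_def by (metis fst_conv snd_conv)
  ultimately show ?thesis
    by simp
qed

text \<open>Differentiating \<^term>\<open>Y' (x, 1 / r) = flip r (Y (x, r))\<close>.\<close>

lemma related_derivative:
  assumes Y: "Y \<in> vector_fields cone.W" and Y': "Y' \<in> vector_fields compact.W"
    and rel: "related_vf cone.W compact.W invert_radius Y Y'"
    and c: "c \<in> charts_at N x" and r: "r > 0"
  shows "dwithin compact.H (vf_rep Y' (compact.lift c)) (snd c x, 1 / r) (flip r u) =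
    flip r (dwithin cone.H (vf_rep Y (cone.lift c)) (snd c x, r) u) +
    (0, 2 * snd u * snd (Y (x, r) (cone.lift c)) / r ^ 3)"
proof -
  have cc: "c \<in> charts N" "x \<in> fst c"
    using c by (auto simp: charts_at_iff)
  let ?y = "vf_rep Y (cone.lift c)" and ?y' = "vf_rep Y' (compact.lift c)"
  let ?D = "dwithin cone.H ?y (snd c x, r)"
  have r': "r \<in> {0<..}"
    using r by simp
  note k = cone.lift_charts_at[OF c r']
  note op = cone.chart_image_lift_openin[OF cc(1)]
  have z: "(snd c x, r) \<in> chart_image (cone.lift c)" "(snd c x, r) \<in> cone.H"
    using cc r by (auto simp: chart_image_lift)
  have yz: "?y (snd c x, r) = Y (x, r) (cone.lift c)"
    using cone.total.vf_rep_chart[of "cone.lift c" "(x, r)" Y] k by (simp add: charts_at_iff snd_lift_chart)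
  have L: "((\<lambda>p. ?y' (fst p, 1 / snd p)) has_derivative
      (\<lambda>v. dwithin compact.H ?y' (fst (snd c x, r), 1 / snd (snd c x, r)) (flip r v)))
      (at (snd c x, r) within cone.H)"
    by (rule has_derivative_chain_openin[OF compact.upward_H op compact.chart_image_lift_openin[OF cc(1)] z(1) _
          invert_has_derivative[OF r] vector_fields_smooth[OF Y' compact.lift_charts[OF cc(1)]]])
      (auto simp: chart_image_lift)
  have Dy: "(?y has_derivative ?D) (at (snd c x, r) within cone.H)"
    using cone.total.vf_rep_has_derivative[OF Y k] by (simp add: snd_lift_chart)
  \<comment> \<open>The factor \<open>1 / r^2\<close> of \<open>flip\<close> varies with the point;
    its derivative is the source of the additional radial term with \<open>r ^ 3\<close> in the
    conclusion.\<close>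
  have inv2: "((\<lambda>s. 1 / s\<^sup>2) has_real_derivative - 2 / r ^ 3) (at r)"
    using r by (auto intro!: derivative_eq_intros simp: field_simps power2_eq_square power3_eq_cube)
  have R: "((\<lambda>p. (fst (?y p), - (snd (?y p) * (1 / (snd p)\<^sup>2)))) has_derivative
      (\<lambda>v. (fst (?D v), - (snd (?y (snd c x, r)) * (- 2 / r ^ 3 * snd v) +
         snd (?D v) * (1 / (snd (snd c x, r))\<^sup>2))))) (at (snd c x, r) within cone.H)"
    by (intro has_derivative_Pair has_derivative_fst has_derivative_minus has_derivative_mult has_derivative_snd Dy
        cone.has_derivative_snd_comp[OF inv2])
  have "((\<lambda>p. ?y' (fst p, 1 / snd p)) has_derivative
      (\<lambda>v. (fst (?D v), - (snd (?y (snd c x, r)) * (- 2 / r ^ 3 * snd v) +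
         snd (?D v) * (1 / (snd (snd c x, r))\<^sup>2))))) (at (snd c x, r) within cone.H)"
  proof (rule has_derivative_cong_openin[OF op z(1) _ R])
    fix p assume "p \<in> chart_image (cone.lift c)"
    then obtain q s where q: "p = (snd c q, s)" "q \<in> fst c" "s > 0"
      unfolding chart_image_lift by auto
    then have cq: "c \<in> charts_at N q"
      using cc by (simp add: charts_at_iff)
    have "?y p = Y (q, s) (cone.lift c)" "?y' (snd c q, 1 / s) = Y' (q, 1 / s) (compact.lift c)"
      using cone.total.vf_rep_chart[of "cone.lift c" "(q, s)" Y] cone.lift_charts[OF cc(1)]
        compact.total.vf_rep_chart[of "compact.lift c" "(q, 1 / s)" Y'] compact.lift_charts[OF cc(1)] q
      by (simp_all add: fst_lift_chart snd_lift_chart)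
    then show "(fst (?y p), - (snd (?y p) * (1 / (snd p)\<^sup>2))) = ?y' (fst p, 1 / snd p)"
      using related_rep[OF Y rel cq q(3)] q by (simp add: flip_def)
  qed
  \<comment> \<open>One function has been differentiated by the chain rule through the inversion and
    by the product rule; uniqueness equates the two results.\<close>
  from dwithin_eq[OF cone.upward_H z(2) L] dwithin_eq[OF cone.upward_H z(2) this]
  show ?thesis
    by (auto simp: fun_eq_iff yz flip_def field_simps)
qed

text \<open>The transformation law of symbols under \<open>s = 1 / r\<close>, with the projective
  terms added on the cone side; \<open>2 / r ^ 3\<close> is the second derivative of
  \<open>1 / r\<close>. Here the defining function and both warping functions of the
  compactification have to fit together.\<close>

lemma symbols_projectively_related:
  assumes r: "r > 0"
  shows "flip r (cone.warped_symbols (cone.lift c) (z, r) u v + (- r / (1 + r\<^sup>2) * snd u) *\<^sub>R v +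
      (- r / (1 + r\<^sup>2) * snd v) *\<^sub>R u) =
    (0, 2 * snd u * snd v / r ^ 3) + compact.warped_symbols (compact.lift c) (z, 1 / r) (flip r u) (flip r v)"
proof (rule prod_eqI)
  let ?s = "1 / r"
  let ?k = "- 2 * ?s / (1 + ?s\<^sup>2)\<^sup>2 / (2 * (1 / (1 + ?s\<^sup>2)))"
  have n: "1 + r\<^sup>2 \<noteq> 0" "r \<noteq> 0"
    using one_plus_square_nz r by auto
  have s: "1 + ?s\<^sup>2 = (1 + r\<^sup>2) / r\<^sup>2"
    using n by (simp add: field_simps)
  \<comment> \<open>The mixed coefficients: \<open>?k\<close> is \<open>b' / (2 b)\<close> of the
    compactification, and on the right stand \<open>b' / (2 b)\<close> of the cone and the
    coefficient of \<open>\<Upsilon>\<close>. The fraction \<open>2 * r / (2 * r^2)\<close> stays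
    unreduced to match the unfolded symbols.\<close>
  have k: "?k * (- 1 / r\<^sup>2) = 2 * r / (2 * r\<^sup>2) - r / (1 + r\<^sup>2)"
    unfolding s using n by (simp add: divide_simps power2_eq_square)
  have F: "\<kappa> *\<^sub>R ((- p / r\<^sup>2) *\<^sub>R x + (- q / r\<^sup>2) *\<^sub>R y) =
      (\<kappa> * (- 1 / r\<^sup>2)) *\<^sub>R (p *\<^sub>R x + q *\<^sub>R y)" for \<kappa> p q and x y :: 'e
    by (simp add: algebra_simps)
  show "fst (flip r (cone.warped_symbols (cone.lift c) (z, r) u v + (- r / (1 + r\<^sup>2) * snd u) *\<^sub>R v +
      (- r / (1 + r\<^sup>2) * snd v) *\<^sub>R u)) =
    fst ((0, 2 * snd u * snd v / r ^ 3) + compact.warped_symbols (compact.lift c) (z, 1 / r) (flip r u) (flip r v))"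
    unfolding cone.warped_symbols_lift compact.warped_symbols_lift flip_def fst_conv snd_conv fst_add
      fst_scaleR F k
    by (simp add: scaleR_left_diff_distrib scaleR_add_right left_diff_distrib)
  show "snd (flip r (cone.warped_symbols (cone.lift c) (z, r) u v + (- r / (1 + r\<^sup>2) * snd u) *\<^sub>R v +
      (- r / (1 + r\<^sup>2) * snd v) *\<^sub>R u)) =
    snd ((0, 2 * snd u * snd v / r ^ 3) + compact.warped_symbols (compact.lift c) (z, 1 / r) (flip r u) (flip r v))"
    unfolding cone.warped_symbols_lift compact.warped_symbols_lift flip_def fst_conv snd_conv snd_add s snd_scaleR
    using n by (simp add: divide_simps power2_eq_square power3_eq_cube) (simp add: algebra_simps)
qed

section \<open>The projectively changed cone connection and its extension\<close>

abbreviation "cone_connection \<equiv> christoffel_connection cone.H cone.W cone.warped_symbols"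

abbreviation "compact_connection \<equiv> christoffel_connection compact.H compact.W compact.warped_symbols"

text \<open>In a lifted chart, differentiating the related fields leaves over the second derivative
  of the inversion, which is the same term as in the comparison of the symbols. Adding the two
  identities gives the relation of the covariant derivatives; away from the charts both sides are
  0.\<close>

lemma compact_connection_extends:
  "connection_extends cone.W compact.W invert_radius
     (projective_change (\<lambda>p v. dfun cone.W (boundary_function \<circ> invert_radius) p v /
        (1 * boundary_function (invert_radius p))) cone_connection)
     compact_connection"
  unfolding connection_extends_def
proof (intro conjI ballI impI)
  show "affine_connection compact.W compact_connection"
    using compact.levi_civita_warped by (simp add: levi_civita_def)
  let ?\<Upsilon> = "\<lambda>p v. dfun cone.W (boundary_function \<circ> invert_radius) p v / (1 * boundary_function (invert_radius p))"
  fix X Y X' Y'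
  assume X: "X \<in> vector_fields cone.W" and Y: "Y \<in> vector_fields cone.W"
    and X': "X' \<in> vector_fields compact.W" and Y': "Y' \<in> vector_fields compact.W"
    and relX: "related_vf cone.W compact.W invert_radius X X'"
    and relY: "related_vf cone.W compact.W invert_radius Y Y'"
  let ?P = "projective_change ?\<Upsilon> cone_connection X Y"
  show "related_vf cone.W compact.W invert_radius ?P (compact_connection X' Y')"
    unfolding related_vf_def
  proof
    fix p assume p: "p \<in> points cone.W"
    then obtain x r where xr: "p = (x, r)" "x \<in> points N" "r > 0"
      by (auto simp: cone.points_W)
    note Xp = vector_fields_tangent[OF X p] and Yp = vector_fields_tangent[OF Y p]
    \<comment> \<open>The factors 1 put the changed derivative into the shape of two nested linear
      combinations, so that closure of the tangent space applies.\<close>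
    have "(\<lambda>k. 1 *\<^sub>R (1 *\<^sub>R cone_connection X Y p k + ?\<Upsilon> p (X p) *\<^sub>R Y p k) + ?\<Upsilon> p (Y p) *\<^sub>R X p k)
        \<in> tangent_space cone.W p"
      by (intro cone.total.tangent_space_lincomb Xp Yp cone.total.connection_tangent[OF
            cone.pseudo_riemannian_warped cone.christoffel_warped X Y p])
    then have P: "?P p \<in> tangent_space cone.W (x, r)"
      by (simp add: projective_change_def xr(1))
    show "compact_connection X' Y' (invert_radius p) = differential cone.W compact.W invert_radius p (?P p)"
    proof
      fix k
      show "compact_connection X' Y' (invert_radius p) k =
          differential cone.W compact.W invert_radius p (?P p) k"
      proof (cases "k \<in> charts_at compact.W (x, 1 / r)")
        case True
        then obtain c where c: "c \<in> charts_at N x" "k = compact.lift c"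
          by (rule compact.charts_at_WE)
        have r: "r \<in> {0<..}" "1 / r \<in> {0..}"
          using xr(3) by simp_all
        note kc = cone.lift_charts_at[OF c(1) r(1)] and kb = compact.lift_charts_at[OF c(1) r(2)]
        let ?u = "X (x, r) (cone.lift c)" and ?v = "Y (x, r) (cone.lift c)"
        let ?D = "dwithin cone.H (vf_rep Y (cone.lift c)) (snd c x, r) ?u"
        have flip_add: "flip r (a + b) = flip r a + flip r b" for a b :: "'e \<times> real"
          by (simp add: flip_def prod_eq_iff diff_divide_distrib)
        have Pc: "?P (x, r) (cone.lift c) = ?D + (cone.warped_symbols (cone.lift c) (snd c x, r) ?u ?v +
            (- r / (1 + r\<^sup>2) * snd ?u) *\<^sub>R ?v + (- r / (1 + r\<^sup>2) * snd ?v) *\<^sub>R ?u)"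
          unfolding projective_change_def log_derivative[OF c(1) xr(3) Xp[unfolded xr(1)]]
            log_derivative[OF c(1) xr(3) Yp[unfolded xr(1)]]
            cone.total.connection_chart[OF cone.pseudo_riemannian_warped cone.christoffel_warped kc]
            snd_lift_chart by (simp only: add.assoc)
        have "compact_connection X' Y' (x, 1 / r) k =
            dwithin compact.H (vf_rep Y' (compact.lift c)) (snd c x, 1 / r) (flip r ?u) +
            compact.warped_symbols (compact.lift c) (snd c x, 1 / r) (flip r ?u) (flip r ?v)"
          unfolding c(2) compact.total.connection_chart[OF compact.pseudo_riemannian_warped
              compact.christoffel_warped kb] snd_lift_chart related_rep[OF X relX c(1) xr(3)]
            related_rep[OF Y relY c(1) xr(3)] ..
        also have "\<dots> = flip r (?P (x, r) (cone.lift c))"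
          unfolding Pc related_derivative[OF Y Y' relY c(1) xr(3)] flip_add[of ?D]
            symbols_projectively_related[OF xr(3)] by (simp only: add.assoc)
        also have "\<dots> = differential cone.W compact.W invert_radius (x, r) (?P (x, r)) k"
          using differential_invert[OF xr(2,3) P[unfolded xr(1)], of k] True
          by (simp add: c(2) base_lift_chart)
        finally show ?thesis
          by (simp add: xr(1) invert_radius_def)
      next
        case False
        then show ?thesis
          using differential_invert[OF xr(2,3) P[unfolded xr(1)], of k]
          by (simp add: xr(1) invert_radius_def christoffel_connection_def)
      qed
    qed
  qed
qed

lemma projective_compactification_cone:
  "projective_compactification 1 cone.W cone_connection compact.W invert_radius boundary_function compact_connection"
  unfolding projective_compactification_def
proof (intro conjI ballI)
  have "compact.H = {x. 0 \<le> snd x}"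
    by auto
  then show "smooth_manifold_with_boundary compact.W"
    using compact.manifold_W by (simp add: smooth_manifold_with_boundary_def)
  have "points N \<noteq> {}"
    using base.manifold by (simp add: smooth_manifold_on_def)
  then show "boundary_points compact.W \<noteq> {}"
    by (simp add: boundary_points_compact)
  show "diffeomorphism cone.W (open_submanifold compact.W (interior_points compact.W)) invert_radius"
    unfolding interior_compact by (rule diffeomorphism_invert)
  show "{p \<in> points compact.W. boundary_function p = 0} = boundary_points compact.W"
    by (auto simp: boundary_points_compact compact.points_W boundary_function_def one_plus_square_nz)
qed (rule smooth_boundary_function boundary_function_regular compact_connection_extends | assumption)+

end

theorem theorem2p4:
  fixes N :: "('a, 'e::euclidean_space) mfd"
    and \<gamma> :: "('a, 'e) metric"
  assumes "smooth_manifold N"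
    and "pseudo_riemannian_metric N \<gamma>"
  shows "\<exists>nabla. levi_civita (cone_manifold N) (cone_metric N \<gamma>) nabla \<and>
           admits_metric_projective_compactification 1 (cone_manifold N) nabla"
proof -
  interpret bm: boundaryless_metric N \<gamma>
    by unfold_locales (use assms in \<open>simp_all add: smooth_manifold_def upward_UNIV\<close>)
  interpret metric_cone N \<gamma> bm.levi_civita_symbols
    by unfold_locales (rule assms(2), rule bm.christoffel_levi_civita_symbols)
  have "admits_metric_projective_compactification 1 cone.W cone_connection"
    unfolding admits_metric_projective_compactification_def
    using projective_compactification_cone compact.pseudo_riemannian_warped compact.levi_civita_warped
    by blast
  then show ?thesis
    unfolding cone_manifold_eq cone_metric_eq using cone.levi_civita_warped by blast
qed

end
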